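(* Let $G$ be a group acting on some hyperbolic space $X$, and assume that the action is not horocyclic. Then there exists a hyperbolic space $Y$ on which $G$ acts coboundedly such that the actions $G\curvearrowright X$ and $G\curvearrowright Y$ have the same type.
   Context: A hyperbolic space is a geodesic Gromov hyperbolic metric space (not necessarily proper) with Gromov boundary $\partial X$; actions on hyperbolic spaces are by isometries. An action is cobounded if some orbit is at finite Hausdorff distance from the space. For an action of $G$ on $X$, let $\Lambda(G)\subset\partial X$ be the set of accumulation points in $\partial X$ of a $G$-orbit. Every action has exactly one of the following types: elliptic if $|\Lambda(G)|=0$ (equivalently, bounded orbits); horocyclic if $|\Lambda(G)|=1$; lineal if $|\Lambda(G)|=2$; focal if $|\Lambda(G)|=\infty$ and $G$ fixes a point of $\partial X$; general type if $|\Lambda(G)|=\infty$ and $G$ fixes no point of $\partial X$. *)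

theory Defs
  imports "HOL-Analysis.Analysis" "HOL-Algebra.Group_Action"
begin

text \<open>Metric spaces are carrier-based (locale \<^locale>\<open>Metric_space\<close>), since the conclusion has to
  quantify existentially over spaces.\<close>

definition geodesic_space :: "'a set \<Rightarrow> ('a \<Rightarrow> 'a \<Rightarrow> real) \<Rightarrow> bool" where
  "geodesic_space M d \<longleftrightarrow>
     (\<forall>x\<in>M. \<forall>y\<in>M. \<exists>\<gamma>::real \<Rightarrow> 'a.
        \<gamma> 0 = x \<and> \<gamma> (d x y) = y \<and> \<gamma> ` {0..d x y} \<subseteq> M \<and>
        (\<forall>s\<in>{0..d x y}. \<forall>t\<in>{0..d x y}. d (\<gamma> s) (\<gamma> t) = \<bar>s - t\<bar>))"

definition gromov_product :: "('a \<Rightarrow> 'a \<Rightarrow> real) \<Rightarrow> 'a \<Rightarrow> 'a \<Rightarrow> 'a \<Rightarrow> real" where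
  "gromov_product d w x y = (d x w + d y w - d x y) / 2"

definition gromov_hyperbolic :: "'a set \<Rightarrow> ('a \<Rightarrow> 'a \<Rightarrow> real) \<Rightarrow> bool" where
  "gromov_hyperbolic M d \<longleftrightarrow>
     (\<exists>\<delta>\<ge>0. \<forall>w\<in>M. \<forall>x\<in>M. \<forall>y\<in>M. \<forall>z\<in>M.
        min (gromov_product d w x y) (gromov_product d w y z) - \<delta> \<le> gromov_product d w x z)"

text \<open>A hyperbolic space is nonempty (\<^locale>\<open>Metric_space\<close> allows an empty carrier); neither
  properness nor completeness is required.\<close>

definition hyperbolic_space :: "'a set \<Rightarrow> ('a \<Rightarrow> 'a \<Rightarrow> real) \<Rightarrow> bool" where
  "hyperbolic_space M d \<longleftrightarrow>
     Metric_space M d \<and> M \<noteq> {} \<and> geodesic_space M d \<and> gromov_hyperbolic M d"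

text \<open>The Gromov boundary consists of the equivalence classes of sequences converging to infinity.
  Such a sequence \<open>u\<close> is one with \<open>(u\<^sub>m|u\<^sub>n)\<^sub>w \<longlongrightarrow> \<infinity>\<close> as \<open>m, n \<longlongrightarrow> \<infinity>\<close>, and \<open>u\<close>, \<open>v\<close> are equivalent
  if \<open>(u\<^sub>m|v\<^sub>n)\<^sub>w \<longlongrightarrow> \<infinity>\<close>. Changing the base point \<open>w\<close> changes the products by a bounded amount, so
  it does not matter that all base points are quantified over.\<close>

definition asymptotic :: "'a set \<Rightarrow> ('a \<Rightarrow> 'a \<Rightarrow> real) \<Rightarrow> (nat \<Rightarrow> 'a) \<Rightarrow> (nat \<Rightarrow> 'a) \<Rightarrow> bool" where
  "asymptotic M d u v \<longleftrightarrow>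
     (\<forall>w\<in>M. filterlim (\<lambda>(m, n). gromov_product d w (u m) (v n)) at_top
              (sequentially \<times>\<^sub>F sequentially))"

definition gromov_sequences :: "'a set \<Rightarrow> ('a \<Rightarrow> 'a \<Rightarrow> real) \<Rightarrow> (nat \<Rightarrow> 'a) set" where
  "gromov_sequences M d = {u. range u \<subseteq> M \<and> asymptotic M d u u}"

definition gromov_boundary :: "'a set \<Rightarrow> ('a \<Rightarrow> 'a \<Rightarrow> real) \<Rightarrow> (nat \<Rightarrow> 'a) set set" where
  "gromov_boundary M d =
     gromov_sequences M d //
       {(u, v). u \<in> gromov_sequences M d \<and> v \<in> gromov_sequences M d \<and> asymptotic M d u v}"

text \<open>\<^const>\<open>group_action\<close> only demands bijections, so that the action is isometric is added.\<close>

definition isometric_action ::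
    "('g, 'm) monoid_scheme \<Rightarrow> 'a set \<Rightarrow> ('a \<Rightarrow> 'a \<Rightarrow> real) \<Rightarrow> ('g \<Rightarrow> 'a \<Rightarrow> 'a) \<Rightarrow> bool" where
  "isometric_action G M d \<phi> \<longleftrightarrow>
     group_action G M \<phi> \<and>
     (\<forall>g\<in>carrier G. \<forall>x\<in>M. \<forall>y\<in>M. d (\<phi> g x) (\<phi> g y) = d x y)"

definition finite_hausdorff_distance :: "('a \<Rightarrow> 'a \<Rightarrow> real) \<Rightarrow> 'a set \<Rightarrow> 'a set \<Rightarrow> bool" where
  "finite_hausdorff_distance d A B \<longleftrightarrow>
     (\<exists>C. (\<forall>a\<in>A. \<exists>b\<in>B. d a b \<le> C) \<and> (\<forall>b\<in>B. \<exists>a\<in>A. d a b \<le> C))"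

definition cobounded_action ::
    "('g, 'm) monoid_scheme \<Rightarrow> 'a set \<Rightarrow> ('a \<Rightarrow> 'a \<Rightarrow> real) \<Rightarrow> ('g \<Rightarrow> 'a \<Rightarrow> 'a) \<Rightarrow> bool" where
  "cobounded_action G M d \<phi> \<longleftrightarrow> (\<exists>x\<in>M. finite_hausdorff_distance d (orbit G \<phi> x) M)"

text \<open>In the natural topology on \<open>M \<union> \<partial>M\<close> a sequence of points of \<open>M\<close> converges to a boundary
  point \<open>\<xi>\<close> iff it is a member of the class \<open>\<xi>\<close>; so an accumulation point of an orbit is a
  class containing a sequence in that orbit. The choice of the orbit is irrelevant, see
  \<open>limit_set_eq_orbit\<close> below.\<close>

definition limit_set ::
    "('g, 'm) monoid_scheme \<Rightarrow> 'a set \<Rightarrow> ('a \<Rightarrow> 'a \<Rightarrow> real) \<Rightarrow> ('g \<Rightarrow> 'a \<Rightarrow> 'a) \<Rightarrow> (nat \<Rightarrow> 'a) set set"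
  where
  "limit_set G M d \<phi> =
     {\<xi> \<in> gromov_boundary M d. \<exists>x\<in>M. \<exists>u\<in>\<xi>. range u \<subseteq> orbit G \<phi> x}"

text \<open>An isometry \<open>f\<close> acts on the boundary by mapping the class of \<open>u\<close> to the class of
  \<open>f \<circ> u\<close>.\<close>

definition fixes_boundary_point ::
    "('g, 'm) monoid_scheme \<Rightarrow> 'a set \<Rightarrow> ('a \<Rightarrow> 'a \<Rightarrow> real) \<Rightarrow> ('g \<Rightarrow> 'a \<Rightarrow> 'a) \<Rightarrow> bool" where
  "fixes_boundary_point G M d \<phi> \<longleftrightarrow>
     (\<exists>\<xi>\<in>gromov_boundary M d. \<forall>g\<in>carrier G. (\<lambda>u. \<phi> g \<circ> u) ` \<xi> = \<xi>)"

datatype action_type = Elliptic | Horocyclic | Lineal | Focal | General_Type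

fun has_action_type ::
    "('g, 'm) monoid_scheme \<Rightarrow> 'a set \<Rightarrow> ('a \<Rightarrow> 'a \<Rightarrow> real) \<Rightarrow> ('g \<Rightarrow> 'a \<Rightarrow> 'a) \<Rightarrow> action_type \<Rightarrow> bool"
  where
  "has_action_type G M d \<phi> Elliptic \<longleftrightarrow> limit_set G M d \<phi> = {}"
| "has_action_type G M d \<phi> Horocyclic \<longleftrightarrow> card (limit_set G M d \<phi>) = 1"
| "has_action_type G M d \<phi> Lineal \<longleftrightarrow> card (limit_set G M d \<phi>) = 2"
| "has_action_type G M d \<phi> Focal \<longleftrightarrow>
     infinite (limit_set G M d \<phi>) \<and> fixes_boundary_point G M d \<phi>"
| "has_action_type G M d \<phi> General_Type \<longleftrightarrow>
     infinite (limit_set G M d \<phi>) \<and> \<not> fixes_boundary_point G M d \<phi>"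


lemma asymptotic_iff:
  "asymptotic M d u v \<longleftrightarrow>
     (\<forall>w\<in>M. \<forall>K. \<exists>N. \<forall>m\<ge>N. \<forall>n\<ge>N. K \<le> gromov_product d w (u m) (v n))"
proof -
  have "(\<forall>\<^sub>F p in sequentially \<times>\<^sub>F sequentially. P (fst p) (snd p)) \<longleftrightarrow>
        (\<exists>N. \<forall>m\<ge>N. \<forall>n\<ge>N. P m n)" (is "?L \<longleftrightarrow> ?R") for P :: "nat \<Rightarrow> nat \<Rightarrow> bool"
  proof
    assume ?L
    then obtain Q where Q: "eventually Q sequentially" "\<forall>m n. Q m \<and> Q n \<longrightarrow> P m n"
      by (auto simp: eventually_prod_same)
    then show ?R by (metis eventually_sequentially)
  next
    assume ?R
    then obtain N where "\<forall>m\<ge>N. \<forall>n\<ge>N. P m n" by blast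
    then show ?L
      unfolding eventually_prod_same
      by (intro exI[of _ "\<lambda>n. N \<le> n"]) (auto simp: eventually_sequentially)
  qed
  note * = this
  show ?thesis
    unfolding asymptotic_def filterlim_at_top case_prod_beta by (subst *) (rule refl)
qed

lemma asymptotic_sym:
  assumes "Metric_space M d" "asymptotic M d u v" shows "asymptotic M d v u"
proof -
  have *: "gromov_product d w x y = gromov_product d w y x" for w x y
    using Metric_space.commute[OF assms(1)] by (simp add: gromov_product_def)
  show ?thesis using assms(2) unfolding asymptotic_iff by (metis *)
qed

lemma asymptotic_trans:
  assumes "gromov_hyperbolic M d" "range u \<subseteq> M" "range v \<subseteq> M" "range w \<subseteq> M"
    and uv: "asymptotic M d u v" and vw: "asymptotic M d v w"
  shows "asymptotic M d u w"
  unfolding asymptotic_iff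
proof (intro ballI allI)
  fix p K assume p: "p \<in> M"
  obtain \<delta> where \<delta>: "\<And>p x y z. \<lbrakk>p\<in>M; x\<in>M; y\<in>M; z\<in>M\<rbrakk> \<Longrightarrow>
      min (gromov_product d p x y) (gromov_product d p y z) - \<delta> \<le> gromov_product d p x z"
    using assms(1) unfolding gromov_hyperbolic_def by blast
  obtain N where N: "\<And>m n. \<lbrakk>m\<ge>N; n\<ge>N\<rbrakk> \<Longrightarrow> K + \<delta> \<le> gromov_product d p (u m) (v n)"
    using uv p unfolding asymptotic_iff by meson
  obtain N' where N': "\<And>m n. \<lbrakk>m\<ge>N'; n\<ge>N'\<rbrakk> \<Longrightarrow> K + \<delta> \<le> gromov_product d p (v m) (w n)"
    using vw p unfolding asymptotic_iff by meson
  show "\<exists>N. \<forall>m\<ge>N. \<forall>n\<ge>N. K \<le> gromov_product d p (u m) (w n)"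
  proof (intro exI[of _ "max N N'"] allI impI)
    fix m n assume "max N N' \<le> m" "max N N' \<le> n"
    then have "K + \<delta> \<le> gromov_product d p (u m) (v (max N N'))"
      "K + \<delta> \<le> gromov_product d p (v (max N N')) (w n)" using N N' by auto
    moreover have "u m \<in> M" "v (max N N') \<in> M" "w n \<in> M" using assms by auto
    ultimately show "K \<le> gromov_product d p (u m) (w n)"
      using \<delta>[OF p, of "u m" "v (max N N')" "w n"] by linarith
  qed
qed

lemma equiv_asymptotic:
  assumes "hyperbolic_space M d"
  shows "equiv (gromov_sequences M d)
    {(u, v). u \<in> gromov_sequences M d \<and> v \<in> gromov_sequences M d \<and> asymptotic M d u v}"
proof (rule equivI)
  have MS: "Metric_space M d" and hyp: "gromov_hyperbolic M d"
    using assms by (auto simp: hyperbolic_space_def)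
  show "refl_on (gromov_sequences M d)
    {(u, v). u \<in> gromov_sequences M d \<and> v \<in> gromov_sequences M d \<and> asymptotic M d u v}"
    by (auto simp: refl_on_def gromov_sequences_def)
  show "sym {(u, v). u \<in> gromov_sequences M d \<and> v \<in> gromov_sequences M d \<and> asymptotic M d u v}"
    using asymptotic_sym[OF MS] by (auto simp: sym_def)
  show "trans {(u, v). u \<in> gromov_sequences M d \<and> v \<in> gromov_sequences M d \<and> asymptotic M d u v}"
  proof (rule transI, clarsimp)
    fix u v w
    assume "u \<in> gromov_sequences M d" "v \<in> gromov_sequences M d" "w \<in> gromov_sequences M d"
      "asymptotic M d u v" "asymptotic M d v w"
    then show "asymptotic M d u w"
      using asymptotic_trans[OF hyp, of u v w] by (auto simp: gromov_sequences_def)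
  qed
qed auto

lemma asymptotic_bounded_distance:
  assumes MS: "Metric_space M d" and M: "range u \<subseteq> M" "range u' \<subseteq> M" "range v \<subseteq> M"
    and D: "\<And>n. d (u n) (u' n) \<le> D" and as: "asymptotic M d u v"
  shows "asymptotic M d u' v"
  unfolding asymptotic_iff
proof (intro ballI allI)
  interpret Metric_space M d by fact
  fix p K assume p: "p \<in> M"
  obtain N where N: "\<And>m n. \<lbrakk>m\<ge>N; n\<ge>N\<rbrakk> \<Longrightarrow> K + D \<le> gromov_product d p (u m) (v n)"
    using as p unfolding asymptotic_iff by meson
  show "\<exists>N. \<forall>m\<ge>N. \<forall>n\<ge>N. K \<le> gromov_product d p (u' m) (v n)"
  proof (intro exI[of _ N] allI impI)
    fix m n assume mn: "N \<le> m" "N \<le> n"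
    have in_M: "u m \<in> M" "u' m \<in> M" "v n \<in> M" using M by auto
    have "d (u m) p \<le> d (u m) (u' m) + d (u' m) p" using triangle in_M p by blast
    moreover have "d (u' m) (v n) \<le> d (u' m) (u m) + d (u m) (v n)" using triangle in_M by blast
    moreover have "d (u' m) (u m) = d (u m) (u' m)" by (rule commute)
    ultimately show "K \<le> gromov_product d p (u' m) (v n)"
      using N[OF mn] D[of m] unfolding gromov_product_def by (simp add: field_simps)
  qed
qed

lemma limit_set_eq_orbit:
  assumes hyp: "hyperbolic_space M d" and act: "isometric_action G M d \<phi>" and y: "y \<in> M"
  shows "limit_set G M d \<phi> = {\<xi> \<in> gromov_boundary M d. \<exists>u\<in>\<xi>. range u \<subseteq> orbit G \<phi> y}"
proof (intro subset_antisym subsetI)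
  let ?R = "{(u, v). u \<in> gromov_sequences M d \<and> v \<in> gromov_sequences M d \<and> asymptotic M d u v}"
  have MS: "Metric_space M d" using hyp by (simp add: hyperbolic_space_def)
  interpret group_action G M \<phi> using act by (simp add: isometric_action_def)
  fix \<xi> assume "\<xi> \<in> limit_set G M d \<phi>"
  then obtain x u where bd: "\<xi> \<in> gromov_boundary M d" and x: "x \<in> M"
    and u: "u \<in> \<xi>" "range u \<subseteq> orbit G \<phi> x"
    by (auto simp: limit_set_def)
  have "\<forall>n. \<exists>g\<in>carrier G. u n = \<phi> g x" using u(2) by (auto simp: orbit_def)
  then obtain g where g: "\<And>n. g n \<in> carrier G" "\<And>n. u n = \<phi> (g n) x" by metis
  define v where "v = (\<lambda>n. \<phi> (g n) y)"
  have vo: "range v \<subseteq> orbit G \<phi> y" using g by (auto simp: v_def orbit_def)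
  have u_seq: "u \<in> gromov_sequences M d"
    using bd u(1) equiv_asymptotic[OF hyp] unfolding gromov_boundary_def
    by (meson in_quotient_imp_subset subsetD)
  then have uM: "range u \<subseteq> M" and uu: "asymptotic M d u u" by (auto simp: gromov_sequences_def)
  have vM: "range v \<subseteq> M" using element_image[OF g(1) y refl] by (auto simp: v_def)
  have D: "d (u n) (v n) \<le> d x y" for n
    using act g x y by (simp add: v_def isometric_action_def)
  have vu: "asymptotic M d v u"
    by (rule asymptotic_bounded_distance[OF MS uM vM uM D uu])
  have uv: "asymptotic M d u v" by (rule asymptotic_sym[OF MS vu])
  have "asymptotic M d v v"
    by (rule asymptotic_bounded_distance[OF MS uM vM vM D uv])
  then have "(u, v) \<in> ?R" using u_seq uv vM by (auto simp: gromov_sequences_def)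
  then have "v \<in> \<xi>"
    using bd u(1) equiv_asymptotic[OF hyp] unfolding gromov_boundary_def
    by (meson in_quotient_imp_closed)
  then show "\<xi> \<in> {\<xi> \<in> gromov_boundary M d. \<exists>u\<in>\<xi>. range u \<subseteq> orbit G \<phi> y}"
    using bd vo by blast
next
  fix \<xi> assume "\<xi> \<in> {\<xi> \<in> gromov_boundary M d. \<exists>u\<in>\<xi>. range u \<subseteq> orbit G \<phi> y}"
  then show "\<xi> \<in> limit_set G M d \<phi>" using y by (auto simp: limit_set_def)
qed

end

(*
  If there are two limit points, some f in G is loxodromic. Cone off every geodesic of X that stays
  farther than R from the orbit O: let two points be adjacent if they are close or if all geodesics
  between them avoid the R-neighbourhood of O, and take the graph metric on X. Geodesics of X
  satisfy the guessing-geodesics criterion there, so the new metric is hyperbolic with a constant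
  independent of R. O is coarsely dense, because the first part of a geodesic from a point to O, up
  to where it comes near O, is coned off. Sequences converging to infinity in the new metric do so
  in X, and asymptoticity of such sequences is the same in both metrics; hence the new boundary
  embeds equivariantly into the limit set of X. For R large, f is loxodromic in the new metric as
  well. Its two ends decide the type: a third boundary point has infinitely many translates under
  the powers of f, a boundary point fixed by G is an end of f, and if G preserves the pair of ends,
  these are all the limit points of X. The tight span of the new metric makes it geodesic.
*)

theory Submission
  imports Defs
begin

section \<open>Gromov hyperbolic metrics\<close>

text \<open>The order of the constants is the obstacle. R must exceed k * K for a k that beats the
  constants of the new metric, since only then can no coned-off step shortcut the axis of f; this
  would be circular if those constants depended on R. Taking K \<ge> 4 * \<delta> turns one thin
  triangle into one step, and the bootstrap then yields the absolute bounds 8, 16 and 27. Only the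
  coarse density of O depends on R, which is harmless.

  Two limit points serve to find f; an action without limit points is modelled by a single point.

  Geodesics are replaced by an \<open>interval\<close>, the union of all geodesics between two
  points. No choice is made, so isometries preserving O preserve everything built from intervals.
  For the same reason the tight span is used to obtain a geodesic space: isometries extend to it
  canonically.

  The two boundaries are never compared as spaces. One set of sequences in O is mapped to classes on
  both sides, and the two maps identify the same sequences.\<close>

definition interval :: "'a set \<Rightarrow> ('a \<Rightarrow> 'a \<Rightarrow> real) \<Rightarrow> 'a \<Rightarrow> 'a \<Rightarrow> 'a set" where
  "interval M d x y = {z \<in> M. d x z + d z y = d x y}"

definition end_class :: "'a set \<Rightarrow> ('a \<Rightarrow> 'a \<Rightarrow> real) \<Rightarrow> (nat \<Rightarrow> 'a) \<Rightarrow> (nat \<Rightarrow> 'a) set" where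
  "end_class M d u = {v \<in> gromov_sequences M d. asymptotic M d u v}"

locale Gromov_hyperbolic_metric = Metric_space M d for M :: "'a set" and d +
  fixes \<delta> :: real
  assumes delta_nonneg: "0 \<le> \<delta>"
    and hyperbolic: "\<lbrakk>w \<in> M; x \<in> M; y \<in> M; z \<in> M\<rbrakk> \<Longrightarrow>
      min (gromov_product d w x y) (gromov_product d w y z) - \<delta> \<le> gromov_product d w x z"
begin

abbreviation gp :: "'a \<Rightarrow> 'a \<Rightarrow> 'a \<Rightarrow> real" where "gp \<equiv> gromov_product d"

lemma gp_commute: "gp w x y = gp w y x"
  by (simp add: gromov_product_def commute)

lemma gp_nonneg: "\<lbrakk>w \<in> M; x \<in> M; y \<in> M\<rbrakk> \<Longrightarrow> 0 \<le> gp w x y"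
  using triangle[of x w y] by (simp add: gromov_product_def commute)

lemma gp_le_left: "\<lbrakk>w \<in> M; x \<in> M; y \<in> M\<rbrakk> \<Longrightarrow> gp w x y \<le> d w x"
  using triangle[of y x w] by (simp add: gromov_product_def commute)

lemma gp_le_right: "\<lbrakk>w \<in> M; x \<in> M; y \<in> M\<rbrakk> \<Longrightarrow> gp w x y \<le> d w y"
  using gp_le_left gp_commute by metis

lemma gp_add_swap: "gp w x y + gp x w y = d w x"
  by (simp add: gromov_product_def commute field_simps)

lemma gp_change_base: "\<lbrakk>w \<in> M; w' \<in> M; x \<in> M; y \<in> M\<rbrakk> \<Longrightarrow> gp w' x y \<le> gp w x y + d w w'"
  using triangle[of x w w'] triangle[of y w w'] by (simp add: gromov_product_def field_simps)

lemma four_point: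
  assumes "x \<in> M" "y \<in> M" "z \<in> M" "w \<in> M"
  shows "d x y + d z w \<le> max (d x z + d y w) (d x w + d y z) + 2 * \<delta>"
  using hyperbolic[of w x z y] assms unfolding gromov_product_def
  by (auto simp: commute min_def max_def field_simps split: if_splits)

lemma hyperbolic3:
  assumes "p \<in> M" "a \<in> M" "b \<in> M" "c \<in> M" "e \<in> M"
  shows "min (gp p a b) (min (gp p b c) (gp p c e)) - 2 * \<delta> \<le> gp p a e"
  using hyperbolic[of p a b e] hyperbolic[of p b c e] assms delta_nonneg
  by (auto simp: min_def split: if_splits)

lemma asymptotic_base:
  assumes "p \<in> M" "range u \<subseteq> M" "range v \<subseteq> M"
  shows "asymptotic M d u v \<longleftrightarrow> (\<forall>K. \<exists>N. \<forall>m\<ge>N. \<forall>n\<ge>N. K \<le> gp p (u m) (v n))" (is "_ \<longleftrightarrow> ?R")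
proof
  assume ?R
  show "asymptotic M d u v" unfolding asymptotic_iff
  proof (intro ballI allI)
    fix w K assume w: "w \<in> M"
    obtain N where N: "\<And>m n. m \<ge> N \<Longrightarrow> n \<ge> N \<Longrightarrow> K + d w p \<le> gp p (u m) (v n)"
      using \<open>?R\<close> by meson
    show "\<exists>N. \<forall>m\<ge>N. \<forall>n\<ge>N. K \<le> gp w (u m) (v n)"
    proof (intro exI[of _ N] allI impI)
      fix m n assume "N \<le> m" "N \<le> n"
      with N[of m n] gp_change_base[of w p "u m" "v n"] w assms
      show "K \<le> gp w (u m) (v n)" by (simp add: image_subset_iff)
    qed
  qed
qed (use assms in \<open>auto simp: asymptotic_iff\<close>)

text \<open>Seen from \<open>p\<close>, the tails of \<open>u\<close> and of \<open>v\<close> are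
  each clustered. A single small product between late terms therefore spreads to all late pairs, at
  the cost of 2 * \<delta> for the detour through two further points.\<close>

lemma not_asymptotic_bounded:
  assumes p: "p \<in> M" and u: "u \<in> gromov_sequences M d" and v: "v \<in> gromov_sequences M d"
    and uv: "\<not> asymptotic M d u v"
  obtains C N where "\<And>i j. i \<ge> N \<Longrightarrow> j \<ge> N \<Longrightarrow> gp p (u i) (v j) \<le> C"
proof -
  have M: "range u \<subseteq> M" "range v \<subseteq> M" and uu: "asymptotic M d u u" and vv: "asymptotic M d v v"
    using u v by (auto simp: gromov_sequences_def)
  have uM: "u i \<in> M" "v i \<in> M" for i using M by auto
  obtain K where K: "\<And>N. \<exists>m\<ge>N. \<exists>n\<ge>N. gp p (u m) (v n) < K"
    using uv asymptotic_base[OF p M] by (meson not_le)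
  obtain N1 where N1: "\<And>m n. m \<ge> N1 \<Longrightarrow> n \<ge> N1 \<Longrightarrow> K + 2 * \<delta> + 1 \<le> gp p (u m) (u n)"
    using uu asymptotic_base[OF p M(1) M(1)] by meson
  obtain N2 where N2: "\<And>m n. m \<ge> N2 \<Longrightarrow> n \<ge> N2 \<Longrightarrow> K + 2 * \<delta> + 1 \<le> gp p (v m) (v n)"
    using vv asymptotic_base[OF p M(2) M(2)] by meson
  obtain m n where mn: "m \<ge> max N1 N2" "n \<ge> max N1 N2" "gp p (u m) (v n) < K" using K by blast
  show thesis
  proof (rule that[of "max N1 N2" "K + 2 * \<delta>"])
    fix i j assume "i \<ge> max N1 N2" "j \<ge> max N1 N2"
    then show "gp p (u i) (v j) \<le> K + 2 * \<delta>"
      using hyperbolic3[OF p, of "u m" "u i" "v j" "v n"] uM mn N1[of m i] N2[of j n] by simp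
  qed
qed

end

text \<open>Arguments with intervals only ask for an intermediate point at each prescribed distance,
  so geodesicity is stated pointwise instead of through paths.\<close>

locale geodesic_hyperbolic_metric = Gromov_hyperbolic_metric +
  assumes geodesic: "\<lbrakk>x \<in> M; y \<in> M; 0 \<le> t; t \<le> d x y\<rbrakk> \<Longrightarrow> \<exists>z\<in>M. d x z = t \<and> d z y = d x y - t"
begin

abbreviation I :: "'a \<Rightarrow> 'a \<Rightarrow> 'a set" where "I \<equiv> interval M d"

lemma interval_commute: "I x y = I y x"
  by (auto simp: interval_def commute)

lemma interval_in: "z \<in> I x y \<Longrightarrow> z \<in> M"
  by (simp add: interval_def)

lemma endpoints_in_interval: "x \<in> M \<Longrightarrow> y \<in> M \<Longrightarrow> x \<in> I x y \<and> y \<in> I x y"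
  by (simp add: interval_def)

lemma interval_le:
  assumes "z \<in> I x y" shows "d x z \<le> d x y" "d z y \<le> d x y"
proof -
  have "d x z + d z y = d x y" using assms by (simp add: interval_def)
  then show "d x z \<le> d x y" "d z y \<le> d x y" using nonneg[of x z] nonneg[of z y] by linarith+
qed

lemma interval_subset:
  assumes "z \<in> I x y" "x \<in> M" "y \<in> M" shows "I x z \<subseteq> I x y"
proof
  fix w assume "w \<in> I x z"
  then show "w \<in> I x y"
    using assms triangle[of w z y] triangle[of x w y] by (auto simp: interval_def)
qed

text \<open>Let \<open>z'\<close> be the point towards \<open>c\<close> at the same distance from
  \<open>a\<close> as \<open>z\<close>. Seen from \<open>a\<close>, consecutive points among
  \<open>z\<close>, \<open>b\<close>, \<open>c\<close>, \<open>z'\<close> have products at least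
  \<open>d a z\<close>. Hence the product of \<open>z\<close> and \<open>z'\<close> falls short of
  their common distance from \<open>a\<close> by at most 2 * \<delta>, which means that they are 4 *
  \<delta> close.\<close>

lemma fellow_travel:
  assumes z: "z \<in> I a b" and M: "a \<in> M" "b \<in> M" "c \<in> M" and le: "d a z \<le> gp a b c"
  shows "\<exists>z'\<in>I a c. d z z' \<le> 4 * \<delta>"
proof -
  have zM: "z \<in> M" using z by (simp add: interval_def)
  obtain z' where z': "z' \<in> M" "d a z' = d a z" "d z' c = d a c - d a z"
    using geodesic[of a c "d a z"] le gp_le_right[of a b c] M by auto
  have "gp a z b = d a z" using z M by (simp add: interval_def gromov_product_def commute)
  moreover have "gp a c z' = d a z" using z' M by (simp add: gromov_product_def commute)
  ultimately have "d a z - 2 * \<delta> \<le> gp a z z'"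
    using hyperbolic3[of a z b c z'] M zM z' le by simp
  then have "d z z' \<le> 4 * \<delta>" using z' unfolding gromov_product_def by (simp add: commute)
  then show ?thesis using z' by (auto simp: interval_def)
qed

lemma thin_triangle:
  assumes z: "z \<in> I a b" and M: "a \<in> M" "b \<in> M" "c \<in> M"
  shows "\<exists>z'\<in>I a c \<union> I c b. d z z' \<le> 4 * \<delta>"
proof (cases "d a z \<le> gp a b c")
  case True then show ?thesis using fellow_travel[OF z M] by blast
next
  case False
  have "gp a b c + gp b a c = d a b" by (rule gp_add_swap)
  with False z have "d b z \<le> gp b a c" by (simp add: interval_def commute)
  then show ?thesis
    using fellow_travel[of z b a c] z M interval_commute by blast
qed

text \<open>The centre of the comparison tripod. By \<open>gp_add_swap\<close> the point at distance
  \<open>gp a b w\<close> from \<open>a\<close> has distance \<open>gp b a w\<close> from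
  \<open>b\<close>, so \<open>fellow_travel\<close> applies from both ends.\<close>

lemma triangle_center:
  assumes M: "a \<in> M" "b \<in> M" "w \<in> M"
  obtains c c1 c2 where "c \<in> I a b" "c1 \<in> I a w" "c2 \<in> I b w" "d c c1 \<le> 4 * \<delta>" "d c c2 \<le> 4 * \<delta>"
    "d a c = gp a b w"
proof -
  obtain c where c: "c \<in> M" "d a c = gp a b w" "d c b = d a b - gp a b w"
    using geodesic[of a b "gp a b w"] gp_le_left gp_nonneg M by metis
  have c1: "c \<in> I a b" "c \<in> I b a" using c by (auto simp: interval_def commute)
  have "d b c = gp b a w" using c gp_add_swap[of a b w] by (simp add: commute)
  then show thesis
    using that fellow_travel[OF c1(1) M] fellow_travel[OF c1(2) M(2,1,3)] c c1 by (metis order_refl)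
qed

text \<open>With the triangle inequality this says that the product at \<open>y\<close> is the
  distance from \<open>y\<close> to the interval, up to 2 * \<delta>. The witness is again the
  centre of the tripod, where both terms of the four-point maximum coincide.\<close>

lemma near_interval:
  assumes M: "a \<in> M" "b \<in> M" "y \<in> M"
  shows "\<exists>z\<in>I a b. d y z \<le> gp y a b + 2 * \<delta>"
proof -
  obtain z where z: "z \<in> M" "d a z = gp a b y" "d z b = d a b - gp a b y"
    using geodesic[of a b "gp a b y"] gp_le_left gp_nonneg M by metis
  have "d y z + d a b \<le> max (d y a + d z b) (d y b + d z a) + 2 * \<delta>"
    using four_point[of y z a b] M z by simp
  then have "d y z \<le> gp y a b + 2 * \<delta>"
    using z unfolding gromov_product_def by (simp add: commute max_def field_simps split: if_splits)
  then show ?thesis using z by (auto simp: interval_def)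
qed

end

section \<open>The Gromov boundary through classes of sequences\<close>

lemma hyperbolic_space_imp_geodesic_hyperbolic_metric:
  assumes "hyperbolic_space M d"
  obtains \<delta> where "geodesic_hyperbolic_metric M d \<delta>"
proof -
  interpret Metric_space M d using assms by (simp add: hyperbolic_space_def)
  obtain \<delta> where "\<delta> \<ge> 0" and h: "\<forall>w\<in>M. \<forall>x\<in>M. \<forall>y\<in>M. \<forall>z\<in>M.
        min (gromov_product d w x y) (gromov_product d w y z) - \<delta> \<le> gromov_product d w x z"
    using assms by (auto simp: hyperbolic_space_def gromov_hyperbolic_def)
  have "\<exists>z\<in>M. d x z = t \<and> d z y = d x y - t" if "x \<in> M" "y \<in> M" "0 \<le> t" "t \<le> d x y" for x y t
  proof -
    have "geodesic_space M d" using assms by (simp add: hyperbolic_space_def)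
    then obtain \<gamma> :: "real \<Rightarrow> 'a" where \<gamma>: "\<gamma> 0 = x" "\<gamma> (d x y) = y" "\<gamma> ` {0..d x y} \<subseteq> M"
      "\<And>s t. s \<in> {0..d x y} \<Longrightarrow> t \<in> {0..d x y} \<Longrightarrow> d (\<gamma> s) (\<gamma> t) = \<bar>s - t\<bar>"
      using \<open>x \<in> M\<close> \<open>y \<in> M\<close> unfolding geodesic_space_def by meson
    show ?thesis
      using \<gamma>(1-3) \<gamma>(4)[of 0 t] \<gamma>(4)[of t "d x y"] that by (intro bexI[of _ "\<gamma> t"]) auto
  qed
  then have "geodesic_hyperbolic_metric M d \<delta>"
    using h \<open>\<delta> \<ge> 0\<close> by unfold_locales auto
  then show thesis by (rule that)
qed

lemma boundary_class_eq:
  assumes "hyperbolic_space M d" "\<xi> \<in> gromov_boundary M d" "u \<in> \<xi>"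
  shows "u \<in> gromov_sequences M d" "\<xi> = end_class M d u"
proof -
  let ?R = "{(u, v). u \<in> gromov_sequences M d \<and> v \<in> gromov_sequences M d \<and> asymptotic M d u v}"
  note eq = equiv_asymptotic[OF assms(1)]
  obtain w where w: "w \<in> gromov_sequences M d" "\<xi> = ?R `` {w}"
    using assms(2) unfolding gromov_boundary_def by (auto elim: quotientE)
  then show "u \<in> gromov_sequences M d" using assms(3) by auto
  moreover have "\<xi> = ?R `` {u}"
    using w assms(3) equiv_class_eq[OF eq, of w u] by auto
  ultimately show "\<xi> = end_class M d u" by (auto simp: end_class_def)
qed

lemma boundary_class_nonempty:
  assumes "hyperbolic_space M d" "\<xi> \<in> gromov_boundary M d" obtains u where "u \<in> \<xi>"
  using assms in_quotient_imp_non_empty[OF equiv_asymptotic[OF assms(1)]]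
  unfolding gromov_boundary_def by blast

lemma end_class_in_boundary:
  assumes "u \<in> gromov_sequences M d" shows "end_class M d u \<in> gromov_boundary M d"
proof -
  have "end_class M d u = {(u, v). u \<in> gromov_sequences M d \<and> v \<in> gromov_sequences M d \<and>
      asymptotic M d u v} `` {u}"
    using assms by (auto simp: end_class_def)
  with assms show ?thesis unfolding gromov_boundary_def by (simp only: quotientI)
qed

lemma in_end_class_self: "u \<in> gromov_sequences M d \<Longrightarrow> u \<in> end_class M d u"
  by (simp add: end_class_def gromov_sequences_def)

lemma end_class_eq_iff:
  assumes "hyperbolic_space M d" "u \<in> gromov_sequences M d" "v \<in> gromov_sequences M d"
  shows "end_class M d u = end_class M d v \<longleftrightarrow> asymptotic M d u v"
proof
  assume "end_class M d u = end_class M d v"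
  then show "asymptotic M d u v" using in_end_class_self[OF assms(3)] by (auto simp: end_class_def)
next
  assume "asymptotic M d u v"
  then have "v \<in> end_class M d u" using assms by (simp add: end_class_def)
  then show "end_class M d u = end_class M d v"
    using boundary_class_eq(2)[OF assms(1) end_class_in_boundary[OF assms(2)]] by simp
qed

section \<open>The tight span\<close>

text \<open>Elements of \<open>BijGroup E\<close> are functions on the whole type, so an equation
  between them needs the values outside \<open>E\<close> as well; hence \<open>extensional\<close>.
  Bijectivity comes from the action of the inverse.\<close>

lemma group_actionI:
  assumes "group G"
    and ext: "\<And>g. g \<in> carrier G \<Longrightarrow> \<psi> g \<in> extensional E"
    and closed: "\<And>g x. g \<in> carrier G \<Longrightarrow> x \<in> E \<Longrightarrow> \<psi> g x \<in> E"
    and one: "\<And>x. x \<in> E \<Longrightarrow> \<psi> \<one>\<^bsub>G\<^esub> x = x"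
    and mult: "\<And>g h x. g \<in> carrier G \<Longrightarrow> h \<in> carrier G \<Longrightarrow> x \<in> E \<Longrightarrow>
      \<psi> (g \<otimes>\<^bsub>G\<^esub> h) x = \<psi> g (\<psi> h x)"
  shows "group_action G E \<psi>"
proof -
  interpret group G by fact
  have bij: "bij_betw (\<psi> g) E E" if g: "g \<in> carrier G" for g
  proof (rule bij_betw_byWitness[where f' = "\<psi> (inv\<^bsub>G\<^esub> g)"])
    show "\<forall>x\<in>E. \<psi> (inv\<^bsub>G\<^esub> g) (\<psi> g x) = x"
      using g mult[of "inv\<^bsub>G\<^esub> g" g] one by auto
    show "\<forall>x\<in>E. \<psi> g (\<psi> (inv\<^bsub>G\<^esub> g) x) = x"
      using g mult[of g "inv\<^bsub>G\<^esub> g"] one by auto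
  qed (use g closed in auto)
  then have Bij: "\<psi> g \<in> Bij E" if "g \<in> carrier G" for g
    using that ext by (simp add: Bij_def)
  have "\<psi> (g \<otimes>\<^bsub>G\<^esub> h) = \<psi> g \<otimes>\<^bsub>BijGroup E\<^esub> \<psi> h" if "g \<in> carrier G" "h \<in> carrier G" for g h
  proof
    fix x
    show "\<psi> (g \<otimes>\<^bsub>G\<^esub> h) x = (\<psi> g \<otimes>\<^bsub>BijGroup E\<^esub> \<psi> h) x"
      using that Bij extensional_arb[OF ext[of "g \<otimes>\<^bsub>G\<^esub> h"], of x] mult[OF that, of x]
      by (cases "x \<in> E") (simp_all add: BijGroup_def compose_def)
  qed
  then have "\<psi> \<in> hom G (BijGroup E)"
    using Bij by (auto simp: hom_def BijGroup_def)
  then show ?thesis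
    by (simp add: group_action_def group_hom_def group_hom_axioms_def group_BijGroup is_group)
qed

locale nonempty_metric_space = Metric_space +
  assumes nonempty: "M \<noteq> {}"
begin

definition dominating :: "('a \<Rightarrow> real) set" where
  "dominating = {f. \<forall>x\<in>M. \<forall>y\<in>M. d x y \<le> f x + f y}"

definition conjugate :: "('a \<Rightarrow> real) \<Rightarrow> 'a \<Rightarrow> real" where
  "conjugate f x = (SUP y\<in>M. d x y - f y)"

text \<open>Isbell's injective hull: the pointwise minimal dominating functions are the dominating
  fixed points of \<open>conjugate\<close>. Values outside \<open>M\<close> are unrestricted, so
  functions are compared on \<open>M\<close> only.\<close>

definition tight_span :: "('a \<Rightarrow> real) set" where
  "tight_span = {f \<in> dominating. \<forall>x\<in>M. conjugate f x = f x}"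

definition sup_dist :: "('a \<Rightarrow> real) \<Rightarrow> ('a \<Rightarrow> real) \<Rightarrow> real" where
  "sup_dist f g = (SUP x\<in>M. \<bar>f x - g x\<bar>)"

lemma dominating_nonneg: "f \<in> dominating \<Longrightarrow> x \<in> M \<Longrightarrow> 0 \<le> f x"
  unfolding dominating_def by force

lemma conjugate_upper: "f \<in> dominating \<Longrightarrow> x \<in> M \<Longrightarrow> y \<in> M \<Longrightarrow> d x y - f y \<le> conjugate f x"
  unfolding conjugate_def
  by (rule cSUP_upper) (auto simp: dominating_def algebra_simps intro!: bdd_aboveI2[where M = "f x"])

lemma conjugate_least: "x \<in> M \<Longrightarrow> (\<And>y. y \<in> M \<Longrightarrow> d x y - f y \<le> c) \<Longrightarrow> conjugate f x \<le> c"
  unfolding conjugate_def using nonempty by (intro cSUP_least) auto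

lemma conjugate_le: "f \<in> dominating \<Longrightarrow> x \<in> M \<Longrightarrow> conjugate f x \<le> f x"
  by (rule conjugate_least) (auto simp: dominating_def algebra_simps)

lemma conjugate_antimono:
  assumes "f \<in> dominating" "\<And>x. x \<in> M \<Longrightarrow> f x \<le> g x + t" "x \<in> M"
  shows "conjugate g x \<le> conjugate f x + t"
proof (rule conjugate_least[OF assms(3)])
  fix y assume "y \<in> M"
  then show "d x y - g y \<le> conjugate f x + t" using conjugate_upper[OF assms(1,3), of y] assms(2)[of y] by linarith
qed

text \<open>The gap between \<open>f\<close> and its conjugate at least halves in each step, so the iteration converges
  to an extremal function. No choice is involved, which makes the limit nonexpansive in \<open>f\<close>.\<close>

definition halfway :: "('a \<Rightarrow> real) \<Rightarrow> 'a \<Rightarrow> real" where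
  "halfway f x = (f x + conjugate f x) / 2"

text \<open>The conjugate alone need not be dominating, but its value at \<open>x\<close> plus
  \<open>f y\<close> is at least \<open>d x y\<close>. Averaging this with the same inequality for
  the swapped points gives the claim.\<close>

lemma halfway_dominating: assumes "f \<in> dominating" shows "halfway f \<in> dominating"
  unfolding dominating_def
proof (clarify)
  fix x y assume "x \<in> M" "y \<in> M"
  then show "d x y \<le> halfway f x + halfway f y"
    using conjugate_upper[OF assms, of x y] conjugate_upper[OF assms, of y x] commute[of x y]
    by (simp add: halfway_def field_simps)
qed

lemma halfway_le: "f \<in> dominating \<Longrightarrow> x \<in> M \<Longrightarrow> halfway f x \<le> f x"
  using conjugate_le[of f x] by (simp add: halfway_def)

text \<open>Conjugation is antitone, so passing to the smaller function \<open>halfway f\<close>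
  cannot lower the conjugate.\<close>

lemma halfway_gap:
  assumes "f \<in> dominating" "x \<in> M" shows "halfway f x - conjugate (halfway f) x \<le> (f x - conjugate f x) / 2"
  using conjugate_antimono[of "halfway f" f 0 x] halfway_dominating halfway_le assms by (simp add: halfway_def field_simps)

lemma halfway_mono:
  assumes "f \<in> dominating" "g \<in> dominating" "\<And>x. x \<in> M \<Longrightarrow> \<bar>f x - g x\<bar> \<le> t" "x \<in> M"
  shows "\<bar>halfway f x - halfway g x\<bar> \<le> t"
proof -
  have "f y \<le> g y + t" "g y \<le> f y + t" if "y \<in> M" for y using assms(3)[OF that] by auto
  then have "conjugate g x \<le> conjugate f x + t" "conjugate f x \<le> conjugate g x + t"
    using conjugate_antimono[of f g t x] conjugate_antimono[of g f t x] assms by auto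
  then show ?thesis using assms(3)[OF assms(4)] by (auto simp: halfway_def abs_le_iff field_simps)
qed

lemma halfway_iter_dominating: "f \<in> dominating \<Longrightarrow> (halfway ^^ n) f \<in> dominating"
  by (induction n) (auto simp: halfway_dominating)

definition retraction :: "('a \<Rightarrow> real) \<Rightarrow> 'a \<Rightarrow> real" where
  "retraction f x = lim (\<lambda>n. (halfway ^^ n) f x)"

lemma halfway_iter_decseq: "f \<in> dominating \<Longrightarrow> x \<in> M \<Longrightarrow> decseq (\<lambda>n. (halfway ^^ n) f x)"
  by (rule decseq_SucI) (simp add: halfway_le halfway_iter_dominating)

lemma retraction_lim: assumes "f \<in> dominating" "x \<in> M" shows "(\<lambda>n. (halfway ^^ n) f x) \<longlonglongrightarrow> retraction f x"
proof -
  have "\<exists>L. (\<lambda>n. (halfway ^^ n) f x) \<longlonglongrightarrow> L"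
    using decseq_convergent[OF halfway_iter_decseq[OF assms], of 0] dominating_nonneg[OF halfway_iter_dominating] assms by metis
  then show ?thesis unfolding retraction_def using convergent_LIMSEQ_iff convergent_def by blast
qed

lemma retraction_le_iter: "f \<in> dominating \<Longrightarrow> x \<in> M \<Longrightarrow> retraction f x \<le> (halfway ^^ n) f x"
  using decseq_ge[OF halfway_iter_decseq retraction_lim] by blast

lemma retraction_dominating: assumes "f \<in> dominating" shows "retraction f \<in> dominating"
  unfolding dominating_def
proof clarify
  fix x y assume "x \<in> M" "y \<in> M"
  then show "d x y \<le> retraction f x + retraction f y"
    by (intro LIMSEQ_le_const[OF tendsto_add[OF retraction_lim[OF assms] retraction_lim[OF assms]]])
      (use halfway_iter_dominating[OF assms] in \<open>auto simp: dominating_def\<close>)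
qed

lemma halfway_iter_gap:
  assumes "f \<in> dominating" "x \<in> M"
  shows "(halfway ^^ n) f x - conjugate ((halfway ^^ n) f) x \<le> (f x - conjugate f x) / 2 ^ n"
proof (induction n)
  case (Suc n)
  then show ?case using halfway_gap[OF halfway_iter_dominating[OF assms(1), of n] assms(2)] by simp
qed simp

lemma retraction_in_tight_span: assumes "f \<in> dominating" shows "retraction f \<in> tight_span"
proof -
  have "conjugate (retraction f) x = retraction f x" if x: "x \<in> M" for x
  proof (rule antisym)
    show "conjugate (retraction f) x \<le> retraction f x" by (rule conjugate_le[OF retraction_dominating[OF assms] x])
    have "conjugate ((halfway ^^ n) f) x \<le> conjugate (retraction f) x" for n
      using conjugate_antimono[OF retraction_dominating[OF assms], of "(halfway ^^ n) f" 0 x] retraction_le_iter[OF assms] x by simp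
    then have "retraction f x - conjugate (retraction f) x \<le> (f x - conjugate f x) / 2 ^ n" for n
      using retraction_le_iter[OF assms x, of n] halfway_iter_gap[OF assms x, of n] by (meson diff_mono order_trans)
    moreover have "(\<lambda>n. (f x - conjugate f x) / 2 ^ n) \<longlonglongrightarrow> 0"
      by (rule LIMSEQ_divide_realpow_zero) simp
    ultimately have "retraction f x - conjugate (retraction f) x \<le> 0"
      using LIMSEQ_le_const[of "\<lambda>n. (f x - conjugate f x) / 2 ^ n" 0] by blast
    then show "retraction f x \<le> conjugate (retraction f) x" by simp
  qed
  then show ?thesis using retraction_dominating[OF assms] by (simp add: tight_span_def)
qed

lemma retraction_nonexpansive:
  assumes "f \<in> dominating" "g \<in> dominating" "\<And>x. x \<in> M \<Longrightarrow> \<bar>f x - g x\<bar> \<le> t" "x \<in> M"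
  shows "\<bar>retraction f x - retraction g x\<bar> \<le> t"
proof -
  have iter: "\<forall>x\<in>M. \<bar>(halfway ^^ n) f x - (halfway ^^ n) g x\<bar> \<le> t" for n
    using assms by (induction n) (auto intro!: halfway_mono halfway_iter_dominating)
  show ?thesis
    by (rule LIMSEQ_le_const2[OF tendsto_rabs[OF tendsto_diff[OF retraction_lim retraction_lim]]])
      (use assms iter in auto)
qed

text \<open>Extremal functions are minimal: \<open>retraction f\<close> lies below \<open>f\<close>,
  so its conjugate lies above that of \<open>f\<close>, and both functions equal their
  conjugates.\<close>

lemma retraction_id: assumes "f \<in> tight_span" "x \<in> M" shows "retraction f x = f x"
proof -
  have f: "f \<in> dominating" using assms by (simp add: tight_span_def)
  have le: "retraction f y \<le> f y" if "y \<in> M" for y using retraction_le_iter[OF f that, of 0] by simp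
  have "conjugate f x \<le> conjugate (retraction f) x" using conjugate_antimono[of "retraction f" f 0 x] retraction_dominating[OF f] le assms by simp
  then show ?thesis
    using le[of x] retraction_in_tight_span[OF f] assms by (simp add: tight_span_def)
qed

lemma tight_span_lipschitz:
  assumes "f \<in> tight_span" "x \<in> M" "a \<in> M" shows "f x \<le> f a + d x a"
proof -
  have "conjugate f x \<le> f a + d x a"
  proof (rule conjugate_least[OF assms(2)])
    fix y assume y: "y \<in> M"
    have "d a y - f y \<le> conjugate f a" using conjugate_upper[of f a y] assms y by (simp add: tight_span_def)
    then show "d x y - f y \<le> f a + d x a"
      using triangle[of x a y] assms y by (simp add: tight_span_def)
  qed
  then show ?thesis using assms by (simp add: tight_span_def)
qed

text \<open>Functions in the tight span are unbounded if \<open>M\<close> is, but any two differ by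
  a bounded amount. This makes the supremum in \<open>sup_dist\<close> finite.\<close>

lemma tight_span_bounded:
  assumes "f \<in> tight_span" "g \<in> tight_span" "x \<in> M" "a \<in> M"
  shows "\<bar>f x - g x\<bar> \<le> f a + g a"
proof -
  have "d x a \<le> g x + g a" "d x a \<le> f x + f a" using assms by (auto simp: tight_span_def dominating_def)
  then show ?thesis
    using tight_span_lipschitz[OF assms(1,3,4)] tight_span_lipschitz[OF assms(2,3,4)] by simp
qed

lemma sup_dist_le_iff:
  assumes "f \<in> tight_span" "g \<in> tight_span"
  shows "sup_dist f g \<le> t \<longleftrightarrow> (\<forall>x\<in>M. \<bar>f x - g x\<bar> \<le> t)"
proof -
  obtain a where "a \<in> M" using nonempty by blast
  then have "bdd_above ((\<lambda>x. \<bar>f x - g x\<bar>) ` M)"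
    using tight_span_bounded[OF assms] by (intro bdd_aboveI2[where M = "f a + g a"]) auto
  then show ?thesis unfolding sup_dist_def using nonempty by (intro cSUP_le_iff) auto
qed

lemma sup_dist_upper:
  assumes "f \<in> tight_span" "g \<in> tight_span" "x \<in> M" shows "\<bar>f x - g x\<bar> \<le> sup_dist f g"
  using sup_dist_le_iff[OF assms(1,2), of "sup_dist f g"] assms(3) by simp

lemma sup_dist_commute: "sup_dist f g = sup_dist g f"
  by (simp add: sup_dist_def abs_minus_commute)

lemma sup_dist_nonneg: "f \<in> tight_span \<Longrightarrow> g \<in> tight_span \<Longrightarrow> 0 \<le> sup_dist f g"
  using nonempty sup_dist_upper[of f g] by fastforce

lemma sup_dist_triangle:
  assumes "f \<in> tight_span" "g \<in> tight_span" "h \<in> tight_span"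
  shows "sup_dist f h \<le> sup_dist f g + sup_dist g h"
  unfolding sup_dist_le_iff[OF assms(1,3)]
proof
  fix x assume "x \<in> M"
  then show "\<bar>f x - h x\<bar> \<le> sup_dist f g + sup_dist g h"
    using sup_dist_upper[OF assms(1,2), of x] sup_dist_upper[OF assms(2,3), of x] by linarith
qed

lemma dist_in_tight_span: assumes "v \<in> M" shows "d v \<in> tight_span"
proof -
  have dominating: "d v \<in> dominating" using assms triangle'' by (auto simp: dominating_def)
  have "conjugate (d v) x = d v x" if x: "x \<in> M" for x
  proof (rule antisym)
    show "conjugate (d v) x \<le> d v x" by (rule conjugate_le[OF dominating x])
    show "d v x \<le> conjugate (d v) x" using conjugate_upper[OF dominating x assms] assms by (simp add: commute)
  qed
  with dominating show ?thesis by (simp add: tight_span_def)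
qed

text \<open>Each value of \<open>f\<close> is a distance from \<open>f\<close> to an embedded point.
  So the Kuratowski embedding \<open>\<lambda>v. d v\<close> is isometric, and finding a point of
  \<open>M\<close> close to \<open>f\<close> means finding an argument at which \<open>f\<close> is
  small.\<close>

lemma sup_dist_point:
  assumes "f \<in> tight_span" "v \<in> M" shows "sup_dist f (d v) = f v"
proof (rule antisym)
  show "sup_dist f (d v) \<le> f v"
    unfolding sup_dist_le_iff[OF assms(1) dist_in_tight_span[OF assms(2)]]
    using tight_span_bounded[OF assms(1) dist_in_tight_span[OF assms(2)] _ assms(2)] assms(2) by simp
  show "f v \<le> sup_dist f (d v)"
    using sup_dist_upper[OF assms(1) dist_in_tight_span assms(2)] assms(2) by fastforce
qed

text \<open>Dominating functions form a convex set, but the affine segment from \<open>f\<close> to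
  \<open>g\<close> may leave the tight span; the retraction brings it back and fixes its ends on
  \<open>M\<close>. Since the retraction is nonexpansive, no two points get farther apart than their
  parameters; since the ends keep their full distance, the triangle inequality leaves no room for
  anything shorter.\<close>

lemma tight_span_geodesic:
  assumes f: "f \<in> tight_span" and g: "g \<in> tight_span"
  obtains \<gamma> where "\<And>s. s \<in> {0..sup_dist f g} \<Longrightarrow> \<gamma> s \<in> tight_span"
    "\<And>x. x \<in> M \<Longrightarrow> \<gamma> 0 x = f x" "\<And>x. x \<in> M \<Longrightarrow> \<gamma> (sup_dist f g) x = g x"
    "\<And>s t. s \<in> {0..sup_dist f g} \<Longrightarrow> t \<in> {0..sup_dist f g} \<Longrightarrow> sup_dist (\<gamma> s) (\<gamma> t) = \<bar>s - t\<bar>"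
proof -
  define n where "n = sup_dist f g"
  have n0: "0 \<le> n" unfolding n_def using f g by (rule sup_dist_nonneg)
  \<comment> \<open>For n = 0, division by zero makes the segment constantly \<open>f\<close>, which
    then agrees with \<open>g\<close> on \<open>M\<close>.\<close>
  define l where "l = (\<lambda>s x. f x + (s / n) * (g x - f x))"
  have fg: "\<bar>f x - g x\<bar> \<le> n" if "x \<in> M" for x unfolding n_def using sup_dist_upper f g that by blast
  have lD: "l s \<in> dominating" if s: "s \<in> {0..n}" for s
    unfolding dominating_def
  proof clarify
    fix x y assume xy: "x \<in> M" "y \<in> M"
    define c where "c = s / n"
    have c: "0 \<le> c" "c \<le> 1" using s n0 by (auto simp: c_def divide_le_eq_1)
    have "d x y \<le> f x + f y" "d x y \<le> g x + g y" using f g xy by (auto simp: tight_span_def dominating_def)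
    then have "(1 - c) * d x y \<le> (1 - c) * (f x + f y)" "c * d x y \<le> c * (g x + g y)"
      using c by (auto intro!: mult_left_mono)
    moreover have "l s x = f x + c * (g x - f x)" "l s y = f y + c * (g y - f y)"
      by (simp_all add: l_def c_def)
    ultimately show "d x y \<le> l s x + l s y" by (simp only:) (simp add: algebra_simps)
  qed
  have ll: "\<bar>l s x - l t x\<bar> \<le> \<bar>s - t\<bar>" if "x \<in> M" for s t x
  proof (cases "n = 0")
    case False
    have "l s x - l t x = (s - t) * ((g x - f x) / n)"
      using False by (simp add: l_def field_simps)
    then have "\<bar>l s x - l t x\<bar> = \<bar>s - t\<bar> * (\<bar>f x - g x\<bar> / n)"
      using n0 by (simp add: abs_mult abs_minus_commute)
    also have "\<dots> \<le> \<bar>s - t\<bar> * 1"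
      using fg[OF that] n0 False by (intro mult_left_mono) (auto simp: divide_le_eq_1)
    finally show ?thesis by simp
  qed (simp add: l_def)
  define \<gamma> where "\<gamma> = (\<lambda>s. retraction (l s))"
  have \<gamma>E: "\<gamma> s \<in> tight_span" if "s \<in> {0..n}" for s
    unfolding \<gamma>_def by (rule retraction_in_tight_span[OF lD[OF that]])
  have le: "sup_dist (\<gamma> s) (\<gamma> t) \<le> \<bar>s - t\<bar>" if "s \<in> {0..n}" "t \<in> {0..n}" for s t
    unfolding sup_dist_le_iff[OF \<gamma>E[OF that(1)] \<gamma>E[OF that(2)]]
    using retraction_nonexpansive[OF lD[OF that(1)] lD[OF that(2)] ll] by (simp add: \<gamma>_def)
  have \<gamma>0: "\<gamma> 0 x = f x" if "x \<in> M" for x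
    using retraction_id[OF f that] by (simp add: \<gamma>_def l_def)
  have \<gamma>n: "\<gamma> n x = g x" if x: "x \<in> M" for x
  proof -
    have "\<bar>retraction (l n) x - retraction g x\<bar> \<le> 0"
    proof (rule retraction_nonexpansive[OF lD _ _ x])
      show "n \<in> {0..n}" using n0 by simp
      show "g \<in> dominating" using g by (simp add: tight_span_def)
      show "\<bar>l n y - g y\<bar> \<le> 0" if "y \<in> M" for y
        using fg[OF that] by (cases "n = 0") (auto simp: l_def)
    qed
    then show ?thesis using retraction_id[OF g x] by (simp add: \<gamma>_def)
  qed
  have "sup_dist (\<gamma> 0) (\<gamma> n) = n"
    using \<gamma>0 \<gamma>n unfolding n_def sup_dist_def by (intro SUP_cong) auto
  then have ge: "t - s \<le> sup_dist (\<gamma> s) (\<gamma> t)" if "s \<in> {0..n}" "t \<in> {0..n}" "s \<le> t" for s t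
    using sup_dist_triangle[of "\<gamma> 0" "\<gamma> s" "\<gamma> n"] sup_dist_triangle[of "\<gamma> s" "\<gamma> t" "\<gamma> n"]
      \<gamma>E le[of 0 s] le[of t n] that n0 by force
  have eq: "sup_dist (\<gamma> s) (\<gamma> t) = \<bar>s - t\<bar>" if "s \<in> {0..n}" "t \<in> {0..n}" for s t
    using le[OF that] ge[OF that] ge[OF that(2,1)] sup_dist_commute[of "\<gamma> s" "\<gamma> t"] by linarith
  show thesis using that[of \<gamma>] \<gamma>E \<gamma>0 \<gamma>n eq unfolding n_def by blast
qed

lemma conjugate_compose:
  assumes "h ` M = M" "\<And>x y. x \<in> M \<Longrightarrow> y \<in> M \<Longrightarrow> d (h x) (h y) = d x y" "x \<in> M"
  shows "conjugate (f \<circ> h) x = conjugate f (h x)"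
proof -
  have "conjugate (f \<circ> h) x = (SUP y\<in>M. d (h x) (h y) - f (h y))"
    unfolding conjugate_def using assms by (intro SUP_cong) auto
  also have "\<dots> = (SUP y\<in>h ` M. d (h x) y - f y)" by (simp add: image_image)
  finally show ?thesis using assms(1) by (simp add: conjugate_def)
qed

lemma tight_span_compose:
  assumes "h ` M = M" "\<And>x y. x \<in> M \<Longrightarrow> y \<in> M \<Longrightarrow> d (h x) (h y) = d x y" "f \<in> tight_span"
  shows "f \<circ> h \<in> tight_span"
proof -
  have "f \<circ> h \<in> dominating" unfolding dominating_def
  proof (clarsimp)
    fix x y assume "x \<in> M" "y \<in> M"
    moreover from this have "h x \<in> M" "h y \<in> M" using assms(1) by auto
    ultimately show "d x y \<le> f (h x) + f (h y)"
      using assms(2)[of x y] assms(3) unfolding tight_span_def dominating_def by fastforce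
  qed
  then show ?thesis
    using conjugate_compose[OF assms(1,2), of _ f] assms(1,3) by (auto simp: tight_span_def)
qed

lemma sup_dist_compose:
  assumes "h ` M = M" shows "sup_dist (f \<circ> h) (g \<circ> h) = sup_dist f g"
proof -
  have "sup_dist (f \<circ> h) (g \<circ> h) = (SUP x\<in>h ` M. \<bar>f x - g x\<bar>)"
    unfolding sup_dist_def by (simp add: image_image)
  then show ?thesis using assms by (simp add: sup_dist_def)
qed

lemma sup_dist_cong: "(\<And>x. x \<in> M \<Longrightarrow> f x = f' x) \<Longrightarrow> (\<And>x. x \<in> M \<Longrightarrow> g x = g' x) \<Longrightarrow>
    sup_dist f g = sup_dist f' g'"
  unfolding sup_dist_def by (intro SUP_cong) auto

end


section \<open>A geodesic space around a coarsely geodesic one\<close>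

lemma gromov_product_perturb:
  assumes "\<bar>d x w - d' x' w'\<bar> \<le> e" "\<bar>d y w - d' y' w'\<bar> \<le> e" "\<bar>d x y - d' x' y'\<bar> \<le> e"
  shows "\<bar>gromov_product d w x y - gromov_product d' w' x' y'\<bar> \<le> 3 * e / 2"
  using assms unfolding gromov_product_def by (simp add: abs_le_iff field_simps)

text \<open>Hyperbolicity and coarse geodesicity keep the tight span within bounded distance of
  \<open>V\<close>, so it is hyperbolic as well. An isometry of \<open>V\<close> acts on it by
  precomposition with the inverse, so the action extends without choices.\<close>

theorem geodesic_extension:
  fixes G :: "('g, 'm) monoid_scheme" and V :: "'x set"
  assumes hyp: "Gromov_hyperbolic_metric V d \<delta>" and ne: "V \<noteq> {}"
    and coarse: "\<And>x y t. \<lbrakk>x \<in> V; y \<in> V; 0 \<le> t; t \<le> d x y\<rbrakk> \<Longrightarrow>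
      \<exists>m\<in>V. d x m \<le> t + c \<and> d m y \<le> d x y - t + c"
    and act: "isometric_action G V d \<phi>"
  obtains Y :: "('g \<times> 'x \<times> real) set set" and dY \<psi> \<iota> C
  where "hyperbolic_space Y dY" "isometric_action G Y dY \<psi>"
    "\<And>u. u \<in> V \<Longrightarrow> \<iota> u \<in> Y" "\<And>u v. u \<in> V \<Longrightarrow> v \<in> V \<Longrightarrow> dY (\<iota> u) (\<iota> v) = d u v"
    "\<And>g u. g \<in> carrier G \<Longrightarrow> u \<in> V \<Longrightarrow> \<psi> g (\<iota> u) = \<iota> (\<phi> g u)"
    "\<And>y. y \<in> Y \<Longrightarrow> \<exists>u\<in>V. dY y (\<iota> u) \<le> C"
proof -
  interpret Gromov_hyperbolic_metric V d \<delta> by fact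
  interpret nonempty_metric_space V d by unfold_locales (rule ne)
  interpret A: group_action G V \<phi> using act by (simp add: isometric_action_def)
  interpret group G using A.group_hom group_hom.axioms(1) by auto
  have iso: "d (\<phi> g x) (\<phi> g y) = d x y" if "g \<in> carrier G" "x \<in> V" "y \<in> V" for g x y
    using act that by (simp add: isometric_action_def)
  let ?T = tight_span
  \<comment> \<open>A function is encoded by its graph; the first component is a dummy that fits the required type.\<close>
  define gr :: "('x \<Rightarrow> real) \<Rightarrow> ('g \<times> 'x \<times> real) set" where "gr = (\<lambda>f. (\<lambda>w. (\<one>\<^bsub>G\<^esub>, w, f w)) ` V)"
  define val :: "('g \<times> 'x \<times> real) set \<Rightarrow> 'x \<Rightarrow> real" where
    "val = (\<lambda>A w. THE r. (\<one>\<^bsub>G\<^esub>, w, r) \<in> A)"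
  have val: "val (gr f) w = f w" if "w \<in> V" for f w
    unfolding val_def gr_def using that by (intro the_equality) auto
  have gr_eq: "gr f = gr g \<longleftrightarrow> (\<forall>x\<in>V. f x = g x)" for f g
  proof
    assume "gr f = gr g" then show "\<forall>x\<in>V. f x = g x" using val by metis
  qed (auto simp: gr_def)
  define Y where "Y = gr ` ?T"
  \<comment> \<open>\<open>Metric_space\<close> asks for nonnegativity and symmetry on the whole
    type, so \<open>dY\<close> is 0 off \<open>Y\<close>.\<close>
  define dY where "dY = (\<lambda>A B. if A \<in> Y \<and> B \<in> Y then sup_dist (val A) (val B) else 0)"
  have dY: "dY (gr f) (gr g) = sup_dist f g" if "f \<in> ?T" "g \<in> ?T" for f g
    using that by (auto simp: dY_def Y_def val intro: sup_dist_cong)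
  have MS: "Metric_space Y dY"
  proof
    fix A B
    show "0 \<le> dY A B"
    proof (cases "A \<in> Y \<and> B \<in> Y")
      case True
      then show ?thesis using dY sup_dist_nonneg by (auto simp: Y_def)
    qed (auto simp: dY_def)
    show "dY A B = dY B A" by (simp add: dY_def sup_dist_commute)
  next
    fix A B assume "A \<in> Y" "B \<in> Y"
    then obtain f g where fg: "A = gr f" "B = gr g" "f \<in> ?T" "g \<in> ?T" by (auto simp: Y_def)
    have "sup_dist f g = 0 \<longleftrightarrow> sup_dist f g \<le> 0" using sup_dist_nonneg[OF fg(3,4)] by auto
    also have "\<dots> \<longleftrightarrow> A = B" using sup_dist_le_iff[OF fg(3,4), of 0] by (simp add: fg gr_eq)
    finally show "dY A B = 0 \<longleftrightarrow> A = B" using dY fg by simp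
  next
    fix A B C assume "A \<in> Y" "B \<in> Y" "C \<in> Y"
    then show "dY A C \<le> dY A B + dY B C"
      using dY sup_dist_triangle by (auto simp: Y_def)
  qed
  interpret Y: Metric_space Y dY by (rule MS)
  have geo: "geodesic_space Y dY"
    unfolding geodesic_space_def
  proof (intro ballI)
    fix A B assume "A \<in> Y" "B \<in> Y"
    then obtain f g where fg: "A = gr f" "B = gr g" "f \<in> ?T" "g \<in> ?T" by (auto simp: Y_def)
    obtain \<gamma> where \<gamma>: "\<And>s. s \<in> {0..sup_dist f g} \<Longrightarrow> \<gamma> s \<in> ?T"
      "\<And>x. x \<in> V \<Longrightarrow> \<gamma> 0 x = f x" "\<And>x. x \<in> V \<Longrightarrow> \<gamma> (sup_dist f g) x = g x"
      "\<And>s t. s \<in> {0..sup_dist f g} \<Longrightarrow> t \<in> {0..sup_dist f g} \<Longrightarrow> sup_dist (\<gamma> s) (\<gamma> t) = \<bar>s - t\<bar>"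
      using tight_span_geodesic[OF fg(3,4)] by metis
    have AB: "dY A B = sup_dist f g" using dY fg by simp
    show "\<exists>\<gamma>::real \<Rightarrow> _. \<gamma> 0 = A \<and> \<gamma> (dY A B) = B \<and> \<gamma> ` {0..dY A B} \<subseteq> Y \<and>
        (\<forall>s\<in>{0..dY A B}. \<forall>t\<in>{0..dY A B}. dY (\<gamma> s) (\<gamma> t) = \<bar>s - t\<bar>)"
      unfolding AB
      by (rule exI[of _ "gr \<circ> \<gamma>"]) (use \<gamma> dY in \<open>auto simp: fg gr_eq Y_def\<close>)
  qed
  define \<iota> where "\<iota> = (\<lambda>u. gr (d u))"
  have \<iota>Y: "\<iota> u \<in> Y" if "u \<in> V" for u using dist_in_tight_span[OF that] by (simp add: \<iota>_def Y_def)
  have d\<iota>: "dY (\<iota> u) (\<iota> v) = d u v" if "u \<in> V" "v \<in> V" for u v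
    using dY sup_dist_point dist_in_tight_span that by (simp add: \<iota>_def)
  \<comment> \<open>Take \<open>x\<close>, \<open>y\<close> for which \<open>f x + f y\<close> is
    almost \<open>d x y\<close>, go about \<open>f x\<close> from \<open>x\<close> towards
    \<open>y\<close> to a point \<open>m\<close>, and take a partner \<open>z\<close> for which
    \<open>f m + f z\<close> is almost \<open>d m z\<close>. The four-point inequality for
    \<open>m\<close>, \<open>z\<close>, \<open>x\<close>, \<open>y\<close> then bounds
    \<open>f m\<close>: it contributes 2 * \<delta>, the coarse geodesic c, and each use of
    \<open>almost\<close> 1.\<close>
  define C where "C = 2 * \<delta> + c + 2"
  have dense: "\<exists>u\<in>V. dY A (\<iota> u) \<le> C" if "A \<in> Y" for A
  proof -
    obtain f where f: "A = gr f" "f \<in> ?T" using \<open>A \<in> Y\<close> by (auto simp: Y_def)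
    then have fD: "f \<in> dominating" and f_conj: "\<And>x. x \<in> V \<Longrightarrow> conjugate f x = f x" by (auto simp: tight_span_def)
    have almost: "\<exists>y\<in>V. f x + f y \<le> d x y + 1" if x: "x \<in> V" for x
    proof (rule ccontr)
      assume "\<not> ?thesis"
      then have "conjugate f x \<le> f x - 1" by (intro conjugate_least[OF x]) force
      then show False using f_conj[OF x] by simp
    qed
    obtain x where x: "x \<in> V" using ne by blast
    obtain y where y: "y \<in> V" "f x + f y \<le> d x y + 1" using almost[OF x] by blast
    have "0 \<le> f x" "0 \<le> f y" "d x y \<le> f x + f y" using dominating_nonneg[OF fD] x y fD by (auto simp: dominating_def)
    \<comment> \<open>\<open>f x\<close> may exceed \<open>d x y\<close> by up to 1, hence the
      minimum.\<close>
    then obtain m where m: "m \<in> V" "d x m \<le> f x + c" "d m y \<le> f y + c"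
      using coarse[OF x y(1), of "min (f x) (d x y)"] by (fastforce simp: min_def split: if_splits)
    obtain z where z: "z \<in> V" "f m + f z \<le> d m z + 1" using almost[OF m(1)] by blast
    have "d m z + d x y \<le> max (d m x + d z y) (d m y + d z x) + 2 * \<delta>"
      using four_point[of m z x y] m z x y by simp
    moreover have "d z y \<le> f z + f y" "d z x \<le> f z + f x" using fD x y z by (auto simp: dominating_def)
    ultimately have "f m \<le> C"
      using m z y commute[of x m] delta_nonneg unfolding C_def by (auto simp: max_def split: if_splits)
    then have "dY A (\<iota> m) \<le> C"
      using f m dY[OF f(2) dist_in_tight_span[OF m(1)]] sup_dist_point[OF f(2) m(1)] by (simp add: \<iota>_def)
    then show ?thesis using m by blast
  qed
  have "gromov_hyperbolic Y dY"
  proof -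
    obtain r where r: "\<And>A. A \<in> Y \<Longrightarrow> r A \<in> V \<and> dY A (\<iota> (r A)) \<le> C" using dense by metis
    have "\<bar>dY A B - d (r A) (r B)\<bar> \<le> 2 * C" if "A \<in> Y" "B \<in> Y" for A B
    proof -
      have in_Y: "\<iota> (r A) \<in> Y" "\<iota> (r B) \<in> Y" using r that \<iota>Y by auto
      have "dY A B \<le> dY A (\<iota> (r A)) + dY (\<iota> (r A)) B" "dY (\<iota> (r A)) B \<le> dY (\<iota> (r A)) (\<iota> (r B)) + dY (\<iota> (r B)) B"
        "dY (\<iota> (r A)) (\<iota> (r B)) \<le> dY (\<iota> (r A)) A + dY A (\<iota> (r B))" "dY A (\<iota> (r B)) \<le> dY A B + dY B (\<iota> (r B))"
        using Y.triangle that in_Y by auto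
      then show ?thesis
        using r[OF that(1)] r[OF that(2)] d\<iota>[of "r A" "r B"] Y.commute[of "\<iota> (r A)" A]
          Y.commute[of "\<iota> (r B)" B] by auto
    qed
    then have gp: "\<bar>gromov_product dY W A B - gromov_product d (r W) (r A) (r B)\<bar> \<le> 3 * C"
      if "W \<in> Y" "A \<in> Y" "B \<in> Y" for W A B
      using gromov_product_perturb[where e = "2 * C" and d = dY and d' = d and x = A and y = B and w = W
          and x' = "r A" and y' = "r B" and w' = "r W"] that by simp
    obtain a where "a \<in> Y" using ne \<iota>Y by blast
    then have "0 \<le> C" using dense Y.nonneg order_trans by blast
    have "min (gromov_product dY W A B) (gromov_product dY W B D) - (\<delta> + 6 * C) \<le> gromov_product dY W A D"
      if "W \<in> Y" "A \<in> Y" "B \<in> Y" "D \<in> Y" for W A B D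
      using gp[of W A B] gp[of W B D] gp[of W A D] that r hyperbolic[of "r W" "r A" "r B" "r D"]
      by (auto simp: min_def split: if_splits)
    then show ?thesis unfolding gromov_hyperbolic_def
      using \<open>0 \<le> C\<close> delta_nonneg by (intro exI[of _ "\<delta> + 6 * C"]) auto
  qed
  then have hypY: "hyperbolic_space Y dY"
    using MS geo ne \<iota>Y by (auto simp: hyperbolic_space_def)
  \<comment> \<open>Moving the points of a graph by \<open>\<phi> g\<close> turns the function
    \<open>f\<close> into its composition with \<open>\<phi> (inv g)\<close>. The restriction makes
    \<open>\<psi> g\<close> extensional.\<close>
  define \<psi> where "\<psi> = (\<lambda>g. restrict (\<lambda>A. (\<lambda>(a, w, r). (a, \<phi> g w, r)) ` A) Y)"
  have inv_surj: "\<phi> (inv\<^bsub>G\<^esub> g) ` V = V" if "g \<in> carrier G" for g using that A.surj_prop by simp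
  have comp_in: "f \<circ> \<phi> (inv\<^bsub>G\<^esub> g) \<in> ?T" if "g \<in> carrier G" "f \<in> ?T" for f g
    using that iso[of "inv\<^bsub>G\<^esub> g"] inv_surj by (intro tight_span_compose) auto
  have \<psi>_gr: "\<psi> g (gr f) = gr (f \<circ> \<phi> (inv\<^bsub>G\<^esub> g))" if g: "g \<in> carrier G" and f: "f \<in> ?T" for f g
  proof -
    have cancel: "\<phi> (inv\<^bsub>G\<^esub> g) (\<phi> g w) = w" if "w \<in> V" for w using A.orbit_sym_aux[OF g that refl] .
    have "gr (f \<circ> \<phi> (inv\<^bsub>G\<^esub> g)) = (\<lambda>w. (\<one>\<^bsub>G\<^esub>, w, f (\<phi> (inv\<^bsub>G\<^esub> g) w))) ` \<phi> g ` V"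
      using A.surj_prop[OF g] by (simp add: gr_def)
    also have "\<dots> = (\<lambda>w. (\<one>\<^bsub>G\<^esub>, \<phi> g w, f w)) ` V"
      unfolding image_image using cancel by (intro image_cong) auto
    also have "\<dots> = \<psi> g (gr f)" using f by (simp add: \<psi>_def Y_def gr_def image_image)
    finally show ?thesis by simp
  qed
  have gaY: "group_action G Y \<psi>"
  proof (rule group_actionI[OF is_group])
    show "\<psi> g \<in> extensional Y" for g by (simp add: \<psi>_def)
    show "\<psi> g A \<in> Y" if "g \<in> carrier G" "A \<in> Y" for g A
      using that \<psi>_gr comp_in by (auto simp: Y_def)
    show "\<psi> \<one>\<^bsub>G\<^esub> A = A" if "A \<in> Y" for A
    proof -
      obtain f where f: "A = gr f" "f \<in> ?T" using \<open>A \<in> Y\<close> by (auto simp: Y_def)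
      have "\<phi> \<one>\<^bsub>G\<^esub> x = x" if "x \<in> V" for x using A.id_eq_one that by (metis restrict_apply')
      then show ?thesis using \<psi>_gr[OF one_closed f(2)] f by (simp add: gr_eq)
    qed
    show "\<psi> (g \<otimes>\<^bsub>G\<^esub> h) A = \<psi> g (\<psi> h A)" if "g \<in> carrier G" "h \<in> carrier G" "A \<in> Y" for g h A
    proof -
      obtain f where f: "A = gr f" "f \<in> ?T" using \<open>A \<in> Y\<close> by (auto simp: Y_def)
      have "\<phi> (inv\<^bsub>G\<^esub> (g \<otimes>\<^bsub>G\<^esub> h)) x = \<phi> (inv\<^bsub>G\<^esub> h) (\<phi> (inv\<^bsub>G\<^esub> g) x)" if "x \<in> V" for x
        using that \<open>g \<in> carrier G\<close> \<open>h \<in> carrier G\<close> by (simp add: inv_mult_group A.composition_rule)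
      then show ?thesis
        using that \<psi>_gr comp_in f by (simp add: gr_eq)
    qed
  qed
  have "dY (\<psi> g A) (\<psi> g B) = dY A B" if "g \<in> carrier G" "A \<in> Y" "B \<in> Y" for g A B
    using that \<psi>_gr comp_in dY sup_dist_compose[OF inv_surj[OF that(1)]] by (auto simp: Y_def)
  with gaY have actY: "isometric_action G Y dY \<psi>" by (simp add: isometric_action_def)
  have equi: "\<psi> g (\<iota> u) = \<iota> (\<phi> g u)" if g: "g \<in> carrier G" and u: "u \<in> V" for g u
  proof -
    have "d u (\<phi> (inv\<^bsub>G\<^esub> g) x) = d (\<phi> g u) x" if x: "x \<in> V" for x
    proof -
      have "\<phi> g (\<phi> (inv\<^bsub>G\<^esub> g) x) = x" using A.orbit_sym_aux[OF inv_closed[OF g] x refl] g by simp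
      then show ?thesis using iso[OF g u, of "\<phi> (inv\<^bsub>G\<^esub> g) x"] A.element_image[OF inv_closed[OF g] x refl] by simp
    qed
    then show ?thesis
      using \<psi>_gr[OF g dist_in_tight_span[OF u]] by (simp add: \<iota>_def gr_eq)
  qed
  show thesis by (rule that[OF hypY actY \<iota>Y d\<iota> equi dense])
qed

section \<open>Coning off the geodesics far from an orbit\<close>

text \<open>Each halving of the chain costs one thin triangle, that is 4 * \<delta>. The distance to
  the chain thus grows with the logarithm of the number of links, however long the links
  are.\<close>

lemma (in geodesic_hyperbolic_metric) interval_near_chain:
  assumes "\<And>i. i \<le> 2 ^ k \<Longrightarrow> p i \<in> M" "z \<in> I (p 0) (p (2 ^ k))"
  shows "\<exists>i<2 ^ k. \<exists>z'\<in>I (p i) (p (Suc i)). d z z' \<le> real k * (4 * \<delta>)"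
  using assms
proof (induction k arbitrary: p z)
  case 0
  then show ?case by (auto simp: interval_def)
next
  case (Suc k)
  have pM: "p 0 \<in> M" "p (2 ^ k) \<in> M" "p (2 ^ Suc k) \<in> M" using Suc.prems(1) by auto
  have zM: "z \<in> M" using Suc.prems(2) by (simp add: interval_def)
  obtain z1 where z1: "z1 \<in> I (p 0) (p (2 ^ k)) \<union> I (p (2 ^ k)) (p (2 ^ Suc k))" "d z z1 \<le> 4 * \<delta>"
    using thin_triangle[OF Suc.prems(2) pM(1,3,2)] by blast
  then have z1M: "z1 \<in> M" by (auto simp: interval_def)
  have "\<exists>i<2 ^ Suc k. \<exists>z'\<in>I (p i) (p (Suc i)). d z1 z' \<le> real k * (4 * \<delta>)"
    using z1(1)
  proof
    assume "z1 \<in> I (p 0) (p (2 ^ k))"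
    then obtain i where "i < 2 ^ k" "\<exists>z'\<in>I (p i) (p (Suc i)). d z1 z' \<le> real k * (4 * \<delta>)"
      using Suc.IH[of p z1] Suc.prems(1) by auto
    then show ?thesis by (intro exI[of _ i]) auto
  next
    assume z1': "z1 \<in> I (p (2 ^ k)) (p (2 ^ Suc k))"
    have "2 ^ k + i \<le> 2 ^ Suc k" if "i \<le> 2 ^ k" for i :: nat using that by simp
    then obtain i where i: "i < 2 ^ k"
      "\<exists>z'\<in>I (p (2 ^ k + i)) (p (2 ^ k + Suc i)). d z1 z' \<le> real k * (4 * \<delta>)"
      using Suc.IH[of "\<lambda>i. p (2 ^ k + i)" z1] Suc.prems(1) z1' by (auto simp: mult_2)
    then show ?thesis by (intro exI[of _ "2 ^ k + i"]) auto
  qed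
  then obtain i z' where i: "i < 2 ^ Suc k" "z' \<in> I (p i) (p (Suc i))" "d z1 z' \<le> real k * (4 * \<delta>)"
    by blast
  moreover have "d z z' \<le> real (Suc k) * (4 * \<delta>)"
    using triangle[of z z1 z'] zM z1M z1(2) i(2,3) by (simp add: interval_def algebra_simps)
  ultimately show ?case by blast
qed

text \<open>The bound \<open>4 * \<delta> \<le> K\<close> makes triangles of intervals 1-thin in the graph metric, so that the
  constants below depend neither on \<open>\<delta>\<close> nor on \<open>R\<close>.\<close>

locale coned_off = geodesic_hyperbolic_metric +
  fixes Orb :: "'a set" and K R :: real
  assumes Orb: "Orb \<subseteq> M" "Orb \<noteq> {}"
    and K: "1 \<le> K" "4 * \<delta> \<le> K" and R: "0 \<le> R"
begin

definition adj :: "('a \<times> 'a) set" where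
  "adj = {(x, y). x \<in> M \<and> y \<in> M \<and> (d x y \<le> K \<or> (\<forall>z\<in>I x y. \<forall>p\<in>Orb. R < d z p))}"

definition steps :: "'a \<Rightarrow> 'a \<Rightarrow> nat" where
  "steps x y = (LEAST n. (x, y) \<in> adj ^^ n)"

definition cone_dist :: "'a \<Rightarrow> 'a \<Rightarrow> real" where
  "cone_dist x y = real (steps x y)"

lemma adj_in: "(x, y) \<in> adj \<Longrightarrow> x \<in> M \<and> y \<in> M"
  by (simp add: adj_def)

lemma adj_refl: "x \<in> M \<Longrightarrow> (x, x) \<in> adj"
  using K by (simp add: adj_def)

lemma adj_converse: "adj\<inverse> = adj"
  unfolding adj_def using commute interval_commute by auto

lemma adj_pow_commute: "(x, y) \<in> adj ^^ n \<longleftrightarrow> (y, x) \<in> adj ^^ n"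
proof (induction n arbitrary: x y)
  case (Suc n)
  have "(x, y) \<in> adj ^^ Suc n \<longleftrightarrow> (\<exists>z. (x, z) \<in> adj \<and> (z, y) \<in> adj ^^ n)"
    unfolding relpow.simps(2) relpow_commute[symmetric] by blast
  also have "\<dots> \<longleftrightarrow> (\<exists>z. (z, x) \<in> adj \<and> (y, z) \<in> adj ^^ n)"
    using Suc.IH adj_converse by blast
  also have "\<dots> \<longleftrightarrow> (y, x) \<in> adj ^^ Suc n" by auto
  finally show ?case .
qed auto

text \<open>Both alternatives in \<open>adj\<close> pass to subintervals. Hence every point between
  two adjacent points is within one step of them, however far apart they are in
  \<open>d\<close>.\<close>

lemma adj_sub: "(x, y) \<in> adj \<Longrightarrow> z \<in> I x y \<Longrightarrow> (x, z) \<in> adj"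
  unfolding adj_def using interval_subset[of z x y] interval_le(1)[of z x y] interval_in[of z x y]
  by fastforce

lemma adj_pow_dist:
  assumes "x \<in> M" "y \<in> M" "d x y \<le> real n * K" shows "(x, y) \<in> adj ^^ n"
  using assms
proof (induction n arbitrary: y)
  case 0
  then have "d x y = 0" using nonneg[of x y] by simp
  then show ?case using 0 by simp
next
  case (Suc n)
  obtain z where z: "z \<in> M" "d x z = min (d x y) (real n * K)" "d z y = d x y - min (d x y) (real n * K)"
    using geodesic[of x y "min (d x y) (real n * K)"] Suc.prems K by auto
  then have "(x, z) \<in> adj ^^ n" using Suc.IH[of z] Suc.prems by simp
  moreover have "d z y \<le> K" using z Suc.prems K by (cases "d x y \<le> real n * K") (auto simp: algebra_simps)
  then have "(z, y) \<in> adj" using z Suc.prems by (simp add: adj_def)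
  ultimately show ?case by auto
qed

lemma steps_le: "(x, y) \<in> adj ^^ n \<Longrightarrow> steps x y \<le> n"
  unfolding steps_def by (rule Least_le)

lemma steps_le_dist:
  assumes "x \<in> M" "y \<in> M" "d x y \<le> real n * K" shows "steps x y \<le> n"
  using assms by (intro steps_le adj_pow_dist)

lemma steps_path: assumes "x \<in> M" "y \<in> M" shows "(x, y) \<in> adj ^^ steps x y"
proof -
  obtain n :: nat where "d x y \<le> real n" using real_arch_simple by blast
  then have "d x y \<le> real n * K" using K by (simp add: order_trans[OF _ mult_left_mono[of 1 K "real n"]])
  then have "(x, y) \<in> adj ^^ n" using assms by (intro adj_pow_dist)
  then show ?thesis unfolding steps_def by (rule LeastI)
qed

lemma steps_commute: "steps x y = steps y x"
  unfolding steps_def using adj_pow_commute by metis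

lemma steps_triangle: "x \<in> M \<Longrightarrow> y \<in> M \<Longrightarrow> z \<in> M \<Longrightarrow> steps x z \<le> steps x y + steps y z"
  using steps_path[of x y] steps_path[of y z] by (intro steps_le) (auto simp: relpow_add)

lemma steps_self: "steps x x = 0"
  using steps_le[of x x 0] by simp

lemma steps_eq_0: "x \<in> M \<Longrightarrow> y \<in> M \<Longrightarrow> steps x y = 0 \<longleftrightarrow> x = y"
  using steps_path[of x y] steps_self by auto

lemma steps_adj: "(x, y) \<in> adj \<Longrightarrow> steps x y \<le> 1"
  using steps_le[of x y 1] by simp

lemma cone_dist_le_dist: "x \<in> M \<Longrightarrow> y \<in> M \<Longrightarrow> cone_dist x y \<le> d x y + 1"
proof -
  assume xy: "x \<in> M" "y \<in> M"
  let ?n = "nat \<lceil>d x y\<rceil>"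
  have "d x y \<le> real ?n * 1" by (simp only: mult_1_right real_nat_ceiling_ge)
  also have "\<dots> \<le> real ?n * K" using K(1) by (rule mult_left_mono) (rule of_nat_0_le_iff)
  finally have "steps x y \<le> ?n" by (rule steps_le_dist[OF xy])
  then show ?thesis unfolding cone_dist_def using nonneg[of x y] by linarith
qed

lemma near_log:
  assumes p: "\<And>i. i < n \<Longrightarrow> (p i, p (Suc i)) \<in> adj" and pM: "p 0 \<in> M" and n: "n \<le> 2 ^ k" and z: "z \<in> I (p 0) (p n)"
  shows "\<exists>i<2 ^ k. \<exists>z'\<in>I (p (min i n)) (p (min (Suc i) n)). d z z' \<le> real k * K"
proof -
  have pM': "p i \<in> M" if "i \<le> n" for i
    using that p[of "i - 1"] pM adj_in by (cases i) auto
  obtain i z' where "i < 2 ^ k" "z' \<in> I (p (min i n)) (p (min (Suc i) n))" "d z z' \<le> real k * (4 * \<delta>)"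
    \<comment> \<open>The chain is padded to exactly 2 ^ k links by repeating its last
      vertex.\<close>
    using interval_near_chain[of k "\<lambda>i. p (min i n)" z] pM' z n by (auto simp: min_absorb2)
  moreover have "real k * (4 * \<delta>) \<le> real k * K" using K by (intro mult_left_mono) auto
  ultimately show ?thesis by force
qed

text \<open>The distance \<open>real k * K\<close> to a link is covered by k steps, and one more
  step leads along that link to its vertex.\<close>

lemma steps_near_log:
  assumes p: "\<And>i. i < n \<Longrightarrow> (p i, p (Suc i)) \<in> adj" and pM: "p 0 \<in> M" and n: "n \<le> 2 ^ k" and z: "z \<in> I (p 0) (p n)"
  shows "\<exists>i\<le>n. steps z (p i) \<le> k + 1"
proof -
  have pM': "p i \<in> M" if "i \<le> n" for i
    using that p[of "i - 1"] pM adj_in by (cases i) auto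
  obtain i z' where i: "z' \<in> I (p (min i n)) (p (min (Suc i) n))" "d z z' \<le> real k * K"
    using near_log[OF p pM n z] by blast
  have M: "z \<in> M" "z' \<in> M" "p (min i n) \<in> M" using z i pM' by (auto simp: interval_def)
  have "(p (min i n), p (min (Suc i) n)) \<in> adj"
    using p[of i] pM'[of n] adj_refl by (cases "i < n") (auto simp: min_def)
  then have "steps (p (min i n)) z' \<le> 1" using adj_sub i(1) steps_adj by blast
  moreover have "steps z z' \<le> k" using steps_le_dist M i(2) by blast
  ultimately have "steps z (p (min i n)) \<le> k + 1"
    using steps_triangle[of z z' "p (min i n)"] M steps_commute[of z'] by simp
  then show ?thesis by (intro exI[of _ "min i n"]) auto
qed

section \<open>Intervals lie near the geodesics of the graph\<close>

definition step_geodesic :: "(nat \<Rightarrow> 'a) \<Rightarrow> nat \<Rightarrow> bool" where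
  "step_geodesic p n \<longleftrightarrow> (\<forall>i\<le>n. p i \<in> M) \<and> (\<forall>i j. i \<le> j \<longrightarrow> j \<le> n \<longrightarrow> steps (p i) (p j) = j - i)"

lemma step_geodesic_exists:
  assumes "a \<in> M" "b \<in> M"
  obtains p where "step_geodesic p (steps a b)" "p 0 = a" "p (steps a b) = b"
proof -
  define n where "n = steps a b"
  obtain p where p: "p 0 = a" "p n = b" "\<And>i. i < n \<Longrightarrow> (p i, p (Suc i)) \<in> adj"
    using steps_path[OF assms] unfolding n_def relpow_fun_conv by blast
  have pM: "p i \<in> M" if "i \<le> n" for i
    using that p(1) p(3)[of "i - 1"] assms adj_in by (cases i) auto
  have le: "steps (p i) (p j) \<le> j - i" if "i \<le> j" "j \<le> n" for i j
  proof (rule steps_le)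
    show "(p i, p j) \<in> adj ^^ (j - i)"
      unfolding relpow_fun_conv using that p(3) by (intro exI[of _ "\<lambda>l. p (i + l)"]) auto
  qed
  have "steps (p i) (p j) = j - i" if "i \<le> j" "j \<le> n" for i j
    using le[OF that] le[of 0 i] le[of j n] that steps_triangle[of a "p i" b] steps_triangle[of "p i" "p j" b]
      pM assms p(1,2) n_def by force
  then show thesis using that[of p] pM p n_def by (simp add: step_geodesic_def)
qed

lemma step_geodesic_sub:
  assumes "step_geodesic p n" "i \<le> j" "j \<le> n" shows "step_geodesic (\<lambda>l. p (i + l)) (j - i)"
  using assms by (auto simp: step_geodesic_def)

lemma step_geodesic_adj: assumes "step_geodesic p n" "i < n" shows "(p i, p (Suc i)) \<in> adj"
  using steps_path[of "p i" "p (Suc i)"] assms by (simp add: step_geodesic_def)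

lemma step_geodesic_near_log:
  assumes "step_geodesic p n" "n \<le> 2 ^ k" "z \<in> I (p 0) (p n)"
  shows "\<exists>i\<le>n. steps z (p i) \<le> k + 1"
  using steps_near_log[of n p k z] step_geodesic_adj[OF assms(1)] assms by (simp add: step_geodesic_def)

text \<open>Bowditch's bootstrapping: the logarithmic bound, applied to a piece of the geodesic of length
  comparable to the bound \<open>T\<close> itself, improves \<open>T\<close> to about \<open>log T\<close>.\<close>

lemma bootstrap:
  assumes W: "\<And>p n z. step_geodesic p n \<Longrightarrow> n \<le> N \<Longrightarrow> z \<in> I (p 0) (p n) \<Longrightarrow> \<exists>i\<le>n. steps z (p i) \<le> T"
    and k: "2 * T + 8 \<le> 2 ^ k" and p: "step_geodesic p n" "n \<le> N" and z: "z \<in> I (p 0) (p n)"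
  shows "\<exists>i\<le>n. steps z (p i) \<le> k + 3"
proof -
  have pM: "p i \<in> M" if "i \<le> n" for i using p that by (simp add: step_geodesic_def)
  have zM: "z \<in> M" using z by (simp add: interval_def)
  \<comment> \<open>The margin over \<open>T\<close> covers the two steps from \<open>z\<close> to
    \<open>z2\<close> below: a vertex within \<open>T\<close> of \<open>z2\<close> belongs to
    \<open>S\<close>.\<close>
  define S where "S = {i. i \<le> n \<and> steps z (p i) \<le> T + 3}"
  obtain i0 where "i0 \<le> n" "steps z (p i0) \<le> T" using W[OF p z] by blast
  then have "i0 \<in> S" by (simp add: S_def)
  have finS: "finite S" by (rule finite_subset[of _ "{..n}"]) (auto simp: S_def)
  define i where "i = Min S"
  define j where "j = Max S"
  have S_bounds: "i \<le> l" "l \<le> j" if "l \<in> S" for l using finS that by (auto simp: i_def j_def)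
  have "S \<noteq> {}" using \<open>i0 \<in> S\<close> by blast
  then have ij: "i \<in> S" "j \<in> S" unfolding i_def j_def using Min_in[OF finS] Max_in[OF finS] by blast+
  have "i \<le> j" using S_bounds[OF \<open>i0 \<in> S\<close>] by linarith
  note ij = ij this
  have "i \<le> n" "j \<le> n" using ij by (auto simp: S_def)
  have "j - i = steps (p i) (p j)" using p(1) ij(3) \<open>j \<le> n\<close> by (simp add: step_geodesic_def)
  also have "\<dots> \<le> steps (p i) z + steps z (p j)" using steps_triangle pM zM \<open>i \<le> n\<close> \<open>j \<le> n\<close> by blast
  also have "\<dots> \<le> 2 * T + 6" using ij by (simp add: S_def steps_commute)
  finally have ji: "j - i \<le> 2 * T + 6" .
  \<comment> \<open>One vertex beyond \<open>S\<close> on each side, cut off at the ends of the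
    geodesic. If \<open>z2\<close> belonged to an outer piece, \<open>W\<close> would produce an
    element of \<open>S\<close> outside \<open>{i..j}\<close> unless that piece is trivial.
    Truncated subtraction gives s = 0 for i = 0.\<close>
  define s where "s = i - 1"
  define t where "t = min (Suc j) n"
  have st: "s \<le> t" "t \<le> n" "s \<le> n" "t - s \<le> 2 ^ k" using ij(3) \<open>i \<le> n\<close> \<open>j \<le> n\<close> ji k by (auto simp: s_def t_def)
  have near1: "\<exists>z'\<in>I a c \<union> I c b. steps w z' \<le> 1" if "w \<in> I a b" "a \<in> M" "b \<in> M" "c \<in> M" for w a b c
    using thin_triangle[OF that] steps_le_dist[of w _ 1] K(2) that(1) unfolding interval_def by fastforce
  obtain z1 where z1: "z1 \<in> I (p 0) (p s) \<union> I (p s) (p n)" "steps z z1 \<le> 1"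
    using near1[OF z] pM st by blast
  have z1M: "z1 \<in> M" using z1 by (auto simp: interval_def)
  obtain z2 where z2: "z2 \<in> I (p 0) (p s) \<union> I (p s) (p t) \<union> I (p t) (p n)" "steps z z2 \<le> 2"
  proof (cases "z1 \<in> I (p 0) (p s)")
    case True then show thesis using that z1 by force
  next
    case False
    then obtain z2 where "z2 \<in> I (p s) (p t) \<union> I (p t) (p n)" "steps z1 z2 \<le> 1"
      using near1[of z1 "p s" "p n" "p t"] z1(1) pM st by blast
    moreover from this have "z2 \<in> M" by (auto simp: interval_def)
    ultimately show thesis using that[of z2] steps_triangle[of z z1 z2] zM z1M z1(2) by auto
  qed
  have z2M: "z2 \<in> M" using z2 by (auto simp: interval_def)
  have near: "steps z (p l) \<le> 2 + steps z2 (p l)" if "l \<le> n" for l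
    using steps_triangle[of z z2 "p l"] z2(2) zM z2M pM[OF that] by simp
  consider "z2 \<in> I (p 0) (p s)" | "z2 \<in> I (p s) (p t)" | "z2 \<in> I (p t) (p n)" using z2 by blast
  then show ?thesis
  proof cases
    case 1
    have "step_geodesic p s" using step_geodesic_sub[OF p(1), of 0 s] st by simp
    then obtain l where l: "l \<le> s" "steps z2 (p l) \<le> T" using W[of p s z2] 1 st p(2) by auto
    then have "l \<in> S" using near[of l] st by (simp add: S_def)
    then have "i \<le> l" by (rule S_bounds)
    then have "i = 0" "s = 0" using l(1) by (auto simp: s_def)
    then have "z2 = p 0" using 1 pM[of 0] z2M by (auto simp: interval_def commute)
    then show ?thesis using z2(2) by (intro exI[of _ 0]) auto
  next
    case 2
    have "step_geodesic (\<lambda>l. p (s + l)) (t - s)" using step_geodesic_sub[OF p(1) st(1,2)] .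
    then obtain l where "l \<le> t - s" "steps z2 (p (s + l)) \<le> k + 1"
      using step_geodesic_near_log[of "\<lambda>l. p (s + l)" "t - s" k z2] 2 st by auto
    then show ?thesis using near[of "s + l"] st by (intro exI[of _ "s + l"]) linarith
  next
    case 3
    have "step_geodesic (\<lambda>l. p (t + l)) (n - t)" using step_geodesic_sub[OF p(1) st(2)] by simp
    then obtain l where l: "l \<le> n - t" "steps z2 (p (t + l)) \<le> T"
      using W[of "\<lambda>l. p (t + l)" "n - t" z2] 3 st(2) diff_le_self[of n t] p(2) by fastforce
    then have "t + l \<le> n" using st by simp
    then have "t + l \<in> S" using near[of "t + l"] l by (simp add: S_def)
    then have "t + l \<le> j" by (rule S_bounds)
    then have "t = n" by (auto simp: t_def)
    then have "z2 = p n" using 3 pM[of n] z2M by (auto simp: interval_def commute)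
    then show ?thesis using z2(2) by (intro exI[of _ n]) auto
  qed
qed

text \<open>For fixed \<open>n\<close> the logarithmic bound provides some admissible
  \<open>T\<close>, and the least one cannot exceed 8: for T \<ge> 9 one has 2 * T + 8 \<le> 2 ^ (T
  - 4), which reads 26 \<le> 32 at T = 9, and the bootstrap improves \<open>T\<close> to
  \<open>T - 1\<close>.\<close>

lemma step_geodesic_near:
  assumes "step_geodesic p n" "z \<in> I (p 0) (p n)" shows "\<exists>i\<le>n. steps z (p i) \<le> 8"
proof -
  define W where "W = (\<lambda>T. \<forall>p m z. step_geodesic p m \<longrightarrow> m \<le> n \<longrightarrow> z \<in> I (p 0) (p m) \<longrightarrow> (\<exists>i\<le>m. steps z (p i) \<le> T))"
  have "m \<le> 2 ^ n" if "m \<le> n" for m using that less_exp[of n] by linarith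
  then have "W (n + 1)" unfolding W_def using step_geodesic_near_log by blast
  define T where "T = (LEAST T. W T)"
  have WT: "W T" unfolding T_def using \<open>W (n + 1)\<close> by (rule LeastI)
  have "T \<le> 8"
  proof (rule ccontr)
    assume T: "\<not> T \<le> 8"
    have "2 * (r + 9) + 8 \<le> (2::nat) ^ 5 * 2 ^ r" for r
      by (induction r) auto
    from this[of "T - 9"] T have "2 * T + 8 \<le> 2 ^ (T - 4)"
      unfolding power_add[symmetric] by simp
    then have "W (T - 4 + 3)"
      using WT bootstrap[of n T "T - 4"] unfolding W_def by blast
    then have "T \<le> T - 4 + 3" unfolding T_def by (rule Least_le)
    then show False using T by simp
  qed
  obtain i where "i \<le> n" "steps z (p i) \<le> T" using WT assms unfolding W_def by blast
  then show ?thesis using \<open>T \<le> 8\<close> by (intro exI[of _ i]) auto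
qed

text \<open>The detour from a graph geodesic to \<open>z\<close> and back costs 2 * 8. Intervals of
  \<open>d\<close> are therefore geodesic for the new metric up to an absolute constant.\<close>

lemma steps_interval:
  assumes "z \<in> I a b" "a \<in> M" "b \<in> M" shows "steps a z + steps z b \<le> steps a b + 16"
proof -
  obtain p where p: "step_geodesic p (steps a b)" "p 0 = a" "p (steps a b) = b" using step_geodesic_exists[OF assms(2,3)] .
  obtain i where i: "i \<le> steps a b" "steps z (p i) \<le> 8" using step_geodesic_near[OF p(1)] p assms(1) by auto
  have M: "p i \<in> M" "z \<in> M" using p i assms(1) by (auto simp: step_geodesic_def interval_def)
  have "steps a (p i) = i" "steps (p i) b = steps a b - i" using p i unfolding step_geodesic_def by (metis diff_zero le0, metis order_refl)
  then show ?thesis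
    using steps_triangle[of a "p i" z] steps_triangle[of z "p i" b] M assms i steps_commute[of z "p i"] by simp
qed

section \<open>Hyperbolicity of the coned-off metric\<close>

lemma Metric_space_cone_dist: "Metric_space M cone_dist"
  by unfold_locales (use steps_commute steps_eq_0 steps_triangle in \<open>auto simp: cone_dist_def simp flip: of_nat_add\<close>)

sublocale cone_dist: Metric_space M cone_dist
  by (rule Metric_space_cone_dist)

abbreviation cone_gp :: "'a \<Rightarrow> 'a \<Rightarrow> 'a \<Rightarrow> real" where "cone_gp \<equiv> gromov_product cone_dist"

lemma cone_dist_interval: "z \<in> I a b \<Longrightarrow> a \<in> M \<Longrightarrow> b \<in> M \<Longrightarrow> cone_dist a z + cone_dist z b \<le> cone_dist a b + 16"
  using steps_interval[of z a b] unfolding cone_dist_def by linarith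

lemma cone_dist_le_1: "x \<in> M \<Longrightarrow> y \<in> M \<Longrightarrow> d x y \<le> 4 * \<delta> \<Longrightarrow> cone_dist x y \<le> 1"
  using steps_le_dist[of x y 1] K by (simp add: cone_dist_def)

lemma cone_gp_le_interval:
  assumes "z \<in> I a b" "a \<in> M" "b \<in> M" "w \<in> M" shows "cone_gp w a b \<le> cone_dist w z + 8"
proof -
  have "z \<in> M" using assms(1) by (simp add: interval_def)
  then show ?thesis
    using cone_dist_interval[OF assms(1-3)] cone_dist.triangle[of a z w] cone_dist.triangle[of b z w] assms
    by (simp add: gromov_product_def cone_dist.commute)
qed

text \<open>A centre of a triangle for \<open>d\<close> is also one for the new metric. The constant
  18 is 16 from \<open>cone_dist_interval\<close> plus 2 for going from \<open>c\<close> to a nearby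
  interval point and back; 9 is 8 from \<open>cone_gp_le_interval\<close> plus 1.\<close>

lemma cone_gp_center:
  assumes M: "a \<in> M" "b \<in> M" "w \<in> M" "c \<in> M"
    and c: "c0 \<in> I a b" "c1 \<in> I a w" "c2 \<in> I b w" "d c c0 \<le> 4 * \<delta>" "d c c1 \<le> 4 * \<delta>" "d c c2 \<le> 4 * \<delta>"
  shows "cone_dist w c \<le> cone_gp w a b + 18" "cone_gp w a b \<le> cone_dist w c + 9"
proof -
  have cM: "c0 \<in> M" "c1 \<in> M" "c2 \<in> M" using c by (auto simp: interval_def)
  have near: "cone_dist c c0 \<le> 1" "cone_dist c c1 \<le> 1" "cone_dist c c2 \<le> 1" using cone_dist_le_1 M cM c by auto
  have "cone_dist a c + cone_dist c w \<le> cone_dist a w + 18"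
    using cone_dist_interval[OF c(2)] cone_dist.triangle[of a c1 c] cone_dist.triangle[of c c1 w] near M cM cone_dist.commute[of c c1] by auto
  moreover have "cone_dist b c + cone_dist c w \<le> cone_dist b w + 18"
    using cone_dist_interval[OF c(3)] cone_dist.triangle[of b c2 c] cone_dist.triangle[of c c2 w] near M cM cone_dist.commute[of c c2] by auto
  moreover have "cone_dist a b \<le> cone_dist a c + cone_dist c b" using cone_dist.triangle M by blast
  ultimately show "cone_dist w c \<le> cone_gp w a b + 18"
    unfolding gromov_product_def using cone_dist.commute[of w c] cone_dist.commute[of b c] by (simp add: field_simps)
  show "cone_gp w a b \<le> cone_dist w c + 9"
    using cone_gp_le_interval[OF c(1) M(1-3)] cone_dist.triangle[of w c c0] near M cM by auto
qed

text \<open>The new product of \<open>x\<close> and \<open>z\<close> at \<open>w\<close> is nearly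
  the distance from \<open>w\<close> to a centre \<open>c\<close> of their triangle for
  \<open>d\<close>. Thinness puts \<open>c\<close> within one step of an interval from
  \<open>y\<close> to \<open>x\<close> or to \<open>z\<close>, and the product of the ends of that
  interval exceeds the distance to none of its points by more than 8. So 27 is 18 + 1 + 8.\<close>

lemma cone_dist_hyperbolic: "Gromov_hyperbolic_metric M cone_dist 27"
proof
  fix w x y z assume M: "w \<in> M" "x \<in> M" "y \<in> M" "z \<in> M"
  obtain c c1 c2 where c: "c \<in> I x z" "c1 \<in> I x w" "c2 \<in> I z w" "d c c1 \<le> 4 * \<delta>" "d c c2 \<le> 4 * \<delta>"
    using triangle_center[of x z w] M by metis
  have cM: "c \<in> M" using c by (simp add: interval_def)
  have "cone_dist w c \<le> cone_gp w x z + 18"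
    using cone_gp_center(1)[of x z w c c c1 c2] M c cM delta_nonneg by simp
  moreover obtain c' where c': "c' \<in> I x y \<union> I y z" "d c c' \<le> 4 * \<delta>"
    using thin_triangle[OF c(1)] M by blast
  moreover have "min (cone_gp w x y) (cone_gp w y z) \<le> cone_dist w c' + 8"
    using c'(1) cone_gp_le_interval[of c' x y w] cone_gp_le_interval[of c' y z w] M by auto
  moreover have "c' \<in> M" using c' by (auto simp: interval_def)
  then have "cone_dist w c' \<le> cone_dist w c + 1"
    using cone_dist.triangle[of w c c'] cone_dist_le_1[of c c'] c' M cM by simp
  ultimately show "min (cone_gp w x y) (cone_gp w y z) - 27 \<le> cone_gp w x z" by linarith
qed simp

sublocale cone_dist: Gromov_hyperbolic_metric M cone_dist 27
  by (rule cone_dist_hyperbolic)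

lemma cone_dist_coarsely_geodesic:
  assumes "x \<in> M" "y \<in> M" "0 \<le> t" "t \<le> cone_dist x y"
  shows "\<exists>m\<in>M. cone_dist x m \<le> t + 1 \<and> cone_dist m y \<le> cone_dist x y - t + 1"
proof -
  obtain p where p: "step_geodesic p (steps x y)" "p 0 = x" "p (steps x y) = y" using step_geodesic_exists[OF assms(1,2)] .
  define i where "i = nat \<lfloor>t\<rfloor>"
  have i: "real i \<le> t" "t < real i + 1" using assms(3) by (auto simp: i_def)
  then have le: "i \<le> steps x y" using assms(4) by (simp add: cone_dist_def)
  have "steps x (p i) = i" "steps (p i) y = steps x y - i" using p le unfolding step_geodesic_def by (metis diff_zero le0, metis order_refl)
  moreover have "p i \<in> M" using p le by (simp add: step_geodesic_def)
  ultimately show ?thesis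
    using i le by (intro bexI[of _ "p i"]) (auto simp: cone_dist_def of_nat_diff)
qed

text \<open>Coning may shrink products but cannot essentially enlarge them: the interval point that
  realises the product for \<open>d\<close> is about as close in the new metric, and it bounds the
  new product.\<close>

lemma cone_gp_le_gp:
  assumes "a \<in> M" "b \<in> M" "w \<in> M" shows "cone_gp w a b \<le> gp w a b + 2 * \<delta> + 9"
proof -
  obtain z where z: "z \<in> I a b" "d w z \<le> gp w a b + 2 * \<delta>" using near_interval[OF assms] by blast
  then show ?thesis
    using cone_gp_le_interval[OF z(1) assms] cone_dist_le_dist[of w z] assms by (simp add: interval_def)
qed

section \<open>Convergence to infinity in the two metrics\<close>

lemma asymptotic_cone_dist_imp:
  assumes M: "range u \<subseteq> M" "range v \<subseteq> M" and as: "asymptotic M cone_dist u v"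
  shows "asymptotic M d u v"
  unfolding asymptotic_iff
proof (intro ballI allI)
  fix w C assume w: "w \<in> M"
  obtain N where N: "\<And>m n. m \<ge> N \<Longrightarrow> n \<ge> N \<Longrightarrow> C + 2 * \<delta> + 9 \<le> cone_gp w (u m) (v n)"
    using as w unfolding asymptotic_iff by meson
  have "C \<le> gp w (u m) (v n)" if "m \<ge> N" "n \<ge> N" for m n
    using N[OF that] cone_gp_le_gp[of "u m" "v n" w] M w by (simp add: image_subset_iff)
  then show "\<exists>N. \<forall>m\<ge>N. \<forall>n\<ge>N. C \<le> gp w (u m) (v n)" by blast
qed

text \<open>Compare two centres on the interval from \<open>w\<close> to \<open>u m\<close>:
  \<open>e\<close> for the third vertex \<open>u N\<close> and \<open>c\<close> for the third vertex
  \<open>v n\<close>. Asymptoticity in \<open>d\<close> moves \<open>c\<close> beyond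
  \<open>e\<close>. Since \<open>u\<close> converges in the new metric, \<open>e\<close> is far from
  \<open>w\<close> there; as \<open>e\<close> is near an interval from \<open>w\<close> to
  \<open>c\<close>, so is \<open>c\<close>, and this distance is nearly the new product of
  \<open>u m\<close> and \<open>v n\<close>.\<close>

lemma asymptotic_imp_cone_dist:
  assumes M: "range u \<subseteq> M" "range v \<subseteq> M" and uu: "asymptotic M cone_dist u u" and uv: "asymptotic M d u v"
  shows "asymptotic M cone_dist u v"
  unfolding asymptotic_iff
proof (intro ballI allI)
  fix w C assume w: "w \<in> M"
  have uM: "u i \<in> M" "v i \<in> M" for i using M by auto
  \<comment> \<open>The comparisons below lose 9, 17 and 18, and 50 exceeds their sum. The threshold
    \<open>d w (u N)\<close> in the next step is an upper bound for \<open>d w e\<close>.\<close>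
  obtain N where N: "\<And>m n. m \<ge> N \<Longrightarrow> n \<ge> N \<Longrightarrow> C + 50 \<le> cone_gp w (u m) (u n)"
    using uu w unfolding asymptotic_iff by meson
  obtain N' where N': "\<And>m n. m \<ge> N' \<Longrightarrow> n \<ge> N' \<Longrightarrow> d w (u N) \<le> gp w (u m) (v n)"
    using uv w unfolding asymptotic_iff by meson
  have "C \<le> cone_gp w (u m) (v n)" if mn: "m \<ge> max N N'" "n \<ge> max N N'" for m n
  proof -
    obtain c c1 c2 where c: "c \<in> I w (u m)" "c1 \<in> I w (v n)" "c2 \<in> I (u m) (v n)"
      "d c c1 \<le> 4 * \<delta>" "d c c2 \<le> 4 * \<delta>" "d w c = gp w (u m) (v n)"
      using triangle_center[OF w uM(1)[of m] uM(2)[of n]] by metis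
    obtain e e1 e2 where e: "e \<in> I w (u m)" "e1 \<in> I w (u N)" "e2 \<in> I (u m) (u N)"
      "d e e1 \<le> 4 * \<delta>" "d e e2 \<le> 4 * \<delta>" "d w e = gp w (u m) (u N)"
      using triangle_center[OF w uM(1)[of m] uM(1)[of N]] by metis
    have ceM: "c \<in> M" "e \<in> M" using c e by (auto simp: interval_def)
    have "gp w (u m) c = d w c" using c ceM by (simp add: interval_def gromov_product_def commute)
    moreover have "d w e \<le> d w c"
      using e(6) c(6) gp_le_right[OF w uM(1)[of m] uM(1)[of N]] N'[of m n] mn by simp
    ultimately obtain e' where e': "e' \<in> I w c" "d e e' \<le> 4 * \<delta>"
      using fellow_travel[OF e(1) w uM(1) ceM(1)] by auto
    have e'M: "e' \<in> M" using e' by (simp add: interval_def)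
    have "cone_dist w e \<le> cone_dist w c + 17"
      using cone_dist_interval[OF e'(1) w ceM(1)] cone_dist.triangle[of w e' e] cone_dist_le_1[of e e'] e'(2) w ceM e'M
        cone_dist.commute[of e e'] cone_dist.nonneg[of e' c] by linarith
    moreover have "cone_gp w (u m) (u N) \<le> cone_dist w e + 9"
      using cone_gp_center(2)[of "u m" "u N" w e e2 e e1] interval_commute e uM w ceM delta_nonneg by auto
    moreover have "cone_dist w c \<le> cone_gp w (u m) (v n) + 18"
      using cone_gp_center(1)[of "u m" "v n" w c c2 c c1] interval_commute c uM w ceM delta_nonneg by auto
    ultimately show ?thesis using N[of m N] mn by simp
  qed
  then show "\<exists>N. \<forall>m\<ge>N. \<forall>n\<ge>N. C \<le> cone_gp w (u m) (v n)" by blast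
qed

lemma Orb_coarsely_dense:
  assumes x: "x \<in> M" shows "\<exists>p\<in>Orb. cone_dist x p \<le> R + 3"
proof -
  obtain o' where o': "o' \<in> Orb" using Orb by blast
  then have oM: "o' \<in> M" using Orb by blast
  define S where "S = {t. \<exists>z\<in>I x o'. d x z = t \<and> (\<exists>p\<in>Orb. d z p \<le> R)}"
  have "d x o' \<in> S" using o' oM x R endpoints_in_interval[OF x oM] by (auto simp: S_def intro!: bexI[of _ o'])
  have bdd: "bdd_below S" by (rule bdd_belowI[of _ 0]) (auto simp: S_def)
  \<comment> \<open>The infimum need not be attained, as the space is not assumed proper. So
    \<open>z\<close> is within 1/2 of the first contact, and the point \<open>y\<close> below is
    chosen 1 before \<open>z\<close>; then nothing between \<open>x\<close> and \<open>y\<close> is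
    within R of the orbit.\<close>
  obtain t where t: "t \<in> S" "t < Inf S + 1 / 2"
    using cInf_lessD[of S "Inf S + 1/2"] \<open>d x o' \<in> S\<close> by auto
  then obtain z p where z: "z \<in> I x o'" "d x z = t" "p \<in> Orb" "d z p \<le> R" by (auto simp: S_def)
  have zM: "z \<in> M" "p \<in> M" using z Orb by (auto simp: interval_def)
  have "cone_dist x z \<le> 2"
  proof (cases "t \<le> 1")
    case True
    then show ?thesis using steps_le_dist[OF x zM(1), of 1] z K by (simp add: cone_dist_def)
  next
    case False
    obtain y where y: "y \<in> M" "d x y = t - 1" "d y z = 1"
      using geodesic[OF x zM(1), of "t - 1"] False z by auto
    have yI: "y \<in> I x z" using y z by (simp add: interval_def)
    have "R < d w p'" if w: "w \<in> I x y" and p': "p' \<in> Orb" for w p'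
    proof (rule ccontr)
      assume "\<not> R < d w p'"
      moreover have "w \<in> I x o'"
        using interval_subset[OF yI x zM(1)] interval_subset[OF z(1) x oM] w by blast
      ultimately have "d x w \<in> S" using p' by (force simp: S_def)
      then have "Inf S \<le> d x w" using bdd by (rule cInf_lower)
      moreover have "d x w \<le> t - 1" using interval_le(1)[OF w] y by simp
      ultimately show False using t by simp
    qed
    then have "(x, y) \<in> adj" using x y by (simp add: adj_def)
    then have "steps x y \<le> 1" by (rule steps_adj)
    moreover have "steps y z \<le> 1" using steps_le_dist[OF y(1) zM(1), of 1] y K by simp
    ultimately show ?thesis using steps_triangle[OF x y(1) zM(1)] by (simp add: cone_dist_def)
  qed
  moreover have "cone_dist z p \<le> R + 1" using cone_dist_le_dist[OF zM] z by simp
  ultimately show ?thesis using cone_dist.triangle[OF x zM] z(3) by (intro bexI[of _ p]) auto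
qed

lemma steps_isometry_le:
  assumes h: "\<And>x y. x \<in> M \<Longrightarrow> y \<in> M \<Longrightarrow> d (h x) (h y) = d x y" "h ` M = M" "Orb \<subseteq> h ` Orb"
    and M: "x \<in> M" "y \<in> M"
  shows "steps (h x) (h y) \<le> steps x y"
proof -
  have hM: "h x \<in> M" if "x \<in> M" for x using h(2) that by blast
  have adj: "(h x, h y) \<in> adj" if xy: "(x, y) \<in> adj" for x y
  proof (cases "d x y \<le> K")
    case True
    then show ?thesis using xy h(1) hM by (simp add: adj_def)
  next
    case False
    have M: "x \<in> M" "y \<in> M" using xy by (auto simp: adj_def)
    have "R < d z p" if z: "z \<in> I (h x) (h y)" and p: "p \<in> Orb" for z p
    proof -
      obtain z' where z': "z' \<in> M" "z = h z'" using z h(2) by (auto simp: interval_def)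
      obtain p' where p': "p' \<in> Orb" "p = h p'" using p h(3) by blast
      have "z' \<in> I x y" using z z' M h(1) by (simp add: interval_def)
      then have "R < d z' p'" using False xy p' by (auto simp: adj_def)
      then show ?thesis using z' p' h(1) Orb by auto
    qed
    then show ?thesis using M hM by (simp add: adj_def)
  qed
  obtain p where p: "step_geodesic p (steps x y)" "p 0 = x" "p (steps x y) = y" using step_geodesic_exists[OF M] .
  show ?thesis
  proof (rule steps_le)
    show "(h x, h y) \<in> adj ^^ steps x y"
      unfolding relpow_fun_conv using p step_geodesic_adj[OF p(1)] adj by (intro exI[of _ "h \<circ> p"]) auto
  qed
qed

text \<open>Coning cannot shorten an interval that stays near the orbit by much. Each of its points
  is within k * K of a link of a graph geodesic with at most 2 ^ k links; that link comes within R
  of \<open>Orb\<close>, so it is not coned and has length at most K. Hence 2 ^ k balls of radius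
  \<rho> = K * (k + 1) cover the interval, and two of 2 ^ k + 1 points with gaps 2 * \<rho> + 1
  would share a ball.\<close>

lemma dist_bound_near_Orb:
  assumes M: "a \<in> M" "b \<in> M" and near: "\<And>z. z \<in> I a b \<Longrightarrow> \<exists>p\<in>Orb. d z p \<le> R'"
    and R': "R' + real k * K \<le> R" and steps: "steps a b \<le> 2 ^ k"
  shows "d a b < 2 ^ k * (2 * (K * (k + 1)) + 1)"
proof (rule ccontr)
  define \<rho> where "\<rho> = K * (k + 1)"
  assume "\<not> ?thesis"
  then have ge: "2 ^ k * (2 * \<rho> + 1) \<le> d a b" by (simp add: \<rho>_def)
  have \<rho>: "0 \<le> \<rho>" using K by (simp add: \<rho>_def)
  obtain p where p: "step_geodesic p (steps a b)" "p 0 = a" "p (steps a b) = b" using step_geodesic_exists[OF M] .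
  define q where "q = (\<lambda>i. p (min i (steps a b)))"
  have qM: "q i \<in> M" for i using p(1) by (simp add: q_def step_geodesic_def)
  have cover: "\<exists>i<2 ^ k. d z (q i) \<le> \<rho>" if z: "z \<in> I a b" for z
  proof -
    obtain i z' where i: "i < 2 ^ k" "z' \<in> I (q i) (q (Suc i))" "d z z' \<le> real k * K"
      using near_log[of "steps a b" p k z] step_geodesic_adj[OF p(1)] p M z steps by (auto simp: q_def)
    have zM: "z \<in> M" "z' \<in> M" using z i by (auto simp: interval_def)
    obtain o' where o': "o' \<in> Orb" "d z o' \<le> R'" using near[OF z] by blast
    then have "d z' o' \<le> R" using triangle[of z' z o'] i(3) zM Orb R' commute[of z z'] by auto
    moreover have "(q i, q (Suc i)) \<in> adj"
    proof (cases "i < steps a b")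
      case True
      then show ?thesis using step_geodesic_adj[OF p(1) True] by (simp add: q_def)
    next
      case False
      then show ?thesis using adj_refl[OF qM[of i]] by (simp add: q_def)
    qed
    ultimately have "d (q i) (q (Suc i)) \<le> K" using i(2) o'(1) by (force simp: adj_def)
    then have "d (q i) z' \<le> K" using interval_le(1)[OF i(2)] by simp
    then have "d z (q i) \<le> \<rho>"
      using triangle[of z z' "q i"] zM qM[of i] i(3) commute[of z' "q i"] by (simp add: \<rho>_def algebra_simps)
    with i(1) show ?thesis by blast
  qed
  have "\<exists>z\<in>I a b. d a z = real l * (2 * \<rho> + 1)" if "l \<le> 2 ^ k" for l :: nat
  proof -
    have "real l * (2 * \<rho> + 1) \<le> 2 ^ k * (2 * \<rho> + 1)"
      using that \<rho> by (intro mult_right_mono) auto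
    then obtain z where "z \<in> M" "d a z = real l * (2 * \<rho> + 1)" "d z b = d a b - real l * (2 * \<rho> + 1)"
      using geodesic[OF M, of "real l * (2 * \<rho> + 1)"] order_trans[OF _ ge] \<rho> by auto
    then show ?thesis by (auto simp: interval_def)
  qed
  then obtain z where z: "\<And>l. l \<le> 2 ^ k \<Longrightarrow> z l \<in> I a b \<and> d a (z l) = real l * (2 * \<rho> + 1)" by metis
  then have "\<forall>l. \<exists>i. l \<le> 2 ^ k \<longrightarrow> i < 2 ^ k \<and> d (z l) (q i) \<le> \<rho>" using cover by blast
  then obtain i where i: "\<And>l. l \<le> 2 ^ k \<Longrightarrow> i l < 2 ^ k \<and> d (z l) (q (i l)) \<le> \<rho>" by metis
  have "\<not> inj_on i {..2 ^ k}"
  proof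
    assume "inj_on i {..2 ^ k}"
    then have "card {..(2::nat) ^ k} \<le> card {..<(2::nat) ^ k}"
      using i by (intro card_inj_on_le) auto
    then show False by simp
  qed
  then obtain l m where lm: "l \<le> 2 ^ k" "m \<le> 2 ^ k" "l < m" "i l = i m"
    unfolding inj_on_def by (metis atMost_iff nat_neq_iff)
  have zM: "z l \<in> M" "z m \<in> M" using z lm by (auto simp: interval_def)
  have "d (z l) (z m) \<le> 2 * \<rho>"
    using triangle[of "z l" "q (i l)" "z m"] i[OF lm(1)] i[OF lm(2)] lm(4) zM qM commute[of "q (i m)" "z m"] by simp
  moreover have "d a (z m) \<le> d a (z l) + d (z l) (z m)" using triangle M zM by blast
  moreover have "d a (z m) = d a (z l) + real (m - l) * (2 * \<rho> + 1)"
    using z lm by (simp add: of_nat_diff algebra_simps)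
  moreover have "1 * (2 * \<rho> + 1) \<le> real (m - l) * (2 * \<rho> + 1)"
    using lm \<rho> by (intro mult_right_mono) auto
  ultimately show False by simp
qed

end

section \<open>Loxodromic isometries\<close>

text \<open>The orbit of a point under the powers of an isometry, recorded only through its
  distances; the reversed orbit is then an instance as well. \<open>long\<close> outweighs
  \<open>angle\<close>, which is the local condition that propagates to global straightness.\<close>

locale quasi_axis = geodesic_hyperbolic_metric +
  fixes x :: "int \<Rightarrow> 'a" and b :: real
  assumes x_in: "x i \<in> M"
    and homogeneous: "d (x (i + k)) (x (j + k)) = d (x i) (x j)"
    and angle: "gp (x 0) (x (- 1)) (x 1) \<le> b"
    and long: "2 * b + 4 * \<delta> + 1 \<le> d (x 0) (x 1)"
begin

lemma gp_shift: "gp (x (i + k)) (x (j + k)) (x (l + k)) = gp (x i) (x j) (x l)"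
  by (simp add: gromov_product_def homogeneous)

lemma dist_diff: "d (x i) (x j) = d (x 0) (x (j - i))"
  using homogeneous[of 0 i "j - i"] by simp

lemma b_nonneg: "0 \<le> b"
  using gp_nonneg[of "x 0" "x (- 1)" "x 1"] x_in angle by simp

text \<open>The two parts feed each other. A turn of at most b + \<delta> yields growth; growth
  makes the product of \<open>x 0\<close> and the previous point, seen from the next one, exceed b +
  \<delta>, so that in the hyperbolic inequality the minimum must be the new turn.\<close>

lemma turn_and_growth:
  "gp (x (int n + 1)) (x 0) (x (int n + 2)) \<le> b + \<delta> \<and>
   d (x 0) (x (int n)) + (d (x 0) (x 1) - 2 * b - 2 * \<delta>) \<le> d (x 0) (x (int n + 1))"
proof (induction n)
  case 0
  have "gp (x 1) (x 0) (x 2) = gp (x 0) (x (- 1)) (x 1)" using gp_shift[of 0 1 "- 1" 1] by simp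
  then show ?case using angle b_nonneg delta_nonneg x_in by simp
next
  case (Suc n)
  let ?i = "int n + 1"
  let ?a = "d (x 0) (x 1)"
  have a: "d (x j) (x (j + 1)) = ?a" for j using dist_diff[of j "j + 1"] by simp
  have gr: "d (x 0) (x ?i) + (?a - 2 * b - 2 * \<delta>) \<le> d (x 0) (x (?i + 1))"
    using Suc.IH a[of ?i] unfolding gromov_product_def by (simp add: commute add.commute field_simps)
  have "min (gp (x (?i + 1)) (x ?i) (x 0)) (gp (x (?i + 1)) (x 0) (x (?i + 2))) - \<delta>
      \<le> gp (x (?i + 1)) (x ?i) (x (?i + 2))"
    using hyperbolic x_in by blast
  also have "\<dots> = gp (x 0) (x (- 1)) (x 1)"
    using gp_shift[of 0 "?i + 1" "- 1" 1] by (simp add: algebra_simps)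
  finally have "min (gp (x (?i + 1)) (x ?i) (x 0)) (gp (x (?i + 1)) (x 0) (x (?i + 2))) \<le> b + \<delta>"
    using angle by linarith
  moreover have "gp (x (?i + 1)) (x ?i) (x 0) > b + \<delta>"
    using gr a[of ?i] long b_nonneg delta_nonneg unfolding gromov_product_def
    by (simp add: commute field_simps)
  ultimately have "gp (x (?i + 1)) (x 0) (x (?i + 2)) \<le> b + \<delta>" by linarith
  with gr show ?case by (simp add: add.commute add.left_commute)
qed

lemma growth: "d (x 0) (x (int n)) + (d (x 0) (x 1) - 2 * b - 2 * \<delta>) \<le> d (x 0) (x (int n + 1))"
  using turn_and_growth by blast

lemma escape: "real n \<le> d (x 0) (x (int n))"
proof (induction n)
  case (Suc n)
  then show ?case using growth[of n] long delta_nonneg by (simp add: add.commute)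
qed simp

lemma dist_le: "d (x 0) (x (int n)) \<le> real n * d (x 0) (x 1)"
proof (induction n)
  case 0
  then show ?case using x_in by simp
next
  case (Suc n)
  have "d (x 0) (x (int (Suc n))) \<le> d (x 0) (x (int n)) + d (x (int n)) (x (int n + 1))"
    using triangle[of "x 0" "x (int n)" "x (int n + 1)"] x_in by (simp add: add.commute)
  also have "d (x (int n)) (x (int n + 1)) = d (x 0) (x 1)" using dist_diff[of "int n" "int n + 1"] by simp
  finally show ?case using Suc by (simp add: algebra_simps)
qed

lemma reverse: "quasi_axis M d \<delta> (\<lambda>i. x (- i)) b"
proof
  show "d (x (- (i + k))) (x (- (j + k))) = d (x (- i)) (x (- j))" for i j k
    using homogeneous[of "- i" "- k" "- j"] by simp
  show "gp (x (- 0)) (x (- (- 1))) (x (- 1)) \<le> b" using angle gp_commute by simp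
  show "2 * b + 4 * \<delta> + 1 \<le> d (x (- 0)) (x (- 1))"
    using long dist_diff[of "- 1" 0] commute by simp
qed (rule x_in)

text \<open>\<open>turn_and_growth\<close> settles the case of an endpoint adjacent to
  \<open>x j\<close>. By growth, a farther endpoint lies in the same direction from
  \<open>x j\<close> as its neighbour, at the cost of one more \<delta>.\<close>

lemma straight:
  assumes "i \<le> j" "j \<le> k" shows "gp (x j) (x i) (x k) \<le> b + 2 * \<delta>"
proof (cases "i = j \<or> j = k")
  case True
  then have "gp (x j) (x i) (x k) = 0" using x_in by (auto simp: gromov_product_def commute)
  then show ?thesis using b_nonneg delta_nonneg by simp
next
  case False
  define m where "m = nat (j - i - 1)"
  define n where "n = nat (k - j - 1)"
  have mn: "i = - (int m + 1) + j" "k = int n + 1 + j" using assms False by (auto simp: m_def n_def)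
  have eq: "gp (x j) (x i) (x k) = gp (x 0) (x (- (int m + 1))) (x (int n + 1))"
    using gp_shift[of 0 j "- (int m + 1)" "int n + 1"] mn by simp
  have "min (gp (x 0) (x (- (int m + 1))) (x (int n + 1))) (gp (x 0) (x (int n + 1)) (x 1)) - \<delta>
      \<le> gp (x 0) (x (- (int m + 1))) (x 1)"
    using hyperbolic x_in by blast
  also have "\<dots> = gp (x (int m + 1)) (x 0) (x (int m + 2))"
    using gp_shift[of 0 "int m + 1" "- (int m + 1)" 1] by (simp add: algebra_simps)
  also have "\<dots> \<le> b + \<delta>" using turn_and_growth by blast
  finally have "min (gp (x 0) (x (- (int m + 1))) (x (int n + 1))) (gp (x 0) (x (int n + 1)) (x 1)) \<le> b + 2 * \<delta>"
    by simp
  moreover have "gp (x 0) (x (int n + 1)) (x 1) > b + 2 * \<delta>"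
    using growth[of n] dist_diff[of 1 "int n + 1"] long b_nonneg delta_nonneg commute[of "x 1" "x (int n + 1)"]
    unfolding gromov_product_def by (simp add: commute[of _ "x 0"] field_simps)
  ultimately show ?thesis unfolding eq by linarith
qed

definition pos :: "nat \<Rightarrow> 'a" where "pos n = x (int n)"
definition neg :: "nat \<Rightarrow> 'a" where "neg n = x (- int n)"

lemma range_pos: "range pos \<subseteq> M" and range_neg: "range neg \<subseteq> M"
  using x_in by (auto simp: pos_def neg_def)

lemma gp_pos: assumes "m \<le> n" shows "real m - (b + 2 * \<delta>) \<le> gp (x 0) (pos m) (pos n)"
  using straight[of 0 "int m" "int n"] gp_add_swap[of "x 0" "x (int m)" "x (int n)"] escape[of m] assms
  unfolding pos_def by simp

lemma pos_gromov: "pos \<in> gromov_sequences M d"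
proof -
  have "\<exists>N. \<forall>m\<ge>N. \<forall>n\<ge>N. C \<le> gp (x 0) (pos m) (pos n)" for C
  proof (intro exI[of _ "nat \<lceil>C + (b + 2 * \<delta>)\<rceil>"] allI impI)
    fix m n assume mn: "nat \<lceil>C + (b + 2 * \<delta>)\<rceil> \<le> m" "nat \<lceil>C + (b + 2 * \<delta>)\<rceil> \<le> n"
    then have "C + (b + 2 * \<delta>) \<le> real (min m n)" by linarith
    moreover have "real (min m n) - (b + 2 * \<delta>) \<le> gp (x 0) (pos m) (pos n)"
      using gp_pos[of m n] gp_pos[of n m] gp_commute[of "x 0" "pos m" "pos n"] by (cases "m \<le> n") auto
    ultimately show "C \<le> gp (x 0) (pos m) (pos n)" by linarith
  qed
  then show ?thesis
    using asymptotic_base[OF x_in[of 0] range_pos range_pos] range_pos by (simp add: gromov_sequences_def)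
qed

lemma neg_gromov: "neg \<in> gromov_sequences M d"
proof -
  interpret r: quasi_axis M d \<delta> "\<lambda>i. x (- i)" b by (rule reverse)
  have "r.pos = neg" by (auto simp: r.pos_def neg_def)
  then show ?thesis using r.pos_gromov by simp
qed

lemma pos_neg_not_asymptotic: "\<not> asymptotic M d pos neg"
proof
  assume "asymptotic M d pos neg"
  then obtain N where "b + 2 * \<delta> + 1 \<le> gp (x 0) (pos N) (neg N)"
    using x_in[of 0] unfolding asymptotic_iff by (meson order_refl)
  then show False
    using straight[of "- int N" 0 "int N"] gp_commute[of "x 0" "pos N" "neg N"]
    by (simp add: pos_def neg_def)
qed

text \<open>An axis point whose distance from \<open>x i\<close> is nearly that of \<open>z\<close>
  is close to \<open>z\<close>, because by \<open>straight\<close> it lies nearly between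
  \<open>x i\<close> and \<open>x k\<close>.\<close>

lemma interval_near_axis:
  assumes z: "z \<in> I (x i) (x k)" and "i \<le> k"
  shows "\<exists>j. d z (x j) \<le> d (x 0) (x 1) + 2 * b + 6 * \<delta>"
proof -
  define f where "f = (\<lambda>n. d (x i) (x (i + int n)))"
  define N where "N = nat (k - i)"
  define t where "t = d (x i) z"
  have fN: "f N = d (x i) (x k)" using \<open>i \<le> k\<close> by (simp add: f_def N_def)
  have zM: "z \<in> M" using z by (simp add: interval_def)
  have tz: "d z (x k) = d (x i) (x k) - t" using z by (simp add: interval_def t_def)
  have tN: "t \<le> f N" unfolding fN t_def by (rule interval_le(1)[OF z])
  have step: "f (Suc n) \<le> f n + d (x 0) (x 1)" for n
    using triangle[of "x i" "x (i + int n)" "x (i + int (Suc n))"] x_in dist_diff[of "i + int n" "i + int (Suc n)"]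
    by (simp add: f_def)
  obtain n where n: "n \<le> N" "f n \<le> t" "t - d (x 0) (x 1) \<le> f n"
  proof -
    \<comment> \<open>A step along the axis adds at most \<open>d (x 0) (x 1)\<close> to
      \<open>f\<close>, so just before reaching \<open>t\<close> it is below \<open>t\<close> by at
      most that much.\<close>
    define n where "n = (LEAST n. t \<le> f n)"
    have tn: "t \<le> f n" and nN: "n \<le> N" unfolding n_def using tN by (auto intro: LeastI Least_le)
    show thesis
    proof (cases n)
      case 0
      then show thesis
        using that[of 0] tn x_in nonneg[of "x 0" "x 1"] nonneg[of "x i" z] by (simp add: f_def t_def)
    next
      case (Suc m)
      then have "\<not> t \<le> f m" unfolding n_def by (metis lessI not_less_Least)
      then show thesis using that[of m] Suc nN tn step[of m] by simp
    qed
  qed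
  define j where "j = i + int n"
  have "j \<le> k" using n(1) \<open>i \<le> k\<close> by (simp add: j_def N_def)
  then have "gp (x j) (x i) (x k) \<le> b + 2 * \<delta>" by (intro straight) (auto simp: j_def)
  then have "d (x j) (x k) \<le> d (x i) (x k) - f n + 2 * (b + 2 * \<delta>)"
    unfolding gromov_product_def f_def j_def by (simp add: commute field_simps)
  moreover have "d z (x j) + d (x i) (x k) \<le> max (d z (x i) + d (x j) (x k)) (d z (x k) + d (x j) (x i)) + 2 * \<delta>"
    using four_point[of z "x j" "x i" "x k"] zM x_in by simp
  moreover have "d z (x i) = t" "d (x j) (x i) = f n" by (simp_all add: t_def f_def j_def commute)
  ultimately have "d z (x j) + d (x i) (x k) \<le> t + d (x j) (x k) + 2 * \<delta> \<or>
      d z (x j) + d (x i) (x k) \<le> d z (x k) + f n + 2 * \<delta>"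
    "d (x j) (x k) \<le> d (x i) (x k) - f n + 2 * (b + 2 * \<delta>)"
    by (auto simp: max_def split: if_splits)
  then have "d z (x j) \<le> d (x 0) (x 1) + 2 * b + 6 * \<delta>"
    using n(2,3) tz nonneg[of "x 0" "x 1"] b_nonneg delta_nonneg by argo
  then show ?thesis by blast
qed

text \<open>Meant for a translate of the axis with the same ends: \<open>y\<close> lies nearly
  between \<open>u n\<close> and \<open>v n\<close>, hence nearly between two far points of the
  axis.\<close>

lemma near_axis_if_ends_match:
  assumes y: "y \<in> M" and M: "range u \<subseteq> M" "range v \<subseteq> M"
    and uv: "\<And>n. gp y (u n) (v n) \<le> b + 2 * \<delta>"
    and as: "asymptotic M d u pos" "asymptotic M d v neg"
  shows "\<exists>j. d y (x j) \<le> d (x 0) (x 1) + 3 * b + 12 * \<delta>"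
proof -
  have uM: "u n \<in> M" "v n \<in> M" "pos n \<in> M" "neg n \<in> M" for n using M range_pos range_neg by auto
  obtain N1 where N1: "\<And>m n. m \<ge> N1 \<Longrightarrow> n \<ge> N1 \<Longrightarrow> b + 4 * \<delta> + 1 \<le> gp y (u m) (pos n)"
    using as(1) y unfolding asymptotic_iff by meson
  obtain N2 where N2: "\<And>m n. m \<ge> N2 \<Longrightarrow> n \<ge> N2 \<Longrightarrow> b + 4 * \<delta> + 1 \<le> gp y (v m) (neg n)"
    using as(2) y unfolding asymptotic_iff by meson
  define n where "n = max N1 N2"
  have "min (gp y (u n) (pos n)) (min (gp y (pos n) (neg n)) (gp y (neg n) (v n))) - 2 * \<delta> \<le> gp y (u n) (v n)"
    using hyperbolic3 y uM by blast
  then have "gp y (pos n) (neg n) \<le> b + 4 * \<delta>"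
    using N1[of n n] N2[of n n] uv[of n] gp_commute[of y "neg n" "v n"] by (simp add: n_def min_def split: if_splits)
  moreover obtain z where z: "z \<in> I (neg n) (pos n)" "d y z \<le> gp y (neg n) (pos n) + 2 * \<delta>"
    using near_interval[OF uM(4)[of n] uM(3)[of n] y] by blast
  moreover obtain j where "d z (x j) \<le> d (x 0) (x 1) + 2 * b + 6 * \<delta>"
    using interval_near_axis[of z "- int n" "int n"] z(1) by (auto simp: pos_def neg_def)
  moreover have "z \<in> M" using z(1) by (simp add: interval_def)
  ultimately have "d y (x j) \<le> d (x 0) (x 1) + 3 * b + 12 * \<delta>"
    using triangle[of y z "x j"] y x_in gp_commute[of y "neg n" "pos n"] by simp
  then show ?thesis by blast
qed

text \<open>A point far out and near the axis is close to some \<open>x j\<close> with large |j|, so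
  its product with \<open>pos\<close> or \<open>neg\<close> at that index is large.\<close>

lemma asymptotic_if_near_axis:
  assumes u: "u \<in> gromov_sequences M d" and near: "\<And>n. \<exists>j. d (u n) (x j) \<le> C"
  shows "asymptotic M d u pos \<or> asymptotic M d u neg"
proof (rule ccontr)
  assume "\<not> ?thesis"
  then obtain C1 N1 C2 N2 where
    C1: "\<And>i j. i \<ge> N1 \<Longrightarrow> j \<ge> N1 \<Longrightarrow> gp (x 0) (u i) (pos j) \<le> C1" and
    C2: "\<And>i j. i \<ge> N2 \<Longrightarrow> j \<ge> N2 \<Longrightarrow> gp (x 0) (u i) (neg j) \<le> C2"
    using not_asymptotic_bounded[OF x_in u pos_gromov] not_asymptotic_bounded[OF x_in u neg_gromov] by metis
  have M: "range u \<subseteq> M" and uu: "asymptotic M d u u" using u by (auto simp: gromov_sequences_def)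
  have uM: "u n \<in> M" for n using M by auto
  define N where "N = max N1 N2"
  \<comment> \<open>The first entry forces |j| \<ge> N, and the second contradicts the bounds on the
    products.\<close>
  define L where "L = max (real N * d (x 0) (x 1) + C) (max C1 C2 + C) + 1"
  obtain n where n: "n \<ge> N" "L \<le> gp (x 0) (u n) (u n)"
    using uu asymptotic_base[OF x_in M M] by (meson linear order_trans)
  have un: "gp (x 0) (u n) (u n) = d (x 0) (u n)" using uM by (simp add: gromov_product_def commute)
  obtain j where j: "d (u n) (x j) \<le> C" using near by blast
  have gpj: "d (x 0) (u n) - C \<le> gp (x 0) (u n) (x j)"
    using triangle[of "x 0" "x j" "u n"] j uM x_in unfolding gromov_product_def by (simp add: commute field_simps)
  have "N \<le> nat \<bar>j\<bar>"
  proof (rule ccontr)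
    assume "\<not> N \<le> nat \<bar>j\<bar>"
    then have "real (nat \<bar>j\<bar>) * d (x 0) (x 1) \<le> real N * d (x 0) (x 1)" by (intro mult_right_mono) auto
    moreover have "d (x 0) (x j) = d (x 0) (x (int (nat \<bar>j\<bar>)))"
      using dist_diff[of j 0] commute by (cases "j \<ge> 0") auto
    ultimately have "d (x 0) (x j) \<le> real N * d (x 0) (x 1)" using dist_le[of "nat \<bar>j\<bar>"] by linarith
    then have "d (x 0) (u n) \<le> real N * d (x 0) (x 1) + C"
      using triangle[of "x 0" "x j" "u n"] j uM x_in by (simp add: commute)
    then show False using n un by (simp add: L_def)
  qed
  moreover have "pos (nat \<bar>j\<bar>) = x j \<or> neg (nat \<bar>j\<bar>) = x j" by (auto simp: pos_def neg_def abs_if)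
  ultimately have "gp (x 0) (u n) (x j) \<le> max C1 C2"
    using C1[of n "nat \<bar>j\<bar>"] C2[of n "nat \<bar>j\<bar>"] n(1) by (auto simp: N_def)
  then show False using gpj n(2) un by (simp add: L_def)
qed

text \<open>North-south dynamics. If \<open>u\<close> keeps away from \<open>neg\<close>, its
  translate by m has a product of at least m minus a constant with \<open>x m\<close>; by invariance
  of the class so has \<open>u\<close>, up to \<delta>, and then it cannot keep away from
  \<open>pos\<close>.\<close>

lemma asymptotic_if_translation_invariant:
  assumes u: "u \<in> gromov_sequences M d"
    and T: "\<And>k y. y \<in> M \<Longrightarrow> T k y \<in> M" "\<And>k y z. y \<in> M \<Longrightarrow> z \<in> M \<Longrightarrow> d (T k y) (T k z) = d y z"
      "\<And>k i. T k (x i) = x (i + k)"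
    and l: "l > 0" and inv: "\<And>n::nat. asymptotic M d (T (int n * l) \<circ> u) u"
  shows "asymptotic M d u pos \<or> asymptotic M d u neg"
proof (rule ccontr)
  assume "\<not> ?thesis"
  then obtain C1 N1 C2 N2 where
    C1: "\<And>i j. i \<ge> N1 \<Longrightarrow> j \<ge> N1 \<Longrightarrow> gp (x 0) (u i) (pos j) \<le> C1" and
    C2: "\<And>i j. i \<ge> N2 \<Longrightarrow> j \<ge> N2 \<Longrightarrow> gp (x 0) (u i) (neg j) \<le> C2"
    using not_asymptotic_bounded[OF x_in u pos_gromov] not_asymptotic_bounded[OF x_in u neg_gromov] by metis
  have M: "range u \<subseteq> M" using u by (auto simp: gromov_sequences_def)
  have uM: "u n \<in> M" for n using M by auto
  define n where "n = max (max N1 N2) (nat \<lceil>C1 + C2 + \<delta> + 1\<rceil>)"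
  define m where "m = n * nat l"
  have "1 \<le> nat l" using l by linarith
  then have mn: "n \<le> m" using mult_le_mono2[of 1 "nat l" n] by (simp add: m_def)
  have m: "int m = int n * l" using l by (simp add: m_def)
  obtain N where N: "\<And>i j. i \<ge> N \<Longrightarrow> j \<ge> N \<Longrightarrow> C1 + \<delta> + 1 \<le> gp (x 0) ((T (int m) \<circ> u) i) (u j)"
    using inv[of n] x_in[of 0] unfolding asymptotic_iff m by meson
  define i where "i = max N n"
  have "gp (x 0) (T m (u i)) (x m) = gp (T m (x (- int m))) (T m (u i)) (T m (x 0))"
    by (simp add: T(3))
  also have "\<dots> = gp (x (- int m)) (u i) (x 0)"
    using T(2) uM x_in by (simp add: gromov_product_def)
  also have "\<dots> = d (x 0) (x (- int m)) - gp (x 0) (u i) (neg m)"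
    using gp_add_swap[of "x 0" "x (- int m)" "u i"] gp_commute by (simp add: neg_def)
  finally have "gp (x 0) (T m (u i)) (x m) = d (x 0) (x m) - gp (x 0) (u i) (neg m)"
    using dist_diff[of "- int m" 0] commute by simp
  moreover have "gp (x 0) (u i) (neg m) \<le> C2" using C2 mn by (simp add: i_def n_def)
  moreover have "C1 + C2 + \<delta> + 1 \<le> real m" using mn unfolding n_def by linarith
  ultimately have "C1 + \<delta> + 1 \<le> gp (x 0) (T m (u i)) (x m)" using escape[of m] by linarith
  moreover have "C1 + \<delta> + 1 \<le> gp (x 0) (u i) (T m (u i))" using N[of i i] gp_commute by (simp add: i_def)
  moreover have "min (gp (x 0) (u i) (T m (u i))) (gp (x 0) (T m (u i)) (x m)) - \<delta> \<le> gp (x 0) (u i) (x m)"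
    using hyperbolic x_in uM T(1) by blast
  moreover have "gp (x 0) (u i) (x m) \<le> C1" using C1[of i m] mn by (simp add: i_def n_def pos_def)
  ultimately show False by linarith
qed

end

section \<open>Isometric actions and the existence of loxodromic elements\<close>

locale hyperbolic_action = geodesic_hyperbolic_metric +
  fixes G (structure) and \<phi> :: "'g \<Rightarrow> 'a \<Rightarrow> 'a"
  assumes action: "isometric_action G M d \<phi>"
begin

sublocale group_action G M \<phi>
  using action by (simp add: isometric_action_def)

sublocale group G
  using group_hom group_hom.axioms(1) by auto

lemma iso: "g \<in> carrier G \<Longrightarrow> x \<in> M \<Longrightarrow> y \<in> M \<Longrightarrow> d (\<phi> g x) (\<phi> g y) = d x y"
  using action by (simp add: isometric_action_def)

lemma act_in [simp]: "g \<in> carrier G \<Longrightarrow> x \<in> M \<Longrightarrow> \<phi> g x \<in> M"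
  using element_image by blast

lemma act_one [simp]: "x \<in> M \<Longrightarrow> \<phi> \<one> x = x"
  using id_eq_one by (metis restrict_apply')

lemma act_mult: "g \<in> carrier G \<Longrightarrow> h \<in> carrier G \<Longrightarrow> x \<in> M \<Longrightarrow> \<phi> g (\<phi> h x) = \<phi> (g \<otimes> h) x"
  using composition_rule by simp

lemma dist_inv: "g \<in> carrier G \<Longrightarrow> x \<in> M \<Longrightarrow> y \<in> M \<Longrightarrow> d x (\<phi> (inv g) y) = d (\<phi> g x) y"
  using iso[of g x "\<phi> (inv g) y"] act_mult[of g "inv g" y] by simp

lemma asymptotic_act:
  assumes "g \<in> carrier G" "range u \<subseteq> M" "range v \<subseteq> M" "asymptotic M d u v"
  shows "asymptotic M d (\<phi> g \<circ> u) (\<phi> g \<circ> v)"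
  unfolding asymptotic_iff
proof (intro ballI allI)
  fix w C assume w: "w \<in> M"
  have uM: "u n \<in> M" "v n \<in> M" for n using assms by auto
  have "gp w ((\<phi> g \<circ> u) m) ((\<phi> g \<circ> v) n) = gp (\<phi> (inv g) w) (u m) (v n)" for m n
    using assms(1) uM w iso dist_inv by (simp add: gromov_product_def)
  moreover have "\<exists>N. \<forall>m\<ge>N. \<forall>n\<ge>N. C \<le> gp (\<phi> (inv g) w) (u m) (v n)"
    using assms(1,4) w unfolding asymptotic_iff by simp
  ultimately show "\<exists>N. \<forall>m\<ge>N. \<forall>n\<ge>N. C \<le> gp w ((\<phi> g \<circ> u) m) ((\<phi> g \<circ> v) n)" by simp
qed

lemma gromov_sequences_act:
  assumes "g \<in> carrier G" "u \<in> gromov_sequences M d" shows "\<phi> g \<circ> u \<in> gromov_sequences M d"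
  using assms asymptotic_act[OF assms(1), of u u] by (auto simp: gromov_sequences_def)

lemma end_class_act:
  assumes g: "g \<in> carrier G" and u: "u \<in> gromov_sequences M d"
  shows "(\<lambda>v. \<phi> g \<circ> v) ` end_class M d u = end_class M d (\<phi> g \<circ> u)"
proof (intro equalityI subsetI)
  fix w assume "w \<in> (\<lambda>v. \<phi> g \<circ> v) ` end_class M d u"
  then obtain v where v: "w = \<phi> g \<circ> v" "v \<in> gromov_sequences M d" "asymptotic M d u v"
    by (auto simp: end_class_def)
  then show "w \<in> end_class M d (\<phi> g \<circ> u)"
    using gromov_sequences_act[OF g v(2)] asymptotic_act[OF g, of u v] u
    by (simp add: end_class_def gromov_sequences_def)
next
  fix w assume w: "w \<in> end_class M d (\<phi> g \<circ> u)"
  then have wM: "range w \<subseteq> M" and uM: "range u \<subseteq> M" using u by (auto simp: end_class_def gromov_sequences_def)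
  have ig: "inv g \<in> carrier G" using g by simp
  have cancel: "\<phi> g \<circ> (\<phi> (inv g) \<circ> w) = w" using g wM act_mult[of g "inv g"] by (auto simp: fun_eq_iff image_subset_iff)
  have cancel': "\<phi> (inv g) \<circ> (\<phi> g \<circ> u) = u" using g uM act_mult[of "inv g" g] by (auto simp: fun_eq_iff image_subset_iff)
  have "range (\<phi> g \<circ> u) \<subseteq> M" using g uM by auto
  then have "asymptotic M d u (\<phi> (inv g) \<circ> w)"
    using asymptotic_act[OF ig, of "\<phi> g \<circ> u" w] cancel' wM w by (simp add: end_class_def)
  then have "\<phi> (inv g) \<circ> w \<in> end_class M d u"
    using gromov_sequences_act[OF ig, of w] w by (simp add: end_class_def)
  then show "w \<in> (\<lambda>v. \<phi> g \<circ> v) ` end_class M d u" using cancel by (metis image_eqI)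
qed

lemma quasi_axis_of:
  assumes f: "f \<in> carrier G" and p: "p \<in> M"
    and long: "2 * gp p (\<phi> (inv f) p) (\<phi> f p) + 4 * \<delta> + 1 \<le> d p (\<phi> f p)"
  shows "quasi_axis M d \<delta> (\<lambda>i. \<phi> (f [^] (i::int)) p) (gp p (\<phi> (inv f) p) (\<phi> f p))"
proof
  show "\<phi> (f [^] i) p \<in> M" for i :: int using f p by simp
  show "d (\<phi> (f [^] (i + k)) p) (\<phi> (f [^] (j + k)) p) = d (\<phi> (f [^] i) p) (\<phi> (f [^] j) p)" for i j k :: int
  proof -
    have "\<phi> (f [^] (i + k)) p = \<phi> (f [^] k) (\<phi> (f [^] i) p)" for i :: int
      using f p by (simp add: act_mult add.commute[of i k] flip: int_pow_mult)
    then show ?thesis using f p iso by simp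
  qed
  show "gp (\<phi> (f [^] (0::int)) p) (\<phi> (f [^] (- 1 :: int)) p) (\<phi> (f [^] (1::int)) p) \<le> gp p (\<phi> (inv f) p) (\<phi> f p)"
    using f p by (simp add: int_pow_neg)
  show "2 * gp p (\<phi> (inv f) p) (\<phi> f p) + 4 * \<delta> + 1 \<le> d (\<phi> (f [^] (0::int)) p) (\<phi> (f [^] (1::int)) p)"
    using f p long by simp
qed

text \<open>Otherwise every \<open>g\<close> that moves \<open>p\<close> far folds back:
  \<open>\<phi> g p\<close> and \<open>\<phi> (inv g) p\<close> lie in almost the same direction
  from \<open>p\<close>. Take such \<open>g\<close> and \<open>h\<close> along the different
  directions of \<open>u\<close> and \<open>v\<close>. Then \<open>g \<otimes> h\<close> moves
  \<open>p\<close> far out towards \<open>\<phi> g p\<close>, its inverse moves \<open>p\<close>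
  towards \<open>\<phi> (inv h) p\<close>, and as these directions differ, the product does not fold
  back.\<close>

lemma loxodromic_exists:
  assumes p: "p \<in> M" and u: "u \<in> gromov_sequences M d" "range u \<subseteq> orbit G \<phi> p"
    and v: "v \<in> gromov_sequences M d" "range v \<subseteq> orbit G \<phi> p"
    and uv: "\<not> asymptotic M d u v"
  obtains f where "f \<in> carrier G" "2 * gp p (\<phi> (inv f) p) (\<phi> f p) + 4 * \<delta> + 1 \<le> d p (\<phi> f p)"
proof (rule ccontr)
  note lox = that
  assume "\<not> thesis"
  then have no: "d p (\<phi> f p) < 2 * gp p (\<phi> (inv f) p) (\<phi> f p) + 4 * \<delta> + 1" if "f \<in> carrier G" for f
    using lox[of f] that \<open>\<not> thesis\<close> by force
  obtain C' N where C': "\<And>i j. i \<ge> N \<Longrightarrow> j \<ge> N \<Longrightarrow> gp p (u i) (v j) \<le> C'"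
    using not_asymptotic_bounded[OF p u(1) v(1) uv] by metis
  define C where "C = max C' 0"
  have C: "0 \<le> C" "\<And>i j. i \<ge> N \<Longrightarrow> j \<ge> N \<Longrightarrow> gp p (u i) (v j) \<le> C"
    using C' unfolding C_def by (auto simp: le_max_iff_disj)
  \<comment> \<open>Folding back gives products of at least (L - 4 * \<delta> - 1) / 2, which must
    beat C + 2 * \<delta>. At the end \<open>d p F\<close>, at least 2 * L - 2 * (C + \<delta>),
    must beat 2 * (C + 3 * \<delta>) + 4 * \<delta> + 1.\<close>
  define L where "L = 4 * C + 20 * \<delta> + 10"
  have far: "\<exists>i\<ge>N. \<exists>g\<in>carrier G. w i = \<phi> g p \<and> L \<le> d p (\<phi> g p)"
    if w: "w \<in> gromov_sequences M d" "range w \<subseteq> orbit G \<phi> p" for w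
  proof -
    have M: "range w \<subseteq> M" and ww: "asymptotic M d w w" using w by (auto simp: gromov_sequences_def)
    obtain i where i: "i \<ge> N" "L \<le> gp p (w i) (w i)"
      using ww asymptotic_base[OF p M M] by (meson linear order_trans)
    moreover have "w i \<in> M" using M by auto
    then have "gp p (w i) (w i) = d p (w i)" by (simp add: gromov_product_def commute)
    moreover obtain g where "g \<in> carrier G" "w i = \<phi> g p" using w(2) by (auto simp: orbit_def image_subset_iff)
    ultimately show ?thesis by auto
  qed
  obtain i g where g: "i \<ge> N" "g \<in> carrier G" "u i = \<phi> g p" "L \<le> d p (\<phi> g p)" using far[OF u] by blast
  obtain j h where h: "j \<ge> N" "h \<in> carrier G" "v j = \<phi> h p" "L \<le> d p (\<phi> h p)" using far[OF v] by blast
  define A where "A = \<phi> g p"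
  define A' where "A' = \<phi> (inv g) p"
  define B where "B = \<phi> h p"
  define B' where "B' = \<phi> (inv h) p"
  define f where "f = g \<otimes> h"
  define F where "F = \<phi> f p"
  define F' where "F' = \<phi> (inv f) p"
  have fG: "f \<in> carrier G" using g h by (simp add: f_def)
  have M: "A \<in> M" "A' \<in> M" "B \<in> M" "B' \<in> M" "F \<in> M" "F' \<in> M"
    using g h p fG by (auto simp: A_def A'_def B_def B'_def F_def F'_def)
  have dA: "d p A' = d p A" "L \<le> d p A" using dist_inv[of g p p] g p by (auto simp: A_def A'_def commute)
  have dB: "d p B' = d p B" "L \<le> d p B" using dist_inv[of h p p] h p by (auto simp: B_def B'_def commute)
  have dF: "d p F' = d p F" using dist_inv[of f p p] fG p by (auto simp: F_def F'_def commute)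
  have "A' \<in> M" using M by simp
  have FA: "d A F = d p B"
    using g h p by (simp add: A_def F_def B_def f_def iso flip: act_mult)
  have F'B': "d B' F' = d p A"
  proof -
    have "F' = \<phi> (inv h) A'" using g h p by (simp add: F'_def A'_def f_def inv_mult_group act_mult)
    then have "d B' F' = d p A'" using h p M by (simp add: B'_def iso)
    then show ?thesis using dA by simp
  qed
  have dF_AB: "d p F = d A' B"
    using dist_inv[of g B p] g h p M by (simp add: A'_def B_def F_def f_def act_mult commute)
  have AB: "gp p A B \<le> C" using C(2)[of i j] g h by (simp add: A_def B_def)
  have AA': "L - 4 * \<delta> - 1 \<le> 2 * gp p A A'" using no[OF g(2)] dA gp_commute[of p A A'] by (simp add: A_def A'_def)
  have BB': "L - 4 * \<delta> - 1 \<le> 2 * gp p B B'" using no[OF h(2)] dB gp_commute[of p B B'] by (simp add: B_def B'_def)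
  have A'B: "gp p A' B \<le> C + \<delta>"
    using hyperbolic[of p A A' B] p M AB AA' C(1) delta_nonneg by (simp add: L_def min_def split: if_splits)
  have AB': "gp p A B' \<le> C + \<delta>"
    using hyperbolic[of p A B' B] p M AB BB' C(1) delta_nonneg gp_commute[of p B' B]
    by (simp add: L_def min_def split: if_splits)
  have dF_ge: "d p A + d p B - 2 * (C + \<delta>) \<le> d p F"
    using A'B dA unfolding dF_AB gromov_product_def by (simp add: commute[of _ p] field_simps)
  have "L - C - \<delta> \<le> gp p A F"
    using dF_ge FA dA unfolding gromov_product_def by (simp add: commute[of _ p] field_simps)
  moreover have "L - C - \<delta> \<le> gp p F' B'"
    using dF_ge F'B' dB dF unfolding gromov_product_def by (simp add: commute[of _ p] commute[of F' B'] field_simps)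
  moreover have "min (gp p A F) (min (gp p F F') (gp p F' B')) - 2 * \<delta> \<le> gp p A B'"
    using hyperbolic3 p M by blast
  ultimately have "gp p F F' \<le> C + 3 * \<delta>"
    using AB' C(1) delta_nonneg by (simp add: L_def min_def split: if_splits)
  then show False
    using no[OF fG] dF_ge dA dB C(1) delta_nonneg gp_commute[of p F F'] by (simp add: L_def F_def F'_def)
qed

end

section \<open>Axes in the coned-off space\<close>

text \<open>\<open>k\<close> exceeds by 1 the defect 2 * b + 8 * \<delta> + 18 of
  \<open>cone_dist_straight\<close>. \<open>R\<close> adds the loss k * K of
  \<open>dist_bound_near_Orb\<close> to the distance from intervals to the axis in
  \<open>interval_near_axis\<close>.\<close>

locale coned_axis = coned_off M d \<delta> Orb K R + quasi_axis M d \<delta> x b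
  for M :: "'a set" and d \<delta> Orb K R x b +
  fixes k :: nat
  assumes axis_in_Orb: "x i \<in> Orb"
    and cone_dist_homogeneous: "cone_dist (x (i + l)) (x (j + l)) = cone_dist (x i) (x j)"
    and k_large: "2 * b + 8 * \<delta> + 19 \<le> real k"
    and R_large: "d (x 0) (x 1) + 2 * b + 6 * \<delta> + real k * K \<le> R"
begin

text \<open>By \<open>straight\<close>, \<open>x j\<close> is within b + 4 * \<delta> of an interval
  point in \<open>d\<close>. Going there and back costs twice b + 4 * \<delta> + 1, on top of the 16
  of \<open>cone_dist_interval\<close>.\<close>

lemma cone_dist_straight:
  assumes "i \<le> j" "j \<le> l"
  shows "cone_dist (x i) (x j) + cone_dist (x j) (x l) \<le> cone_dist (x i) (x l) + (2 * b + 8 * \<delta> + 18)"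
proof -
  obtain z where z: "z \<in> I (x i) (x l)" "d (x j) z \<le> gp (x j) (x i) (x l) + 2 * \<delta>"
    using near_interval[OF x_in x_in x_in] by blast
  have zM: "z \<in> M" using z(1) by (simp add: interval_def)
  have "cone_dist (x j) z \<le> b + 4 * \<delta> + 1"
    using cone_dist_le_dist[OF x_in[of j] zM] z(2) straight[OF assms] by linarith
  then show ?thesis
    using cone_dist_interval[OF z(1) x_in x_in] cone_dist.triangle[OF x_in[of i] zM x_in[of j]]
      cone_dist.triangle[OF x_in[of j] zM x_in[of l]] cone_dist.commute[of "x j" z] by linarith
qed

text \<open>For large \<open>m0\<close> the point \<open>x m0\<close> is too far from
  \<open>x 0\<close> in \<open>d\<close> to be reached in 2 ^ k steps. A block of \<open>m0\<close>
  axis points thus outweighs the defect of gluing two blocks by at least 1.\<close>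

lemma cone_dist_escape: "\<exists>m0>0. \<forall>m. real (m div m0) \<le> cone_dist (x 0) (x (int m))"
proof -
  define D where "D = 2 * b + 8 * \<delta> + 18"
  define m0 where "m0 = nat \<lceil>2 ^ k * (2 * (K * (k + 1)) + 1)\<rceil>"
  have m0: "2 ^ k * (2 * (K * (k + 1)) + 1) \<le> real m0" unfolding m0_def by (rule real_nat_ceiling_ge)
  have "0 < 2 ^ k * (2 * (K * (k + 1)) + 1)" using K(1) by (intro mult_pos_pos add_nonneg_pos) auto
  then have "0 < m0" using m0 by (metis not_le of_nat_0_le_iff of_nat_0_less_iff order_less_le_trans)
  have "\<not> steps (x 0) (x (int m0)) \<le> 2 ^ k"
  proof
    assume "steps (x 0) (x (int m0)) \<le> 2 ^ k"
    moreover have "\<exists>q\<in>Orb. d z q \<le> d (x 0) (x 1) + 2 * b + 6 * \<delta>" if "z \<in> I (x 0) (x (int m0))" for z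
      using interval_near_axis[OF that] axis_in_Orb by auto
    ultimately have "d (x 0) (x (int m0)) < 2 ^ k * (2 * (K * (k + 1)) + 1)"
      using dist_bound_near_Orb[OF x_in x_in _ R_large, of 0 "int m0"] by blast
    then show False using escape[of m0] m0 by linarith
  qed
  then have "k \<le> steps (x 0) (x (int m0))" using less_exp[of k] by linarith
  then have big: "D + 1 \<le> cone_dist (x 0) (x (int m0))" using k_large by (simp add: D_def cone_dist_def)
  \<comment> \<open>For l > 0 a reserve of \<open>D\<close> is carried along: the next gluing costs
    \<open>D\<close> and the next block adds at least \<open>D + 1\<close>. At l = 0 nothing is
    glued.\<close>
  have mult: "real l \<le> cone_dist (x 0) (x (int (l * m0))) - (if l = 0 then 0 else D)" for l
  proof (induction l)
    case (Suc l)
    have sh: "cone_dist (x (int (l * m0))) (x (int (Suc l * m0))) = cone_dist (x 0) (x (int m0))"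
      using cone_dist_homogeneous[of 0 "int (l * m0)" "int m0"] by (simp add: add.commute)
    show ?case
    proof (cases "l = 0")
      case True then show ?thesis using big by simp
    next
      case False
      have "cone_dist (x 0) (x (int (l * m0))) + cone_dist (x (int (l * m0))) (x (int (Suc l * m0)))
          \<le> cone_dist (x 0) (x (int (Suc l * m0))) + D"
        unfolding D_def by (rule cone_dist_straight) auto
      then show ?thesis using Suc False big unfolding sh by simp
    qed
  qed simp
  have "real (m div m0) \<le> cone_dist (x 0) (x (int m))" for m
  proof (cases "m div m0 = 0")
    case False
    have "m div m0 * m0 \<le> m" by (simp add: div_times_less_eq_dividend)
    then have "cone_dist (x 0) (x (int (m div m0 * m0))) + cone_dist (x (int (m div m0 * m0))) (x (int m))
          \<le> cone_dist (x 0) (x (int m)) + D"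
      unfolding D_def by (intro cone_dist_straight) (auto simp del: of_nat_mult)
    then show ?thesis
      using mult[of "m div m0"] False cone_dist.nonneg[of "x (int (m div m0 * m0))" "x (int m)"] by (simp only: if_False)
  qed simp
  with \<open>0 < m0\<close> show ?thesis by blast
qed

lemma pos_asymptotic_cone_dist: "asymptotic M cone_dist pos pos"
proof -
  obtain m0 where m0: "m0 > 0" "\<And>m. real (m div m0) \<le> cone_dist (x 0) (x (int m))" using cone_dist_escape by blast
  have gp: "real (min m n div m0) - (b + 4 * \<delta> + 9) \<le> cone_gp (x 0) (pos m) (pos n)" if "m \<le> n" for m n
    using cone_dist_straight[of 0 "int m" "int n"] m0(2)[of m] that
    unfolding gromov_product_def pos_def by (simp add: cone_dist.commute[of _ "x 0"] field_simps min_absorb1)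
  have "\<exists>N. \<forall>m\<ge>N. \<forall>n\<ge>N. C \<le> cone_gp (x 0) (pos m) (pos n)" for C
  proof (intro exI[of _ "nat \<lceil>C + (b + 4 * \<delta> + 9)\<rceil> * m0"] allI impI)
    fix m n assume mn: "nat \<lceil>C + (b + 4 * \<delta> + 9)\<rceil> * m0 \<le> m" "nat \<lceil>C + (b + 4 * \<delta> + 9)\<rceil> * m0 \<le> n"
    have "nat \<lceil>C + (b + 4 * \<delta> + 9)\<rceil> * m0 div m0 \<le> min m n div m0" using mn by (intro div_le_mono) simp
    then have "C + (b + 4 * \<delta> + 9) \<le> real (min m n div m0)" using m0(1) by simp
    moreover have "real (min m n div m0) - (b + 4 * \<delta> + 9) \<le> cone_gp (x 0) (pos m) (pos n)"
      using gp[of m n] gp[of n m] cone_dist.gp_commute[of "x 0" "pos m" "pos n"]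
      by (cases "m \<le> n") (auto simp: min.commute)
    ultimately show "C \<le> cone_gp (x 0) (pos m) (pos n)" by linarith
  qed
  then show ?thesis using cone_dist.asymptotic_base[OF x_in[of 0] range_pos range_pos] by simp
qed

lemma reverse_coned: "coned_axis M d \<delta> Orb K R (\<lambda>i. x (- i)) b k"
proof -
  interpret r: quasi_axis M d \<delta> "\<lambda>i. x (- i)" b by (rule reverse)
  show ?thesis
  proof
    show "cone_dist (x (- (i + l))) (x (- (j + l))) = cone_dist (x (- i)) (x (- j))" for i j l
      using cone_dist_homogeneous[of "- i" "- l" "- j"] by simp
    have "d (x (- 0)) (x (- 1)) = d (x 0) (x 1)" using dist_diff[of "- 1" 0] commute by simp
    then show "d (x (- 0)) (x (- 1)) + 2 * b + 6 * \<delta> + real k * K \<le> R" using R_large by simp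
  qed (use axis_in_Orb k_large in auto)
qed

lemma neg_asymptotic_cone_dist: "asymptotic M cone_dist neg neg"
proof -
  interpret r: coned_axis M d \<delta> Orb K R "\<lambda>i. x (- i)" b k by (rule reverse_coned)
  have "r.pos = neg" by (auto simp: r.pos_def neg_def)
  then show ?thesis using r.pos_asymptotic_cone_dist by simp
qed

end

section \<open>The dynamics of a loxodromic element on the boundary\<close>

locale loxodromic_action = hyperbolic_action M d \<delta> G \<phi>
  for M :: "'a set" and d \<delta> and G :: "('g, 'm) monoid_scheme" (structure) and \<phi> +
  fixes f p b
  assumes f: "f \<in> carrier G" and p: "p \<in> M"
    and axis: "quasi_axis M d \<delta> (\<lambda>i. \<phi> (f [^] (i::int)) p) b"
    and hs: "hyperbolic_space M d"
begin

sublocale quasi_axis M d \<delta> "\<lambda>i. \<phi> (f [^] (i::int)) p" b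
  by (rule axis)

abbreviation cls :: "(nat \<Rightarrow> 'a) \<Rightarrow> (nat \<Rightarrow> 'a) set" where "cls \<equiv> end_class M d"
abbreviation GS where "GS \<equiv> gromov_sequences M d"

lemma comp_act: "g \<in> carrier G \<Longrightarrow> h \<in> carrier G \<Longrightarrow> range u \<subseteq> M \<Longrightarrow> \<phi> g \<circ> (\<phi> h \<circ> u) = \<phi> (g \<otimes> h) \<circ> u"
  using act_mult by (auto simp: fun_eq_iff image_subset_iff)

lemma comp_one: "range u \<subseteq> M \<Longrightarrow> \<phi> \<one> \<circ> u = u"
  by (auto simp: fun_eq_iff image_subset_iff)

lemma GS_range: "u \<in> GS \<Longrightarrow> range u \<subseteq> M"
  by (simp add: gromov_sequences_def)

lemma cls_act_cong:
  "cls u = cls v \<Longrightarrow> u \<in> GS \<Longrightarrow> v \<in> GS \<Longrightarrow> g \<in> carrier G \<Longrightarrow> cls (\<phi> g \<circ> u) = cls (\<phi> g \<circ> v)"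
  using end_class_act by metis

lemma cls_act_cancel:
  assumes "cls (\<phi> g \<circ> u) = cls (\<phi> g \<circ> v)" "u \<in> GS" "v \<in> GS" "g \<in> carrier G"
  shows "cls u = cls v"
proof -
  have "\<phi> (inv g) \<circ> (\<phi> g \<circ> w) = w" if "w \<in> GS" for w
    using comp_act[of "inv g" g w] comp_one[of w] GS_range[OF that] assms(4) by simp
  then show ?thesis
    using cls_act_cong[OF assms(1) gromov_sequences_act gromov_sequences_act, of "inv g"] assms by simp
qed

lemma fixed_by_power:
  assumes u: "u \<in> GS" and l: "l > 0" and fixed: "cls (\<phi> (f [^] (l::int)) \<circ> u) = cls u"
  shows "cls u \<in> {cls pos, cls neg}"
proof -
  let ?T = "\<lambda>k::int. \<phi> (f [^] k)"
  have fk: "f [^] k \<in> carrier G" for k :: int using f by simp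
  have "cls (?T (int n * l) \<circ> u) = cls u" for n
  proof (induction n)
    case 0
    then show ?case by (simp only: of_nat_0 mult_zero_left int_pow_0 comp_one[OF GS_range[OF u]])
  next
    case (Suc n)
    have "?T (int (Suc n) * l) \<circ> u = ?T l \<circ> (?T (int n * l) \<circ> u)"
      using comp_act[OF fk fk GS_range[OF u]] f by (simp add: algebra_simps int_pow_mult)
    moreover have "cls (?T l \<circ> (?T (int n * l) \<circ> u)) = cls (?T l \<circ> u)"
      by (rule cls_act_cong[OF Suc gromov_sequences_act[OF fk u] u fk])
    ultimately show ?case using fixed by metis
  qed
  then have inv: "asymptotic M d (?T (int n * l) \<circ> u) u" for n
    using end_class_eq_iff[OF hs gromov_sequences_act[OF fk u] u] by blast
  have "asymptotic M d u pos \<or> asymptotic M d u neg"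
  proof (rule asymptotic_if_translation_invariant[where T = ?T, OF u _ _ _ l inv])
    show "?T k (\<phi> (f [^] i) p) = \<phi> (f [^] (i + k)) p" for k i :: int
      using f p by (simp add: act_mult add.commute[of i k] flip: int_pow_mult)
  qed (use fk iso in auto)
  then show ?thesis using end_class_eq_iff[OF hs u] pos_gromov neg_gromov by blast
qed

text \<open>If two translates under powers of \<open>f\<close> coincide, a positive power fixes the
  class of \<open>u\<close>, which \<open>fixed_by_power\<close> rules out.\<close>

lemma infinite_if_third_end:
  assumes Z: "\<And>u g. u \<in> GS \<Longrightarrow> cls u \<in> Z \<Longrightarrow> g \<in> carrier G \<Longrightarrow> cls (\<phi> g \<circ> u) \<in> Z"
    and u: "u \<in> GS" "cls u \<in> Z" "cls u \<notin> {cls pos, cls neg}"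
  shows "infinite Z"
proof
  assume "finite Z"
  let ?A = "\<lambda>n::nat. cls (\<phi> (f [^] int n) \<circ> u)"
  have fk: "f [^] k \<in> carrier G" for k :: int using f by simp
  have "range ?A \<subseteq> Z" using Z u fk by auto
  then have "\<not> inj ?A" using \<open>finite Z\<close> finite_subset range_inj_infinite by blast
  then obtain m n where mn: "m < n" "?A m = ?A n" unfolding inj_on_def by (metis nat_neq_iff)
  have "\<phi> (f [^] int n) \<circ> u = \<phi> (f [^] int m) \<circ> (\<phi> (f [^] (int n - int m)) \<circ> u)"
    using comp_act[OF fk fk GS_range[OF u(1)], of "int m" "int n - int m"] f by (simp flip: int_pow_mult)
  then have "cls u = cls (\<phi> (f [^] (int n - int m)) \<circ> u)"
    using cls_act_cancel[of "f [^] int m" u] mn(2) u(1) fk gromov_sequences_act[OF fk u(1)] by simp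
  then show False using fixed_by_power[OF u(1), of "int n - int m"] mn(1) u(3) by simp
qed

lemma limit_set_alt: "limit_set G M d \<phi> = cls ` {u \<in> GS. range u \<subseteq> orbit G \<phi> p}"
  unfolding limit_set_eq_orbit[OF hs action p]
proof (intro equalityI subsetI)
  fix \<xi> assume "\<xi> \<in> {\<xi> \<in> gromov_boundary M d. \<exists>u\<in>\<xi>. range u \<subseteq> orbit G \<phi> p}"
  then obtain u where "\<xi> \<in> gromov_boundary M d" "u \<in> \<xi>" "range u \<subseteq> orbit G \<phi> p" by blast
  then show "\<xi> \<in> cls ` {u \<in> GS. range u \<subseteq> orbit G \<phi> p}"
    using boundary_class_eq[OF hs, of \<xi> u] by blast
next
  fix \<xi> assume "\<xi> \<in> cls ` {u \<in> GS. range u \<subseteq> orbit G \<phi> p}"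
  then obtain u where "\<xi> = cls u" "u \<in> GS" "range u \<subseteq> orbit G \<phi> p" by blast
  then show "\<xi> \<in> {\<xi> \<in> gromov_boundary M d. \<exists>u\<in>\<xi>. range u \<subseteq> orbit G \<phi> p}"
    using end_class_in_boundary[of u M d] in_end_class_self[of u M d] by blast
qed

lemma axis_in_orbit: "range pos \<subseteq> orbit G \<phi> p" "range neg \<subseteq> orbit G \<phi> p"
  using f by (auto simp: pos_def neg_def orbit_def)

lemma cls_pos_neg: "cls pos \<noteq> cls neg"
  using end_class_eq_iff[OF hs pos_gromov neg_gromov] pos_neg_not_asymptotic by simp

text \<open>\<open>\<phi> g p\<close> lies on a translated axis with the same pair of ends, hence
  uniformly near the original axis. So the whole orbit is near the axis and accumulates only at the
  ends. If \<open>g\<close> exchanges the ends, the two sequences swap roles.\<close>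

lemma limit_set_if_axis_preserved:
  assumes inv: "\<And>g. g \<in> carrier G \<Longrightarrow> {cls (\<phi> g \<circ> pos), cls (\<phi> g \<circ> neg)} \<subseteq> {cls pos, cls neg}"
  shows "limit_set G M d \<phi> = {cls pos, cls neg}"
proof
  have near: "\<exists>j. d (\<phi> g p) (\<phi> (f [^] (j::int)) p) \<le> d (\<phi> (f [^] (0::int)) p) (\<phi> (f [^] (1::int)) p) + 3 * b + 12 * \<delta>"
    if g: "g \<in> carrier G" for g
  proof -
    note gs = gromov_sequences_act[OF g pos_gromov] gromov_sequences_act[OF g neg_gromov]
    have ne: "cls (\<phi> g \<circ> pos) \<noteq> cls (\<phi> g \<circ> neg)"
      using cls_act_cancel[OF _ pos_gromov neg_gromov g] cls_pos_neg by blast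
    have "gp (\<phi> g p) ((\<phi> g \<circ> pos) n) ((\<phi> g \<circ> neg) n) = gp p (pos n) (neg n)" for n
      using g p f by (simp add: gromov_product_def iso pos_def neg_def)
    then have gp: "gp (\<phi> g p) ((\<phi> g \<circ> pos) n) ((\<phi> g \<circ> neg) n) \<le> b + 2 * \<delta>" for n
      using straight[of "- int n" 0 "int n"] p gp_commute[of p] by (simp add: pos_def neg_def)
    show ?thesis
    proof (cases "cls (\<phi> g \<circ> pos) = cls pos")
      case True
      then have "cls (\<phi> g \<circ> neg) = cls neg" using inv[OF g] ne by auto
      then show ?thesis
        using near_axis_if_ends_match[OF act_in[OF g p] GS_range[OF gs(1)] GS_range[OF gs(2)] gp] True
          end_class_eq_iff[OF hs] gs pos_gromov neg_gromov by blast
    next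
      case False
      then have "cls (\<phi> g \<circ> pos) = cls neg" "cls (\<phi> g \<circ> neg) = cls pos" using inv[OF g] ne by auto
      then show ?thesis
        using near_axis_if_ends_match[OF act_in[OF g p] GS_range[OF gs(2)] GS_range[OF gs(1)]] gp
          gp_commute end_class_eq_iff[OF hs] gs pos_gromov neg_gromov by metis
    qed
  qed
  show "limit_set G M d \<phi> \<subseteq> {cls pos, cls neg}"
  proof
    fix \<xi> assume "\<xi> \<in> limit_set G M d \<phi>"
    then obtain u where u: "\<xi> = cls u" "u \<in> GS" "range u \<subseteq> orbit G \<phi> p" by (auto simp: limit_set_alt)
    have "asymptotic M d u pos \<or> asymptotic M d u neg"
    proof (rule asymptotic_if_near_axis[OF u(2)])
      fix n
      obtain g where "g \<in> carrier G" "u n = \<phi> g p" using u(3) by (auto simp: orbit_def image_subset_iff)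
      then show "\<exists>j. d (u n) (\<phi> (f [^] (j::int)) p) \<le> d (\<phi> (f [^] (0::int)) p) (\<phi> (f [^] (1::int)) p) + 3 * b + 12 * \<delta>"
        using near by simp
    qed
    then show "\<xi> \<in> {cls pos, cls neg}"
      using end_class_eq_iff[OF hs u(2)] pos_gromov neg_gromov u(1) by blast
  qed
  show "{cls pos, cls neg} \<subseteq> limit_set G M d \<phi>"
    unfolding limit_set_alt using axis_in_orbit pos_gromov neg_gromov by auto
qed

lemma orbit_act: "g \<in> carrier G \<Longrightarrow> q \<in> orbit G \<phi> p \<Longrightarrow> \<phi> g q \<in> orbit G \<phi> p"
  using p act_mult by (auto simp: orbit_def)

lemma orbit_subset: "orbit G \<phi> p \<subseteq> M"
  using p by (auto simp: orbit_def)

end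

text \<open>Classes in the two spaces are images of one set of sequences under maps with the same
  kernel; this transfers finiteness and cardinality.\<close>

lemma kernel_bij:
  assumes "\<And>v w. v \<in> S \<Longrightarrow> w \<in> S \<Longrightarrow> \<kappa> v = \<kappa> w \<longleftrightarrow> \<mu> v = \<mu> w"
  shows "\<exists>J. bij_betw J (\<kappa> ` S) (\<mu> ` S)"
proof -
  have "inj_on (\<lambda>y. \<mu> (inv_into S \<kappa> y)) (\<kappa> ` S)"
    by (rule inj_onI) (metis assms f_inv_into_f inv_into_into)
  moreover have "(\<lambda>y. \<mu> (inv_into S \<kappa> y)) ` \<kappa> ` S = \<mu> ` S"
  proof -
    have "\<mu> (inv_into S \<kappa> (\<kappa> v)) = \<mu> v" if "v \<in> S" for v
      using assms[of "inv_into S \<kappa> (\<kappa> v)" v] that by (simp add: f_inv_into_f inv_into_into)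
    then show ?thesis by (auto simp: image_image)
  qed
  ultimately show ?thesis unfolding bij_betw_def by blast
qed


lemma (in loxodromic_action) fixes_boundary_point_iff:
  "fixes_boundary_point G M d \<phi> \<longleftrightarrow> (\<exists>u\<in>GS. \<forall>g\<in>carrier G. cls (\<phi> g \<circ> u) = cls u)"
proof
  assume "fixes_boundary_point G M d \<phi>"
  then obtain \<xi> where \<xi>: "\<xi> \<in> gromov_boundary M d" "\<And>g. g \<in> carrier G \<Longrightarrow> (\<lambda>u. \<phi> g \<circ> u) ` \<xi> = \<xi>"
    unfolding fixes_boundary_point_def by blast
  obtain u where "u \<in> \<xi>" using boundary_class_nonempty[OF hs \<xi>(1)] .
  then have "u \<in> GS" "\<xi> = cls u" using boundary_class_eq[OF hs \<xi>(1)] by auto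
  then show "\<exists>u\<in>GS. \<forall>g\<in>carrier G. cls (\<phi> g \<circ> u) = cls u"
    using \<xi>(2) end_class_act by (intro bexI[of _ u]) auto
next
  assume "\<exists>u\<in>GS. \<forall>g\<in>carrier G. cls (\<phi> g \<circ> u) = cls u"
  then show "fixes_boundary_point G M d \<phi>"
    unfolding fixes_boundary_point_def using end_class_in_boundary end_class_act by metis
qed

theorem (in loxodromic_action) cobounded_model:
  "\<exists>(Y :: ('g \<times> 'a \<times> real) set set) dY \<psi>.
     hyperbolic_space Y dY \<and> isometric_action G Y dY \<psi> \<and> cobounded_action G Y dY \<psi> \<and>
     (\<exists>\<tau>. has_action_type G M d \<phi> \<tau> \<and> has_action_type G Y dY \<psi> \<tau>)"
proof -
  let ?x = "\<lambda>i::int. \<phi> (f [^] i) p"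
  let ?O = "orbit G \<phi> p"
  define K where "K = max 1 (4 * \<delta>)"
  define k where "k = nat \<lceil>2 * b + 8 * \<delta> + 19\<rceil>"
  define R where "R = d (?x 0) (?x 1) + 2 * b + 6 * \<delta> + real k * K"
  have "0 \<le> R" using b_nonneg delta_nonneg by (simp add: R_def K_def)
  then interpret CO: coned_off M d \<delta> ?O K R
    using orbit_subset orbit_refl[OF p] by unfold_locales (auto simp: K_def)
  have steps_le: "CO.steps (\<phi> g u) (\<phi> g v) \<le> CO.steps u v" if g: "g \<in> carrier G" and uv: "u \<in> M" "v \<in> M" for g u v
  proof (rule CO.steps_isometry_le[OF _ surj_prop[OF g] _ uv])
    show "?O \<subseteq> \<phi> g ` ?O"
    proof
      fix q assume q: "q \<in> ?O"
      then have "q = \<phi> g (\<phi> (inv g) q)" using g orbit_subset by (simp add: act_mult subset_eq)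
      then show "q \<in> \<phi> g ` ?O" using orbit_act[of "inv g" q] g q by blast
    qed
  qed (use iso g in auto)
  have cone_dist_iso: "CO.cone_dist (\<phi> g u) (\<phi> g v) = CO.cone_dist u v" if g: "g \<in> carrier G" and uv: "u \<in> M" "v \<in> M" for g u v
    using steps_le[OF g uv] steps_le[of "inv g" "\<phi> g u" "\<phi> g v"] g uv by (simp add: act_mult CO.cone_dist_def)
  interpret CA: coned_axis M d \<delta> ?O K R ?x b k
  proof
    show "?x i \<in> ?O" for i using f by (auto simp: orbit_def)
    show "CO.cone_dist (?x (i + l)) (?x (j + l)) = CO.cone_dist (?x i) (?x j)" for i j l
    proof -
      have "?x (i + l) = \<phi> (f [^] l) (?x i)" for i
        using f p by (simp add: act_mult add.commute[of i l] flip: int_pow_mult)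
      then show ?thesis using cone_dist_iso f p by simp
    qed
    show "2 * b + 8 * \<delta> + 19 \<le> real k" unfolding k_def by (rule real_nat_ceiling_ge)
  qed (simp add: R_def)
  have actR: "isometric_action G M CO.cone_dist \<phi>"
    using cone_dist_iso group_action_axioms by (simp add: isometric_action_def)
  obtain Y :: "('g \<times> 'a \<times> real) set set" and dY \<psi> \<iota> C where
    hsY: "hyperbolic_space Y dY" and actY: "isometric_action G Y dY \<psi>" and
    \<iota>Y: "\<And>u. u \<in> M \<Longrightarrow> \<iota> u \<in> Y" and d\<iota>: "\<And>u v. u \<in> M \<Longrightarrow> v \<in> M \<Longrightarrow> dY (\<iota> u) (\<iota> v) = CO.cone_dist u v" and
    equi: "\<And>g u. g \<in> carrier G \<Longrightarrow> u \<in> M \<Longrightarrow> \<psi> g (\<iota> u) = \<iota> (\<phi> g u)" and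
    dense: "\<And>y. y \<in> Y \<Longrightarrow> \<exists>u\<in>M. dY y (\<iota> u) \<le> C"
  proof -
    have "M \<noteq> {}" using p by blast
    then show thesis
      by (rule geodesic_extension[OF CO.cone_dist_hyperbolic _ CO.cone_dist_coarsely_geodesic actR]) (assumption+, fact that)
  qed
  obtain \<delta>Y where "geodesic_hyperbolic_metric Y dY \<delta>Y"
    using hyperbolic_space_imp_geodesic_hyperbolic_metric[OF hsY] .
  then interpret Y: hyperbolic_action Y dY \<delta>Y G \<psi>
    using actY by (simp add: hyperbolic_action_def hyperbolic_action_axioms_def)
  have MSY: "Metric_space Y dY" by (rule Y.Metric_space_axioms)
  have OM: "q \<in> M" if "q \<in> ?O" for q using orbit_subset that by blast
  have dense_orbit: "\<exists>q\<in>?O. dY y (\<iota> q) \<le> C + R + 3" if y: "y \<in> Y" for y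
  proof -
    obtain u where u: "u \<in> M" "dY y (\<iota> u) \<le> C" using dense[OF y] by blast
    obtain q where q: "q \<in> ?O" "CO.cone_dist u q \<le> R + 3" using CO.Orb_coarsely_dense[OF u(1)] by blast
    have "dY y (\<iota> q) \<le> dY y (\<iota> u) + dY (\<iota> u) (\<iota> q)"
      using Y.triangle y \<iota>Y u(1) OM[OF q(1)] by blast
    then show ?thesis using u q d\<iota>[OF u(1) OM[OF q(1)]] by (intro bexI[of _ q]) auto
  qed
  have orbit\<iota>: "\<iota> q \<in> orbit G \<psi> (\<iota> p)" if "q \<in> ?O" for q
    using that equi p by (auto simp: orbit_def)
  have cob: "cobounded_action G Y dY \<psi>"
    unfolding cobounded_action_def finite_hausdorff_distance_def
  proof (rule bexI[of _ "\<iota> p"], rule exI[of _ "max 0 (C + R + 3)"], intro conjI ballI)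
    fix a assume "a \<in> orbit G \<psi> (\<iota> p)"
    then have "a \<in> Y" using \<iota>Y[OF p] by (auto simp: orbit_def)
    then show "\<exists>y\<in>Y. dY a y \<le> max 0 (C + R + 3)" by (intro bexI[of _ a]) auto
  next
    fix y assume "y \<in> Y"
    then obtain q where "q \<in> ?O" "dY y (\<iota> q) \<le> C + R + 3" using dense_orbit by blast
    then show "\<exists>a\<in>orbit G \<psi> (\<iota> p). dY a y \<le> max 0 (C + R + 3)"
      using orbit\<iota> Y.commute[of y] by (intro bexI[of _ "\<iota> q"]) auto
  qed (rule \<iota>Y[OF p])
  \<comment> \<open>\<open>S\<close> parametrises both sides: \<open>\<kappa>\<close> maps it onto
    the boundary of \<open>Y\<close>, since the orbit is coarsely dense there, and
    \<open>cls\<close> maps it into the limit set in the given space.\<close>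
  define S where "S = {v. range v \<subseteq> ?O \<and> asymptotic M CO.cone_dist v v}"
  define \<kappa> where "\<kappa> = (\<lambda>v. end_class Y dY (\<iota> \<circ> v))"
  have SM: "range v \<subseteq> M" if "v \<in> S" for v using that OM by (auto simp: S_def)
  have SGS: "v \<in> GS" if "v \<in> S" for v
    using CO.asymptotic_cone_dist_imp[OF SM[OF that] SM[OF that]] SM[OF that] that
    by (simp add: S_def gromov_sequences_def)
  have asY: "asymptotic Y dY (\<iota> \<circ> u) (\<iota> \<circ> v) \<longleftrightarrow> asymptotic M CO.cone_dist u v"
    if M: "range u \<subseteq> M" "range v \<subseteq> M" for u v
  proof -
    have "range (\<iota> \<circ> u) \<subseteq> Y" "range (\<iota> \<circ> v) \<subseteq> Y" using M \<iota>Y by auto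
    moreover have "Y.gp (\<iota> p) ((\<iota> \<circ> u) m) ((\<iota> \<circ> v) n) = CO.cone_gp p (u m) (v n)" for m n
      using M p d\<iota> by (simp add: gromov_product_def image_subset_iff)
    ultimately show ?thesis
      using Y.asymptotic_base[OF \<iota>Y[OF p]] CO.cone_dist.asymptotic_base[OF p M] by simp
  qed
  have gsY: "\<iota> \<circ> v \<in> gromov_sequences Y dY" if "v \<in> S" for v
    using asY[OF SM[OF that] SM[OF that]] SM[OF that] that \<iota>Y by (auto simp: S_def gromov_sequences_def)
  have kernel: "\<kappa> v = \<kappa> w \<longleftrightarrow> cls v = cls w" if "v \<in> S" "w \<in> S" for v w
  proof -
    note M = SM[OF that(1)] SM[OF that(2)]
    have "\<kappa> v = \<kappa> w \<longleftrightarrow> asymptotic M CO.cone_dist v w"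
      unfolding \<kappa>_def end_class_eq_iff[OF hsY gsY[OF that(1)] gsY[OF that(2)]] by (rule asY[OF M])
    also have "\<dots> \<longleftrightarrow> asymptotic M d v w"
      using CO.asymptotic_cone_dist_imp[OF M] CO.asymptotic_imp_cone_dist[OF M] that(1) by (auto simp: S_def)
    also have "\<dots> \<longleftrightarrow> cls v = cls w"
      using end_class_eq_iff[OF hs SGS[OF that(1)] SGS[OF that(2)]] by simp
    finally show ?thesis .
  qed
  have \<iota>_act: "\<iota> \<circ> (\<phi> g \<circ> v) = \<psi> g \<circ> (\<iota> \<circ> v)" if "g \<in> carrier G" "v \<in> S" for g v
    using equi[OF that(1)] SM[OF that(2)] by (auto simp: fun_eq_iff image_subset_iff)
  have S_act: "\<phi> g \<circ> v \<in> S" if g: "g \<in> carrier G" and v: "v \<in> S" for g v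
  proof -
    have O: "range (\<phi> g \<circ> v) \<subseteq> ?O" using v orbit_act[OF g] by (auto simp: S_def)
    then have M: "range (\<phi> g \<circ> v) \<subseteq> M" using OM by blast
    have "asymptotic Y dY (\<iota> \<circ> (\<phi> g \<circ> v)) (\<iota> \<circ> (\<phi> g \<circ> v))"
      using Y.gromov_sequences_act[OF g gsY[OF v]] \<iota>_act[OF g v] by (simp add: gromov_sequences_def)
    then show ?thesis using asY[OF M M] O by (simp add: S_def)
  qed
  have \<kappa>_act: "(\<lambda>u. \<psi> g \<circ> u) ` \<kappa> v = \<kappa> (\<phi> g \<circ> v)" if "g \<in> carrier G" "v \<in> S" for g v
    unfolding \<kappa>_def \<iota>_act[OF that] by (rule Y.end_class_act[OF that(1) gsY[OF that(2)]])
  have bdY: "gromov_boundary Y dY \<subseteq> \<kappa> ` S"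
  proof
    fix \<eta> assume \<eta>: "\<eta> \<in> gromov_boundary Y dY"
    then obtain u where "u \<in> \<eta>" using boundary_class_nonempty[OF hsY] by blast
    then have u: "u \<in> gromov_sequences Y dY" "\<eta> = end_class Y dY u"
      using boundary_class_eq[OF hsY \<eta>] by auto
    then have uY: "range u \<subseteq> Y" and uu: "asymptotic Y dY u u" by (auto simp: gromov_sequences_def)
    have "\<forall>n. \<exists>q\<in>?O. dY (u n) (\<iota> q) \<le> C + R + 3" using dense_orbit uY by (simp add: image_subset_iff)
    then obtain v where v: "\<And>n. v n \<in> ?O" "\<And>n. dY (u n) (\<iota> (v n)) \<le> C + R + 3" by metis
    then have vM: "range v \<subseteq> M" using OM by auto
    then have vY: "range (\<iota> \<circ> v) \<subseteq> Y" using \<iota>Y by auto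
    have near: "dY (u n) ((\<iota> \<circ> v) n) \<le> C + R + 3" for n using v by simp
    have vu: "asymptotic Y dY (\<iota> \<circ> v) u"
      by (rule asymptotic_bounded_distance[OF MSY uY vY uY near uu])
    have uv: "asymptotic Y dY u (\<iota> \<circ> v)" by (rule asymptotic_sym[OF MSY vu])
    have "asymptotic Y dY (\<iota> \<circ> v) (\<iota> \<circ> v)"
      by (rule asymptotic_bounded_distance[OF MSY uY vY vY near uv])
    then have vS: "v \<in> S" using asY[OF vM vM] v by (auto simp: S_def)
    then have "\<eta> = \<kappa> v" unfolding u(2) \<kappa>_def using end_class_eq_iff[OF hsY u(1) gsY[OF vS]] uv by simp
    then show "\<eta> \<in> \<kappa> ` S" using vS by blast
  qed
  have limY: "limit_set G Y dY \<psi> = \<kappa> ` S"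
  proof
    show "limit_set G Y dY \<psi> \<subseteq> \<kappa> ` S" using bdY by (auto simp: limit_set_def)
    show "\<kappa> ` S \<subseteq> limit_set G Y dY \<psi>"
    proof clarify
      fix v assume v: "v \<in> S"
      have "range (\<iota> \<circ> v) \<subseteq> orbit G \<psi> (\<iota> p)" using v orbit\<iota> by (auto simp: S_def)
      then show "\<kappa> v \<in> limit_set G Y dY \<psi>"
        unfolding limit_set_def \<kappa>_def
        using end_class_in_boundary[OF gsY[OF v]] in_end_class_self[OF gsY[OF v]] \<iota>Y[OF p] by blast
    qed
  qed
  have axisS: "pos \<in> S" "neg \<in> S"
    using axis_in_orbit CA.pos_asymptotic_cone_dist CA.neg_asymptotic_cone_dist by (auto simp: S_def)
  have fixY: "fixes_boundary_point G Y dY \<psi> \<longleftrightarrow> (\<exists>v\<in>S. \<forall>g\<in>carrier G. cls (\<phi> g \<circ> v) = cls v)"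
  proof
    assume "fixes_boundary_point G Y dY \<psi>"
    then obtain \<eta> where \<eta>: "\<eta> \<in> gromov_boundary Y dY" "\<forall>g\<in>carrier G. (\<lambda>u. \<psi> g \<circ> u) ` \<eta> = \<eta>"
      unfolding fixes_boundary_point_def by (elim bexE)
    obtain v where "v \<in> S" "\<eta> = \<kappa> v" using bdY \<eta>(1) by blast
    with \<eta>(2) have v: "v \<in> S" "\<And>g. g \<in> carrier G \<Longrightarrow> (\<lambda>u. \<psi> g \<circ> u) ` \<kappa> v = \<kappa> v"
      by simp_all
    have "cls (\<phi> g \<circ> v) = cls v" if g: "g \<in> carrier G" for g
      using \<kappa>_act[OF g v(1)] v(2)[OF g] kernel[OF S_act[OF g v(1)] v(1)] by simp
    then show "\<exists>v\<in>S. \<forall>g\<in>carrier G. cls (\<phi> g \<circ> v) = cls v" using v(1) by blast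
  next
    assume "\<exists>v\<in>S. \<forall>g\<in>carrier G. cls (\<phi> g \<circ> v) = cls v"
    then obtain v where v: "v \<in> S" "\<And>g. g \<in> carrier G \<Longrightarrow> cls (\<phi> g \<circ> v) = cls v" by blast
    have "\<kappa> v \<in> gromov_boundary Y dY" unfolding \<kappa>_def by (rule end_class_in_boundary[OF gsY[OF v(1)]])
    moreover have "(\<lambda>u. \<psi> g \<circ> u) ` \<kappa> v = \<kappa> v" if g: "g \<in> carrier G" for g
      using \<kappa>_act[OF g v(1)] v(2)[OF g] kernel[OF S_act[OF g v(1)] v(1)] by simp
    ultimately show "fixes_boundary_point G Y dY \<psi>"
      unfolding fixes_boundary_point_def by blast
  qed
  \<comment> \<open>A fixed class of the original boundary need not come from \<open>S\<close> a
    priori, but it is an end of \<open>f\<close>, and \<open>pos\<close> and \<open>neg\<close>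
    belong to \<open>S\<close>.\<close>
  have fix_eq: "fixes_boundary_point G Y dY \<psi> \<longleftrightarrow> fixes_boundary_point G M d \<phi>"
    unfolding fixY fixes_boundary_point_iff
  proof
    assume "\<exists>u\<in>GS. \<forall>g\<in>carrier G. cls (\<phi> g \<circ> u) = cls u"
    then obtain u where u: "u \<in> GS" "\<And>g. g \<in> carrier G \<Longrightarrow> cls (\<phi> g \<circ> u) = cls u" by blast
    have "cls u \<in> {cls pos, cls neg}" using fixed_by_power[OF u(1), of 1] u(2) f by simp
    then obtain v where v: "v \<in> S" "cls v = cls u" using axisS by auto
    then have "cls (\<phi> g \<circ> v) = cls v" if "g \<in> carrier G" for g
      using cls_act_cong[OF v(2) SGS[OF v(1)] u(1) that] u(2)[OF that] by simp
    then show "\<exists>v\<in>S. \<forall>g\<in>carrier G. cls (\<phi> g \<circ> v) = cls v" using v by blast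
  qed (use SGS in blast)
  obtain J where J: "bij_betw J (\<kappa> ` S) (cls ` S)" using kernel_bij[of S \<kappa> cls] kernel by blast
  have "\<exists>\<tau>. has_action_type G M d \<phi> \<tau> \<and> has_action_type G Y dY \<psi> \<tau>"
  \<comment> \<open>The dichotomy concerns the image of \<open>S\<close> under \<open>cls\<close>,
    which may be smaller than the original limit set. If it is just the pair of ends, invariance of
    \<open>S\<close> under \<open>G\<close> shows that \<open>G\<close> preserves this pair, and the
    original limit set is that pair too. Otherwise both limit sets are infinite and
    \<open>fix_eq\<close> tells focal from general type.\<close>
  proof (cases "cls ` S \<subseteq> {cls pos, cls neg}")
    case True
    then have eq: "cls ` S = {cls pos, cls neg}" using axisS by blast
    have "card (limit_set G Y dY \<psi>) = 2"
      unfolding limY bij_betw_same_card[OF J] eq using cls_pos_neg by simp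
    moreover have "limit_set G M d \<phi> = {cls pos, cls neg}"
      using True S_act axisS by (intro limit_set_if_axis_preserved) blast
    then have "card (limit_set G M d \<phi>) = 2" using cls_pos_neg by simp
    ultimately show ?thesis by (intro exI[of _ Lineal]) simp
  next
    case False
    then obtain v where v: "v \<in> S" "cls v \<notin> {cls pos, cls neg}" by blast
    have "infinite (cls ` S)"
    proof (rule infinite_if_third_end[OF _ SGS[OF v(1)] _ v(2)])
      fix u g assume u: "u \<in> GS" "cls u \<in> cls ` S" and g: "g \<in> carrier G"
      then obtain w where w: "w \<in> S" "cls u = cls w" by blast
      then have "cls (\<phi> g \<circ> u) = cls (\<phi> g \<circ> w)" using cls_act_cong u(1) SGS g by blast
      then show "cls (\<phi> g \<circ> u) \<in> cls ` S" using S_act[OF g w(1)] by blast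
    qed (use v in blast)
    moreover have "cls ` S \<subseteq> limit_set G M d \<phi>"
      unfolding limit_set_alt using SGS by (auto simp: S_def)
    ultimately have "infinite (limit_set G M d \<phi>)" "infinite (limit_set G Y dY \<psi>)"
      unfolding limY using bij_betw_finite[OF J] finite_subset by blast+
    then show ?thesis
      using fix_eq by (cases "fixes_boundary_point G M d \<phi>")
        (auto intro: exI[of _ Focal] exI[of _ General_Type])
  qed
  then show ?thesis using hsY actY cob by blast
qed

text \<open>The elliptic case. On a one-point space all Gromov products vanish, so no sequence
  converges to infinity and the boundary is empty.\<close>

lemma trivial_model:
  fixes G :: "('g, 'm) monoid_scheme"
  assumes "group G"
  shows "\<exists>(Y :: 'y set set) dY \<psi>. hyperbolic_space Y dY \<and> isometric_action G Y dY \<psi> \<and>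
    cobounded_action G Y dY \<psi> \<and> has_action_type G Y dY \<psi> Elliptic"
proof -
  define Y :: "'y set set" where "Y = {{}}"
  define dY :: "'y set \<Rightarrow> 'y set \<Rightarrow> real" where "dY = (\<lambda>_ _. 0)"
  define \<psi> :: "'g \<Rightarrow> 'y set \<Rightarrow> 'y set" where "\<psi> = (\<lambda>g. restrict id Y)"
  have gp: "gromov_product dY w u v = 0" for w u v by (simp add: gromov_product_def dY_def)
  have MS: "Metric_space Y dY" by unfold_locales (auto simp: Y_def dY_def)
  have geo: "geodesic_space Y dY" by (auto simp: geodesic_space_def Y_def dY_def)
  have "gromov_hyperbolic Y dY" unfolding gromov_hyperbolic_def gp by (intro exI[of _ 0]) auto
  then have hs: "hyperbolic_space Y dY" using MS geo by (simp add: hyperbolic_space_def Y_def)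
  have act: "isometric_action G Y dY \<psi>"
    unfolding isometric_action_def using assms by (auto simp: \<psi>_def dY_def intro!: group_actionI)
  have "orbit G \<psi> {} = Y"
    using group.is_monoid[OF assms] monoid.one_closed by (fastforce simp: orbit_def \<psi>_def Y_def)
  then have cob: "cobounded_action G Y dY \<psi>"
    unfolding cobounded_action_def finite_hausdorff_distance_def
    by (intro bexI[of _ "{}"] exI[of _ 0]) (auto simp: dY_def Y_def)
  have "\<not> asymptotic Y dY u v" for u v
    unfolding asymptotic_iff gp by (auto simp: Y_def intro: exI[of _ 1])
  then have "gromov_sequences Y dY = {}" by (simp add: gromov_sequences_def)
  then have "limit_set G Y dY \<psi> = {}" by (simp add: limit_set_def gromov_boundary_def)
  then show ?thesis using hs act cob by (intro exI[of _ Y] exI[of _ dY] exI[of _ \<psi>]) simp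
qed

theorem corollaryA3:
  fixes G :: "('g, 'm) monoid_scheme"
    and X :: "'x set" and dX :: "'x \<Rightarrow> 'x \<Rightarrow> real" and \<phi> :: "'g \<Rightarrow> 'x \<Rightarrow> 'x"
  assumes "hyperbolic_space X dX"
    and "isometric_action G X dX \<phi>"
    and "\<not> has_action_type G X dX \<phi> Horocyclic"
  shows "\<exists>(Y :: ('g \<times> 'x \<times> real) set set) dY \<psi>.
           hyperbolic_space Y dY \<and> isometric_action G Y dY \<psi> \<and> cobounded_action G Y dY \<psi> \<and>
           (\<exists>\<tau>. has_action_type G X dX \<phi> \<tau> \<and> has_action_type G Y dY \<psi> \<tau>)"
proof -
  obtain \<delta> where "geodesic_hyperbolic_metric X dX \<delta>"
    using hyperbolic_space_imp_geodesic_hyperbolic_metric[OF assms(1)] .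
  then interpret hyperbolic_action X dX \<delta> G \<phi>
    using assms(2) by (simp add: hyperbolic_action_def hyperbolic_action_axioms_def)
  show ?thesis
  proof (cases "limit_set G X dX \<phi> = {}")
    case True
    then have "has_action_type G X dX \<phi> Elliptic" by simp
    then show ?thesis using trivial_model[OF is_group] by blast
  next
    case False
    then obtain \<xi> where \<xi>: "\<xi> \<in> limit_set G X dX \<phi>" by blast
    have "limit_set G X dX \<phi> \<noteq> {\<xi>}" using assms(3) by auto
    then obtain \<eta> where \<eta>: "\<eta> \<in> limit_set G X dX \<phi>" "\<eta> \<noteq> \<xi>" using \<xi> by blast
    obtain p where p: "p \<in> X" using assms(1) by (auto simp: hyperbolic_space_def)
    \<comment> \<open>\<open>limit_set\<close> allows a different orbit for each limit point. Both
      are represented in the orbit of the same \<open>p\<close>, as \<open>loxodromic_exists\<close>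
      demands.\<close>
    obtain u where u: "\<xi> \<in> gromov_boundary X dX" "u \<in> \<xi>" "range u \<subseteq> orbit G \<phi> p"
      using \<xi> unfolding limit_set_eq_orbit[OF assms(1,2) p] by blast
    obtain v where v: "\<eta> \<in> gromov_boundary X dX" "v \<in> \<eta>" "range v \<subseteq> orbit G \<phi> p"
      using \<eta>(1) unfolding limit_set_eq_orbit[OF assms(1,2) p] by blast
    note uv = boundary_class_eq[OF assms(1) u(1,2)] boundary_class_eq[OF assms(1) v(1,2)]
    have "\<not> asymptotic X dX u v" using end_class_eq_iff[OF assms(1) uv(1,3)] uv \<eta>(2) by simp
    then obtain f where f: "f \<in> carrier G"
      "2 * gp p (\<phi> (inv\<^bsub>G\<^esub> f) p) (\<phi> f p) + 4 * \<delta> + 1 \<le> dX p (\<phi> f p)"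
      using loxodromic_exists[OF p uv(1) u(3) uv(3) v(3)] by blast
    interpret loxodromic_action X dX \<delta> G \<phi> f p "gp p (\<phi> (inv\<^bsub>G\<^esub> f) p) (\<phi> f p)"
      using f(1) p quasi_axis_of[OF f(1) p f(2)] assms(1)
      by (intro loxodromic_action.intro loxodromic_action_axioms.intro hyperbolic_action_axioms)
    show ?thesis by (rule cobounded_model)
  qed
qed

end
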